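(* Let $t_0,t_1,\dots,t_6\in\mathbb{C}[[q]]$ be the formal power series solution of the differential system displayed in the context, with $t_{0,0}=\frac15$, $t_{0,1}=24$, $t_{4,0}=0$ and $t_{5,0}\neq0$. Then $t_0,t_1,\dots,t_6$ are algebraically independent over $\mathbb{C}$: there is no nonzero polynomial $P$ in seven variables with coefficients in $\mathbb{C}$ such that $P(t_0,t_1,\dots,t_6)=0$.
   Context: Write $\dot t=5q\frac{\partial t}{\partial q}$. The differential system is $$\begin{aligned} \dot t_0&=\tfrac{1}{t_5}\left(\tfrac{6}{5}t_0^5+\tfrac{1}{3125}t_0t_3-\tfrac{1}{5}t_4\right)\\ \dot t_1&=\tfrac{1}{t_5}\left(-125t_0^6+t_0^4t_1+125t_0t_4+\tfrac{1}{3125}t_1t_3\right)\\ \dot t_2&=\tfrac{1}{t_5}\left(-1875t_0^7-\tfrac{1}{5}t_0^5t_1+2t_0^4t_2+1875t_0^2t_4+\tfrac{1}{5}t_1t_4+\tfrac{2}{3125}t_2t_3\right)\\ \dot t_3&=\tfrac{1}{t_5}\left(-3125t_0^8-\tfrac{1}{5}t_0^5t_2+3t_0^4t_3+3125t_0^3t_4+\tfrac{1}{5}t_2t_4+\tfrac{3}{3125}t_3^2\right)\\ \dot t_4&=\tfrac{1}{t_5}\left(5t_0^4t_4+\tfrac{1}{625}t_3t_4\right)\\ \dot t_5&=\tfrac{t_6}{t_5}\\ \dot t_6&=\left(-\tfrac{72}{5}t_0^8-\tfrac{24}{3125}t_0^4t_3-\tfrac{3}{5}t_0^3t_4-\tfrac{2}{1953125}t_3^2\right)+\tfrac{t_6}{t_5}\left(12t_0^4+\tfrac{2}{625}t_3\right)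 \end{aligned}$$ Write $t_i=\sum_{n\ge0}t_{i,n}q^n$. The conditions $t_{0,0}=\frac15$, $t_{0,1}=24$, $t_{4,0}=0$, $t_{5,0}\ne0$ determine all coefficients $t_{i,n}$ uniquely (in particular $t_{5,0}=-\frac1{3125}$). *)

theory Defs
  imports "HOL-Computational_Algebra.Formal_Power_Series" "HOL-Library.Poly_Mapping"
begin

text \<open>
  A polynomial with coefficients in \<open>'a\<close> and indeterminates indexed by \<open>'i\<close> is an
  element of \<open>('i \<Rightarrow>\<^sub>0 nat) \<Rightarrow>\<^sub>0 'a\<close>: a finitely supported map from exponent vectors to
  coefficients. It is evaluated at a family of formal power series, the coefficients
  being regarded as constant series.
\<close>

definition poly_indets :: "(('i \<Rightarrow>\<^sub>0 nat) \<Rightarrow>\<^sub>0 'a::zero) \<Rightarrow> 'i set" where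
  "poly_indets P = (\<Union>m\<in>Poly_Mapping.keys P. Poly_Mapping.keys m)"

definition poly_eval_fps :: "('i \<Rightarrow> 'a fps) \<Rightarrow> (('i \<Rightarrow>\<^sub>0 nat) \<Rightarrow>\<^sub>0 'a::comm_ring_1) \<Rightarrow> 'a fps" where
  "poly_eval_fps f P =
     (\<Sum>m\<in>Poly_Mapping.keys P. fps_const (Poly_Mapping.lookup P m) *
        (\<Prod>i\<in>Poly_Mapping.keys m. f i ^ Poly_Mapping.lookup m i))"

definition algebraically_independent_fps :: "'i set \<Rightarrow> ('i \<Rightarrow> 'a::comm_ring_1 fps) \<Rightarrow> bool" where
  "algebraically_independent_fps I f \<longleftrightarrow>
     \<not> (\<exists>P :: ('i \<Rightarrow>\<^sub>0 nat) \<Rightarrow>\<^sub>0 'a. poly_indets P \<subseteq> I \<and> P \<noteq> 0 \<and> poly_eval_fps f P = 0)"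

definition qderiv5 :: "complex fps \<Rightarrow> complex fps" where
  "qderiv5 f = 5 * fps_X * fps_deriv f"

text \<open>
  In the system below, a rational coefficient \<open>a/b\<close> is the constant series
  \<open>fps_const (a/b)\<close>, while division by \<open>t 5\<close> is division of formal power series. The latter
  is multiplication by the inverse series when the constant term of \<open>t 5\<close> is nonzero, so the
  predicate is only meant to be used together with that condition.
\<close>

definition dwork_system :: "(nat \<Rightarrow> complex fps) \<Rightarrow> bool" where
  "dwork_system t \<longleftrightarrow>
     qderiv5 (t 0) = (1 / t 5) *
       (fps_const (6/5) * t 0 ^ 5 + fps_const (1/3125) * t 0 * t 3 - fps_const (1/5) * t 4) \<and>
     qderiv5 (t 1) = (1 / t 5) *
       (- 125 * t 0 ^ 6 + t 0 ^ 4 * t 1 + 125 * t 0 * t 4 + fps_const (1/3125) * t 1 * t 3) \<and>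
     qderiv5 (t 2) = (1 / t 5) *
       (- 1875 * t 0 ^ 7 - fps_const (1/5) * t 0 ^ 5 * t 1 + 2 * t 0 ^ 4 * t 2
        + 1875 * t 0 ^ 2 * t 4 + fps_const (1/5) * t 1 * t 4 + fps_const (2/3125) * t 2 * t 3) \<and>
     qderiv5 (t 3) = (1 / t 5) *
       (- 3125 * t 0 ^ 8 - fps_const (1/5) * t 0 ^ 5 * t 2 + 3 * t 0 ^ 4 * t 3
        + 3125 * t 0 ^ 3 * t 4 + fps_const (1/5) * t 2 * t 4 + fps_const (3/3125) * t 3 ^ 2) \<and>
     qderiv5 (t 4) = (1 / t 5) *
       (5 * t 0 ^ 4 * t 4 + fps_const (1/625) * t 3 * t 4) \<and>
     qderiv5 (t 5) = t 6 / t 5 \<and>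
     qderiv5 (t 6) =
       (- fps_const (72/5) * t 0 ^ 8 - fps_const (24/3125) * t 0 ^ 4 * t 3
        - fps_const (3/5) * t 0 ^ 3 * t 4 - fps_const (2/1953125) * t 3 ^ 2)
       + (t 6 / t 5) * (12 * t 0 ^ 4 + fps_const (2/625) * t 3)"

end

theory Submission
  imports Defs "HOL-Analysis.Analysis"
begin

text \<open>
  With \<open>z = t\<^sub>4 / t\<^sub>0\<^sup>5\<close> and \<open>\<theta> = z d/dz\<close> the system says that \<open>y = 5 t\<^sub>0\<close> solves the Picard-Fuchs equation of
  the mirror quintic, that \<open>t\<^sub>1, t\<^sub>2, t\<^sub>3\<close> are polynomials in \<open>z, y, \<theta>y, \<theta>\<^sup>2y, \<theta>\<^sup>3y\<close>, and that
  \<open>t\<^sub>5, t\<^sub>6\<close> are given by \<open>W = y \<theta>y' - y' \<theta>y\<close> and \<open>\<theta>W\<close>, where \<open>y'\<close> is the solution with a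
  simple logarithm. Hence a polynomial relation between the \<open>t\<^sub>i\<close> is a relation between two solutions and
  their derivatives, holding on the lens where the unit discs about \<open>0\<close> and \<open>1\<close> overlap. As \<open>log z\<close>
  and \<open>log (1 - z)\<close> are transcendental over the convergent power series at \<open>0\<close> and \<open>1\<close>, the relation
  survives when the logarithm is shifted by an arbitrary constant, that is, when the pair of solutions is moved by
  the one-parameter groups through the maximally unipotent monodromy at \<open>0\<close> and the symplectic reflection
  at \<open>1\<close>. The directions along which symplectic transvections preserve the relation form a subspace
  stable under the former group. It contains the vanishing cycle, which is a cyclic vector because the holomorphic
  solution is singular at \<open>1\<close>, so it is everything. Transvections act transitively on independent
  isotropic pairs, and these realise all values of \<open>t\<^sub>0, \<dots>, t\<^sub>6\<close> on a product of infinite sets, where the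
  polynomial therefore vanishes.
\<close>

text \<open>The monodromy group is discrete and is usually reached by analytic continuation. Here
  nothing leaves the lens: the bases at 0 and at 1 both converge there, and an identity that is
  polynomial in convergent series and a logarithm stays true when the logarithm becomes a free
  variable. So each local monodromy enters at once as a full one-parameter group. Of the connection
  matrix only its invertibility and one nonvanishing pairing enter, that of the vanishing cycle with
  the holomorphic solution. The number seven is a dimension count: z, the four entries of
  \<open>Y\<close>, and \<open>W\<close>, \<open>W1\<close>. The last two fix a second solution
  isotropic to \<open>Y\<close> up to multiples of \<open>Y\<close>, which leave all seven functions
  unchanged. Isotropy is also what expresses \<theta>^2 W by the other functions, so that the
  equation for t_6 closes the system.\<close>

section \<open>Polynomials that vanish on a product of infinite sets\<close>

definition meval :: "(('i \<Rightarrow>\<^sub>0 nat) \<Rightarrow>\<^sub>0 'a::comm_ring_1) \<Rightarrow> ('i \<Rightarrow> 'a) \<Rightarrow> 'a" where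
  "meval P x = (\<Sum>m\<in>Poly_Mapping.keys P. Poly_Mapping.lookup P m *
     (\<Prod>i\<in>Poly_Mapping.keys m. x i ^ Poly_Mapping.lookup m i))"

text \<open>Induction on the variables. Monomials are abstract indices with exponents
  \<open>e m\<close>, so that the induction hypothesis applies to those that share the exponent of
  the removed variable \<open>i\<close>. With the other variables fixed the sum is a univariate
  polynomial with infinitely many roots, so each of its coefficients vanishes.\<close>

lemma vanishing_exponent_sum:
  fixes A :: "'i \<Rightarrow> 'a::idom set" and e :: "'m \<Rightarrow> 'i \<Rightarrow> nat"
  assumes "finite I" "finite M"
    and "\<And>m m'. m \<in> M \<Longrightarrow> m' \<in> M \<Longrightarrow> (\<And>i. i \<in> I \<Longrightarrow> e m i = e m' i) \<Longrightarrow> m = m'"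
    and "\<And>i. i \<in> I \<Longrightarrow> infinite (A i)"
    and "\<And>x. (\<And>i. i \<in> I \<Longrightarrow> x i \<in> A i) \<Longrightarrow> (\<Sum>m\<in>M. c m * (\<Prod>i\<in>I. x i ^ e m i)) = 0"
    and "m \<in> M"
  shows "c m = 0"
  using assms
proof (induction I arbitrary: M m rule: finite_induct)
  case empty
  have "M = {m}" using empty.prems(2)[of _ m] empty.prems(5) by blast
  with empty.prems(4)[of "\<lambda>_. 0"] show ?case by simp
next
  case (insert i I)
  define M' where "M' = {m' \<in> M. e m' i = e m i}"
  show ?case
  proof (rule insert.IH[of M'])
    show "finite M'" using insert.prems by (simp add: M'_def)
    show "m \<in> M'" using insert.prems by (simp add: M'_def)
    show "infinite (A j)" if "j \<in> I" for j using insert.prems that by auto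
    show "m1 = m2" if "m1 \<in> M'" "m2 \<in> M'" "\<And>j. j \<in> I \<Longrightarrow> e m1 j = e m2 j" for m1 m2
      by (rule insert.prems(2)) (use that in \<open>auto simp: M'_def\<close>)
    show "(\<Sum>m\<in>M'. c m * (\<Prod>j\<in>I. x j ^ e m j)) = 0" if x: "\<And>j. j \<in> I \<Longrightarrow> x j \<in> A j" for x
    proof -
      define p where "p = (\<Sum>m\<in>M. monom (c m * (\<Prod>j\<in>I. x j ^ e m j)) (e m i))"
      have root: "poly p y = 0" if "y \<in> A i" for y
      proof -
        have eq: "(\<Prod>j\<in>insert i I. (x(i := y)) j ^ k j) = (\<Prod>j\<in>I. x j ^ k j) * y ^ k i" for k
        proof -
          have "(\<Prod>j\<in>I. (x(i := y)) j ^ k j) = (\<Prod>j\<in>I. x j ^ k j)"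
            using insert.hyps by (intro prod.cong) auto
          then show ?thesis using insert.hyps by (simp add: mult.commute)
        qed
        have "(\<Sum>m\<in>M. c m * (\<Prod>j\<in>insert i I. (x(i := y)) j ^ e m j)) = 0"
          using that x by (intro insert.prems(4)) auto
        then show ?thesis unfolding eq p_def by (simp add: poly_sum poly_monom mult.assoc)
      qed
      have "p = 0"
      proof (rule ccontr)
        assume "p \<noteq> 0"
        then have "finite {y. poly p y = 0}" by (rule poly_roots_finite)
        moreover have "A i \<subseteq> {y. poly p y = 0}" using root by auto
        ultimately show False using insert.prems(3)[of i] finite_subset by blast
      qed
      then have "coeff p (e m i) = 0" by simp
      then show ?thesis using insert.prems(1)
        by (simp add: p_def coeff_sum M'_def sum.inter_filter)
    qed
  qed
qed

lemma meval_eq_0_imp_eq_0: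
  fixes P :: "('i \<Rightarrow>\<^sub>0 nat) \<Rightarrow>\<^sub>0 'a::idom"
  assumes "finite I" "poly_indets P \<subseteq> I" "\<And>i. i \<in> I \<Longrightarrow> infinite (A i)"
    and "\<And>x. (\<And>i. i \<in> I \<Longrightarrow> x i \<in> A i) \<Longrightarrow> meval P x = 0"
  shows "P = 0"
proof (rule poly_mapping_eqI)
  fix m
  have sub: "Poly_Mapping.keys m \<subseteq> I" if "m \<in> Poly_Mapping.keys P" for m
    using assms(2) that by (auto simp: poly_indets_def)
  have "Poly_Mapping.lookup P m = 0" if "m \<in> Poly_Mapping.keys P"
  proof (rule vanishing_exponent_sum[of I "Poly_Mapping.keys P" Poly_Mapping.lookup A "Poly_Mapping.lookup P"])
    fix m1 m2 assume *: "m1 \<in> Poly_Mapping.keys P" "m2 \<in> Poly_Mapping.keys P"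
      "\<And>i. i \<in> I \<Longrightarrow> Poly_Mapping.lookup m1 i = Poly_Mapping.lookup m2 i"
    show "m1 = m2"
    proof (rule poly_mapping_eqI)
      fix i show "Poly_Mapping.lookup m1 i = Poly_Mapping.lookup m2 i"
        using * sub[of m1] sub[of m2] by (cases "i \<in> I") (auto, metis in_keys_iff subsetD)
    qed
  next
    fix x assume x: "\<And>i. i \<in> I \<Longrightarrow> x i \<in> A i"
    have "(\<Prod>i\<in>I. x i ^ Poly_Mapping.lookup m i) = (\<Prod>i\<in>Poly_Mapping.keys m. x i ^ Poly_Mapping.lookup m i)"
      if "m \<in> Poly_Mapping.keys P" for m
      using sub[OF that] assms(1) by (intro prod.mono_neutral_right) (auto simp: in_keys_iff)
    with assms(4)[OF x]
    show "(\<Sum>m\<in>Poly_Mapping.keys P. Poly_Mapping.lookup P m * (\<Prod>i\<in>I. x i ^ Poly_Mapping.lookup m i)) = 0"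
      by (simp add: meval_def)
  qed (use assms that in auto)
  then show "Poly_Mapping.lookup P m = Poly_Mapping.lookup 0 m"
    by (cases "m \<in> Poly_Mapping.keys P") (auto simp: in_keys_iff)
qed

section \<open>Evaluation of polynomials at convergent power series\<close>

lemma
  fixes f :: "'i \<Rightarrow> 'a::{banach, real_normed_field} fps"
  assumes "\<And>i. r \<le> fps_conv_radius (f i)"
  shows fps_conv_radius_poly_eval: "r \<le> fps_conv_radius (poly_eval_fps f P)"
    and eval_fps_poly_eval: "ereal (norm x) < r \<Longrightarrow>
           eval_fps (poly_eval_fps f P) x = meval P (\<lambda>i. eval_fps (f i) x)"
proof -
  have pw: "r \<le> fps_conv_radius (f i ^ n)" for i n
    using order.trans[OF assms fps_conv_radius_power] .
  have pr: "r \<le> fps_conv_radius (\<Prod>i\<in>I. f i ^ k i) \<and> (ereal (norm x) < r \<longrightarrow>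
      eval_fps (\<Prod>i\<in>I. f i ^ k i) x = (\<Prod>i\<in>I. eval_fps (f i) x ^ k i))" if "finite I" for I k
    using that
  proof induction
    case (insert i I)
    have "r \<le> min (fps_conv_radius (f i ^ k i)) (fps_conv_radius (\<Prod>i\<in>I. f i ^ k i))"
      using insert pw by simp
    moreover have "eval_fps (f i ^ k i * (\<Prod>i\<in>I. f i ^ k i)) x =
        eval_fps (f i) x ^ k i * (\<Prod>i\<in>I. eval_fps (f i) x ^ k i)" if "ereal (norm x) < r"
      using insert.IH that less_le_trans[OF that pw] less_le_trans[OF that assms]
      by (subst eval_fps_mult) (auto simp: eval_fps_power intro: less_le_trans)
    ultimately show ?case using insert.hyps order.trans[OF _ fps_conv_radius_mult] by auto
  qed auto
  have tm: "r \<le> fps_conv_radius (fps_const c * (\<Prod>i\<in>I. f i ^ k i)) \<and> (ereal (norm x) < r \<longrightarrow>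
      eval_fps (fps_const c * (\<Prod>i\<in>I. f i ^ k i)) x = c * (\<Prod>i\<in>I. eval_fps (f i) x ^ k i))"
    if "finite I" for I k c
  proof -
    have "r \<le> min (fps_conv_radius (fps_const c)) (fps_conv_radius (\<Prod>i\<in>I. f i ^ k i))"
      using pr[OF that] by simp
    then have "r \<le> fps_conv_radius (fps_const c * (\<Prod>i\<in>I. f i ^ k i))"
      using fps_conv_radius_mult order.trans by blast
    moreover have "eval_fps (fps_const c * (\<Prod>i\<in>I. f i ^ k i)) x = c * (\<Prod>i\<in>I. eval_fps (f i) x ^ k i)"
      if "ereal (norm x) < r"
      using pr[OF \<open>finite I\<close>] that by (subst eval_fps_mult) (auto intro: less_le_trans)
    ultimately show ?thesis by blast
  qed
  have sm: "r \<le> fps_conv_radius (\<Sum>m\<in>M. fps_const (c m) * (\<Prod>i\<in>K m. f i ^ k m i)) \<and>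
     (ereal (norm x) < r \<longrightarrow> eval_fps (\<Sum>m\<in>M. fps_const (c m) * (\<Prod>i\<in>K m. f i ^ k m i)) x =
        (\<Sum>m\<in>M. c m * (\<Prod>i\<in>K m. eval_fps (f i) x ^ k m i)))" if fin: "finite M" "\<And>m. finite (K m)" for M c k K
    using fin(1)
  proof induction
    case (insert m M)
    have "r \<le> min (fps_conv_radius (fps_const (c m) * (\<Prod>i\<in>K m. f i ^ k m i)))
         (fps_conv_radius (\<Sum>m\<in>M. fps_const (c m) * (\<Prod>i\<in>K m. f i ^ k m i)))"
      using insert.IH tm[OF fin(2)[of m], where c = "c m" and k = "k m"] by simp
    then have a: "r \<le> fps_conv_radius (\<Sum>m\<in>insert m M. fps_const (c m) * (\<Prod>i\<in>K m. f i ^ k m i))"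
      using insert.hyps order.trans[OF _ fps_conv_radius_add] by simp
    have "eval_fps (\<Sum>m\<in>insert m M. fps_const (c m) * (\<Prod>i\<in>K m. f i ^ k m i)) x =
        (\<Sum>m\<in>insert m M. c m * (\<Prod>i\<in>K m. eval_fps (f i) x ^ k m i))" if r: "ereal (norm x) < r"
      using insert.hyps insert.IH r tm[OF fin(2)[of m], where c = "c m" and k = "k m"]
      by simp (subst eval_fps_add, auto intro: less_le_trans)
    with a show ?case by blast
  qed auto
  show "r \<le> fps_conv_radius (poly_eval_fps f P)"
    using sm[of "Poly_Mapping.keys P" "\<lambda>m. Poly_Mapping.keys m"] by (simp add: poly_eval_fps_def)
  show "eval_fps (poly_eval_fps f P) x = meval P (\<lambda>i. eval_fps (f i) x)" if "ereal (norm x) < r"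
    using sm[of "Poly_Mapping.keys P" "\<lambda>m. Poly_Mapping.keys m"] that by (simp add: poly_eval_fps_def meval_def)
qed

section \<open>Functions polynomial in a logarithm\<close>

definition lens :: "complex set" where
  "lens = ball 0 1 \<inter> ball 1 1"

lemma lens_iff: "x \<in> lens \<longleftrightarrow> norm x < 1 \<and> norm (1 - x) < 1"
  by (simp add: lens_def dist_norm norm_minus_commute)

lemma of_real_in_lens: "0 < x \<Longrightarrow> x < 1 \<Longrightarrow> complex_of_real x \<in> lens"
  using norm_of_real[of "1 - x", where ?'a = complex] by (simp add: lens_iff)

lemma lens_one_minus: "x \<in> lens \<Longrightarrow> 1 - x \<in> lens"
  by (auto simp: lens_iff)

lemma lens_neq [simp]: "x \<in> lens \<Longrightarrow> x \<noteq> 0" "x \<in> lens \<Longrightarrow> x \<noteq> 1"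
  by (auto simp: lens_iff)

lemma convex_lens: "convex lens"
  by (auto simp: lens_def intro: convex_Int)

lemma lens_nonpos: "x \<in> lens \<Longrightarrow> x \<notin> \<real>\<^sub>\<le>\<^sub>0"
proof
  assume "x \<in> lens" "x \<in> \<real>\<^sub>\<le>\<^sub>0"
  then obtain r where "x = of_real r" "r \<le> 0" by (auto simp: nonpos_Reals_def)
  with \<open>x \<in> lens\<close> norm_of_real[of "1 - r", where ?'a = complex] show False
    by (simp add: lens_iff)
qed

text \<open>The second argument stands for a logarithm but is free. The factor \<open>x ^ m\<close>
  admits poles at 0, which the logarithmic solution at the conifold point has. Coefficients beyond
  \<open>n\<close> are 0, so that sums can be padded to a common length and multiplied by the Cauchy
  rule.\<close>

definition logpoly :: "(complex \<Rightarrow> complex \<Rightarrow> complex) \<Rightarrow> bool" where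
  "logpoly g \<longleftrightarrow> (\<exists>m n F. (\<forall>k. 1 \<le> fps_conv_radius (F k)) \<and> (\<forall>k>n. F k = 0) \<and>
     (\<forall>x\<in>lens. \<forall>l. x ^ m * g x l = (\<Sum>k\<le>n. eval_fps (F k) x * l ^ k)))"

lemma lens_conv: "x \<in> lens \<Longrightarrow> 1 \<le> fps_conv_radius F \<Longrightarrow> ereal (norm x) < fps_conv_radius F"
  by (rule less_le_trans[of _ 1]) (auto simp: lens_iff)

lemma conv1_intros:
  fixes F G :: "complex fps"
  assumes "1 \<le> fps_conv_radius F" "1 \<le> fps_conv_radius G"
  shows "1 \<le> fps_conv_radius (F + G)" "1 \<le> fps_conv_radius (F - G)" "1 \<le> fps_conv_radius (F * G)"
  using assms fps_conv_radius_add[of F G] fps_conv_radius_diff[of F G] fps_conv_radius_mult[of F G]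
  by (simp_all add: min_def split: if_splits)

lemma lens_eval_fps:
  assumes "x \<in> lens" "1 \<le> fps_conv_radius F" "1 \<le> fps_conv_radius G"
  shows "eval_fps (F + G) x = eval_fps F x + eval_fps G x"
    and "eval_fps (F - G) x = eval_fps F x - eval_fps G x"
    and "eval_fps (F * G) x = eval_fps F x * eval_fps G x"
  using assms by (simp_all add: eval_fps_add eval_fps_diff eval_fps_mult lens_conv)

lemma logpoly_eval_fps:
  assumes "1 \<le> fps_conv_radius F" shows "logpoly (\<lambda>x l. eval_fps F x)"
  unfolding logpoly_def
  by (rule exI[of _ 0], rule exI[of _ 0], rule exI[of _ "\<lambda>k. if k = 0 then F else 0"]) (use assms in auto)

lemma logpoly_const: "logpoly (\<lambda>x l. c)"
  using logpoly_eval_fps[of "fps_const c"] by simp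

lemma logpoly_var: "logpoly (\<lambda>x l. x)"
  using logpoly_eval_fps[of "fps_X"] by simp

lemma logpoly_log: "logpoly (\<lambda>x l. l)"
  unfolding logpoly_def
  by (rule exI[of _ 0], rule exI[of _ 1], rule exI[of _ "\<lambda>k. if k = 1 then 1 else 0"])
    (auto simp: if_distrib[of "\<lambda>F. eval_fps F _ * _"] sum.delta cong: if_cong)

lemma logpoly_inverse: "logpoly (\<lambda>x l. inverse x)"
  unfolding logpoly_def
  by (rule exI[of _ 1], rule exI[of _ 0], rule exI[of _ "\<lambda>k. if k = 0 then 1 else 0"]) auto

lemma logpoly_add:
  assumes "logpoly g" "logpoly h" shows "logpoly (\<lambda>x l. g x l + h x l)"
proof -
  obtain m n F where 1: "\<And>k. 1 \<le> fps_conv_radius (F k)" "\<And>k. k > n \<Longrightarrow> F k = 0"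
     "\<And>x l. x \<in> lens \<Longrightarrow> x ^ m * g x l = (\<Sum>k\<le>n. eval_fps (F k) x * l ^ k)"
    using assms(1) unfolding logpoly_def by metis
  obtain m' n' F' where 2: "\<And>k. 1 \<le> fps_conv_radius (F' k)" "\<And>k. k > n' \<Longrightarrow> F' k = 0"
     "\<And>x l. x \<in> lens \<Longrightarrow> x ^ m' * h x l = (\<Sum>k\<le>n'. eval_fps (F' k) x * l ^ k)"
    using assms(2) unfolding logpoly_def by metis
  let ?G = "\<lambda>k. fps_X ^ m' * F k + fps_X ^ m * F' k"
  have r: "1 \<le> fps_conv_radius (fps_X ^ m' * F k)" "1 \<le> fps_conv_radius (fps_X ^ m * F' k)" for k
    by (auto intro!: conv1_intros 1 2)
  show ?thesis unfolding logpoly_def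
  proof (rule exI[of _ "m + m'"], rule exI[of _ "max n n'"], rule exI[of _ ?G], intro conjI allI ballI impI)
    show "1 \<le> fps_conv_radius (?G k)" for k by (intro conv1_intros(1) r)
    show "?G k = 0" if "k > max n n'" for k using that 1(2) 2(2) by simp
    fix x l assume x: "x \<in> lens"
    have "(\<Sum>k\<le>n. eval_fps (F k) x * l ^ k) = (\<Sum>k\<le>max n n'. eval_fps (F k) x * l ^ k)"
      using 1(2) by (intro sum.mono_neutral_left) auto
    then have a: "(\<Sum>k\<le>max n n'. eval_fps (F k) x * l ^ k) = x ^ m * g x l" using 1(3)[OF x] by simp
    have "(\<Sum>k\<le>n'. eval_fps (F' k) x * l ^ k) = (\<Sum>k\<le>max n n'. eval_fps (F' k) x * l ^ k)"
      using 2(2) by (intro sum.mono_neutral_left) auto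
    then have b: "(\<Sum>k\<le>max n n'. eval_fps (F' k) x * l ^ k) = x ^ m' * h x l" using 2(3)[OF x] by simp
    have e: "eval_fps (?G k) x = x ^ m' * eval_fps (F k) x + x ^ m * eval_fps (F' k) x" for k
      using r 1(1) 2(1) x by (simp add: lens_eval_fps)
    show "x ^ (m + m') * (g x l + h x l) = (\<Sum>k\<le>max n n'. eval_fps (?G k) x * l ^ k)"
      unfolding e ring_distribs sum.distrib mult.assoc sum_distrib_left[symmetric] a b
      by (simp add: power_add algebra_simps)
  qed
qed

lemma logpoly_mult:
  assumes "logpoly g" "logpoly h" shows "logpoly (\<lambda>x l. g x l * h x l)"
proof -
  obtain m n F where 1: "\<And>k. 1 \<le> fps_conv_radius (F k)" "\<And>k. k > n \<Longrightarrow> F k = 0"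
     "\<And>x l. x \<in> lens \<Longrightarrow> x ^ m * g x l = (\<Sum>k\<le>n. eval_fps (F k) x * l ^ k)"
    using assms(1) unfolding logpoly_def by metis
  obtain m' n' F' where 2: "\<And>k. 1 \<le> fps_conv_radius (F' k)" "\<And>k. k > n' \<Longrightarrow> F' k = 0"
     "\<And>x l. x \<in> lens \<Longrightarrow> x ^ m' * h x l = (\<Sum>k\<le>n'. eval_fps (F' k) x * l ^ k)"
    using assms(2) unfolding logpoly_def by metis
  let ?G = "\<lambda>k. \<Sum>i\<le>k. F i * F' (k - i)"
  have r: "1 \<le> fps_conv_radius (\<Sum>i\<in>I. F i * F' (k - i)) \<and> (x \<in> lens \<longrightarrow>
      eval_fps (\<Sum>i\<in>I. F i * F' (k - i)) x = (\<Sum>i\<in>I. eval_fps (F i) x * eval_fps (F' (k - i)) x))"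
    if "finite I" for I k x
    using that
    by induction (use 1(1) 2(1) in \<open>auto simp: lens_eval_fps conv1_intros\<close>)
  show ?thesis unfolding logpoly_def
  proof (rule exI[of _ "m + m'"], rule exI[of _ "n + n'"], rule exI[of _ ?G], intro conjI allI ballI impI)
    show "1 \<le> fps_conv_radius (?G k)" for k using r by simp
    show "?G k = 0" if "k > n + n'" for k
    proof (rule sum.neutral, rule ballI)
      fix i show "F i * F' (k - i) = 0" using that 1(2)[of i] 2(2)[of "k - i"] by (cases "i > n") auto
    qed
    fix x l assume x: "x \<in> lens"
    have "x ^ (m + m') * (g x l * h x l) = (\<Sum>k\<le>n. eval_fps (F k) x * l ^ k) * (\<Sum>k\<le>n'. eval_fps (F' k) x * l ^ k)"
      unfolding 1(3)[OF x, symmetric] 2(3)[OF x, symmetric] by (simp add: power_add algebra_simps)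
    also have "\<dots> = (\<Sum>k\<le>n + n'. (\<Sum>i\<le>k. eval_fps (F i) x * eval_fps (F' (k - i)) x) * l ^ k)"
      by (rule polynomial_product) (auto simp: 1(2) 2(2))
    finally show "x ^ (m + m') * (g x l * h x l) = (\<Sum>k\<le>n + n'. eval_fps (?G k) x * l ^ k)"
      using r x by simp
  qed
qed

lemma logpoly_cmult: "logpoly g \<Longrightarrow> logpoly (\<lambda>x l. c * g x l)"
  by (intro logpoly_mult logpoly_const)

lemma logpoly_diff: "logpoly g \<Longrightarrow> logpoly h \<Longrightarrow> logpoly (\<lambda>x l. g x l - h x l)"
  using logpoly_add[OF _ logpoly_cmult[of h "-1"], of g] by simp

lemma logpoly_power: "logpoly g \<Longrightarrow> logpoly (\<lambda>x l. g x l ^ n)"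
  by (induction n) (auto intro: logpoly_const logpoly_mult)

lemma logpoly_sum: "(\<And>i. i \<in> I \<Longrightarrow> logpoly (g i)) \<Longrightarrow> logpoly (\<lambda>x l. \<Sum>i\<in>I. g i x l)"
  by (induction I rule: infinite_finite_induct) (auto intro: logpoly_const logpoly_add)

lemma logpoly_prod: "(\<And>i. i \<in> I \<Longrightarrow> logpoly (g i)) \<Longrightarrow> logpoly (\<lambda>x l. \<Prod>i\<in>I. g i x l)"
  by (induction I rule: infinite_finite_induct) (auto intro: logpoly_const logpoly_mult)

lemma logpoly_meval: "(\<And>i. logpoly (g i)) \<Longrightarrow> logpoly (\<lambda>x l. meval P (\<lambda>i. g i x l))"
  unfolding meval_def by (intro logpoly_sum logpoly_mult logpoly_const logpoly_prod logpoly_power)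

lemmas logpoly_intros = logpoly_const logpoly_var logpoly_log logpoly_inverse logpoly_eval_fps
  logpoly_add logpoly_mult logpoly_diff logpoly_power logpoly_sum

lemma tendsto_power_mult_ln_power_at_right_0:
  "((\<lambda>x::real. x * ln x ^ k) \<longlongrightarrow> 0) (at_right 0)"
  by real_asymp

text \<open>As x tends to 0 from the right, x (ln x)^k tends to 0. Hence the polynomial
  \<open>p\<close> formed by the constant terms tends to 0 at ln x; as ln x is unbounded,
  \<open>p\<close> is zero.\<close>

lemma logpoly_leading_zero:
  fixes F :: "nat \<Rightarrow> complex fps"
  assumes F: "\<And>k. 1 \<le> fps_conv_radius (F k)"
    and zero: "\<And>x. 0 < x \<Longrightarrow> x < 1 \<Longrightarrow>
      (\<Sum>k\<le>n. eval_fps (F k) (of_real x) * of_real (ln x) ^ k) = 0"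
    and "k \<le> n"
  shows "fps_nth (F k) 0 = 0"
proof -
  define p where "p = (\<Sum>k\<le>n. monom (fps_nth (F k) 0) k)"
  have ev: "eval_fps (F k) x = fps_nth (F k) 0 + x * eval_fps (fps_shift 1 (F k)) x"
    if "x \<in> lens" for k x
  proof -
    have "fps_const (fps_nth (F k) 0) + fps_X * fps_shift 1 (F k) = F k"
      by (rule fps_ext) auto
    moreover have "eval_fps (fps_const (fps_nth (F k) 0) + fps_X * fps_shift 1 (F k)) x =
        fps_nth (F k) 0 + x * eval_fps (fps_shift 1 (F k)) x"
      using F that by (simp add: lens_eval_fps conv1_intros)
    ultimately show ?thesis by simp
  qed
  have lim: "((\<lambda>x::real. \<Sum>k\<le>n. eval_fps (fps_shift 1 (F k)) (of_real x) * of_real (x * ln x ^ k)) \<longlongrightarrow>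
      (\<Sum>k\<le>n. eval_fps (fps_shift 1 (F k)) (of_real 0) * of_real 0)) (at_right 0)"
  proof (rule tendsto_sum, rule tendsto_mult)
    fix k
    have "isCont (eval_fps (fps_shift 1 (F k))) (of_real 0)"
    proof (rule continuous_eval_fps)
      show "ereal (norm (complex_of_real 0)) < fps_conv_radius (fps_shift 1 (F k))"
        using F[of k] less_le_trans[of 0 1 "fps_conv_radius (F k)"] by (simp add: zero_ereal_def[symmetric])
    qed
    moreover have "(of_real \<longlongrightarrow> complex_of_real 0) (at_right 0)"
      by (rule tendsto_of_real) (rule tendsto_ident_at)
    ultimately show "((\<lambda>x::real. eval_fps (fps_shift 1 (F k)) (of_real x)) \<longlongrightarrow> eval_fps (fps_shift 1 (F k)) (of_real 0)) (at_right 0)"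
      by (rule isCont_tendsto_compose)
    show "((\<lambda>x::real. complex_of_real (x * ln x ^ k)) \<longlongrightarrow> of_real 0) (at_right 0)"
      by (rule tendsto_of_real) (rule tendsto_power_mult_ln_power_at_right_0)
  qed
  have eq: "poly p (of_real (ln x)) =
     - (\<Sum>k\<le>n. eval_fps (fps_shift 1 (F k)) (of_real x) * of_real (x * ln x ^ k))" if "0 < x" "x < 1" for x :: real
  proof -
    have "complex_of_real x \<in> lens" using that by (rule of_real_in_lens)
    from zero[OF that] show ?thesis
      by (simp add: ev[OF \<open>complex_of_real x \<in> lens\<close>] p_def poly_sum poly_monom ring_distribs sum.distrib
          eq_neg_iff_add_eq_0 mult_ac)
  qed
  have plim: "((\<lambda>x::real. poly p (of_real (ln x))) \<longlongrightarrow> 0) (at_right 0)"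
  proof (rule Lim_transform_eventually)
    show "((\<lambda>x::real. - (\<Sum>k\<le>n. eval_fps (fps_shift 1 (F k)) (of_real x) * of_real (x * ln x ^ k))) \<longlongrightarrow> 0) (at_right 0)"
      using tendsto_minus[OF lim] by simp
    show "\<forall>\<^sub>F x in at_right 0. - (\<Sum>k\<le>n. eval_fps (fps_shift 1 (F k)) (of_real x) * of_real (x * ln x ^ k))
        = poly p (of_real (ln x))"
      by (rule eventually_at_rightI[of 0 1]) (simp_all add: eq)
  qed
  have "p = 0"
  proof (rule ccontr)
    assume p: "p \<noteq> 0"
    show False
    proof (cases "degree p = 0")
      case True
      then obtain c where "p = [:c:]" by (meson degree_eq_zeroE)
      with plim p show False using tendsto_const_iff[of "at_right (0::real)" c 0] by auto
    next
      case False
      have "filterlim (\<lambda>x::real. complex_of_real (ln x)) at_infinity (at_right 0)"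
        unfolding filterlim_at_infinity_conv_norm_at_top norm_of_real by real_asymp
      with False have "filterlim (\<lambda>x::real. poly p (of_real (ln x))) at_infinity (at_right 0)"
        by (intro filterlim_compose[OF filterlim_poly_at_infinity]) auto
      with plim show False
        using not_tendsto_and_filterlim_at_infinity[of "at_right (0::real)"] by force
    qed
  qed
  then have "coeff p k = 0" by simp
  with \<open>k \<le> n\<close> show ?thesis by (simp add: p_def coeff_sum)
qed

text \<open>Transcendence of the logarithm over the convergent series: divide by the lowest power of
  x that occurs in any coefficient, then compare constant terms. This is the replacement for
  analytic continuation, since \<open>l\<close> can afterwards be shifted by any constant.\<close>

lemma logpoly_eq_0:
  assumes "logpoly g" and g0: "\<And>x. x \<in> lens \<Longrightarrow> g x (Ln x) = 0" and "x \<in> lens"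
  shows "g x l = 0"
proof -
  obtain m n F where 1: "\<And>k. 1 \<le> fps_conv_radius (F k)" "\<And>k. k > n \<Longrightarrow> F k = 0"
     "\<And>x l. x \<in> lens \<Longrightarrow> x ^ m * g x l = (\<Sum>k\<le>n. eval_fps (F k) x * l ^ k)"
    using assms(1) unfolding logpoly_def by metis
  have "F k = 0" for k
  proof (rule ccontr)
    assume "F k \<noteq> 0"
    define j where "j = (LEAST j. \<exists>k. fps_nth (F k) j \<noteq> 0)"
    have "\<exists>j k. fps_nth (F k) j \<noteq> 0" using \<open>F k \<noteq> 0\<close> by (auto simp: fps_eq_iff)
    then have "\<exists>k. fps_nth (F k) j \<noteq> 0" unfolding j_def by (rule LeastI_ex)
    then obtain k0 where k0: "fps_nth (F k0) j \<noteq> 0" by blast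
    have low: "fps_nth (F k) i = 0" if "i < j" for i k
      using not_less_Least[of i "\<lambda>j. \<exists>k. fps_nth (F k) j \<noteq> 0"] that unfolding j_def by blast
    have F: "F k = fps_X ^ j * fps_shift j (F k)" for k
      by (rule fps_ext) (auto simp: fps_X_power_mult_nth low)
    have "fps_nth (fps_shift j (F k0)) 0 = 0"
    proof (rule logpoly_leading_zero[of "\<lambda>k. fps_shift j (F k)" n])
      show "k0 \<le> n" using k0 1(2)[of k0] by (rule_tac ccontr) auto
      fix x :: real assume x: "0 < x" "x < 1"
      have xl: "complex_of_real x \<in> lens" using x by (rule of_real_in_lens)
      have e: "eval_fps (F k) y = y ^ j * eval_fps (fps_shift j (F k)) y" if "y \<in> lens" for k y
        using that 1(1) by (subst F) (simp add: lens_eval_fps)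
      have "(\<Sum>k\<le>n. eval_fps (F k) (of_real x) * of_real (ln x) ^ k) = 0"
        using 1(3)[OF xl, of "Ln (of_real x)"] g0[OF xl] x by (simp add: Ln_of_real)
      then have "of_real x ^ j * (\<Sum>k\<le>n. eval_fps (fps_shift j (F k)) (of_real x) * of_real (ln x) ^ k) = 0"
        by (simp add: e[OF xl] sum_distrib_left mult.assoc)
      then show "(\<Sum>k\<le>n. eval_fps (fps_shift j (F k)) (of_real x) * of_real (ln x) ^ k) = 0"
        using x by simp
    qed (use 1(1) in auto)
    with k0 show False by simp
  qed
  then have "x ^ m * g x l = 0" using 1(3)[OF \<open>x \<in> lens\<close>] by simp
  then show ?thesis using \<open>x \<in> lens\<close> by simp
qed

section \<open>A convergence criterion for power series\<close>

text \<open>Coefficients of a Fuchsian system with singular points 0 and 1 obey such an inequality.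
  It reads (n + 1 - K) x_(n+1) \<le> (n + K) x_n, so the ratios are asymptotically at most
  1.\<close>

lemma fps_conv_radius_ge_1:
  fixes f :: "complex fps" and x :: "nat \<Rightarrow> real"
  assumes nonneg: "\<And>n. 0 \<le> x n"
    and step: "\<And>n. (real n + 1) * x (Suc n) \<le> real n * x n + K * (x n + x (Suc n))"
    and bound: "\<And>n. norm (fps_nth f n) \<le> C * x n"
  shows "1 \<le> fps_conv_radius f"
  unfolding fps_conv_radius_def
proof (rule conv_radius_geI_ex')
  fix r :: real assume r: "0 < r" "ereal r < 1"
  then have "r < 1" by simp
  define c where "c = (1 + r) / 2"
  have c: "r < c" "c < 1" using \<open>r < 1\<close> by (auto simp: c_def)
  have "summable (\<lambda>n. x n * r ^ n)"
  proof (rule summable_ratio_test[OF c(2)])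
    \<comment> \<open>Beyond \<open>N\<close> the inequality (n + K) r \<le> c (n + 1 - K) holds,
      with a positive right factor.\<close>
    define N where "N = nat \<lceil>(2 * \<bar>K\<bar> + 2) / (c - r)\<rceil>"
    fix n assume "N \<le> n"
    then have "(2 * \<bar>K\<bar> + 2) / (c - r) \<le> real n" unfolding N_def by linarith
    then have n: "2 * \<bar>K\<bar> + 2 \<le> real n * (c - r)" using c by (simp add: field_simps)
    have "real n * (c - r) \<le> real n" using c r by (intro mult_left_le) auto
    with n have nK: "0 < real n + 1 - K" by linarith
    have "K * r \<le> \<bar>K\<bar>" "- (K * c) \<ge> - \<bar>K\<bar>"
      using mult_mono[of K "\<bar>K\<bar>" r 1] mult_mono[of K "\<bar>K\<bar>" c 1] r c by (auto simp: mult_left_le_one_le)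
    with n c r have le: "(real n + K) * r \<le> c * (real n + 1 - K)"
      by (simp add: algebra_simps)
    have "(real n + 1 - K) * x (Suc n) \<le> (real n + K) * x n"
      using step[of n] by (simp add: algebra_simps)
    then have "(real n + 1 - K) * x (Suc n) * r \<le> (real n + K) * r * x n"
      using r mult_right_mono[of _ _ r] by (force simp: mult_ac)
    also have "\<dots> \<le> c * (real n + 1 - K) * x n"
      using le nonneg by (intro mult_right_mono)
    finally have "(real n + 1 - K) * (x (Suc n) * r) \<le> (real n + 1 - K) * (c * x n)"
      by (simp add: mult_ac)
    then have "x (Suc n) * r \<le> c * x n" using nK by simp
    then have "x (Suc n) * r * r ^ n \<le> c * x n * r ^ n" using r by (intro mult_right_mono) auto
    then show "norm (x (Suc n) * r ^ Suc n) \<le> c * norm (x n * r ^ n)"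
      using nonneg r by (simp add: mult_ac abs_mult)
  qed
  then have "summable (\<lambda>n. C * (x n * r ^ n))" by (rule summable_mult)
  then show "summable (\<lambda>n. fps_nth f n * of_real r ^ n)"
  proof (rule summable_comparison_test'[where N = 0])
    fix n show "norm (fps_nth f n * of_real r ^ n) \<le> C * (x n * r ^ n)"
      using mult_right_mono[OF bound[of n], of "r ^ n"] r by (simp add: norm_mult norm_power mult.assoc)
  qed
qed

section \<open>The Picard-Fuchs equation as a first-order system\<close>

definition vec4 :: "'a \<Rightarrow> 'a \<Rightarrow> 'a \<Rightarrow> 'a \<Rightarrow> 'a ^ 4" where
  "vec4 a b c d = (\<chi> i. if i = 1 then a else if i = 2 then b else if i = 3 then c else d)"

lemma vec4_nth [simp]:
  "vec4 a b c d $ 1 = a" "vec4 a b c d $ 2 = b" "vec4 a b c d $ 3 = c" "vec4 a b c d $ 4 = d"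
  by (simp_all add: vec4_def)

lemma vec4_eq_iff: "x = y \<longleftrightarrow> x $ 1 = y $ 1 \<and> x $ 2 = y $ 2 \<and> x $ 3 = y $ 3 \<and> x $ (4::4) = y $ 4"
  by (simp add: vec_eq_iff forall_4)

text \<open>
  A vector \<open>Y\<close> stands for \<open>(y, \<theta> y, \<theta>\<^sup>2 y, \<theta>\<^sup>3 y)\<close> with \<open>\<theta> = z d/dz\<close> and a solution \<open>y\<close> of
  the Picard-Fuchs equation
  \<open>\<theta>\<^sup>4 y = z (\<theta> + 1/5) (\<theta> + 2/5) (\<theta> + 3/5) (\<theta> + 4/5) y\<close>, whose right-hand side is
  \<open>z (\<theta>\<^sup>4 + 2 \<theta>\<^sup>3 + 7/5 \<theta>\<^sup>2 + 2/5 \<theta> + 24/625) y\<close>.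
\<close>

definition pf_solution :: "(complex \<Rightarrow> complex ^ 4) \<Rightarrow> bool" where
  "pf_solution Y \<longleftrightarrow> (\<forall>z\<in>lens.
     ((\<lambda>z. Y z $ 1) has_field_derivative Y z $ 2 / z) (at z) \<and>
     ((\<lambda>z. Y z $ 2) has_field_derivative Y z $ 3 / z) (at z) \<and>
     ((\<lambda>z. Y z $ 3) has_field_derivative Y z $ 4 / z) (at z) \<and>
     ((\<lambda>z. Y z $ 4) has_field_derivative
        (24/625 * Y z $ 1 + 2/5 * Y z $ 2 + 7/5 * Y z $ 3 + 2 * Y z $ 4) / (1 - z)) (at z))"

subsection \<open>Solutions at the point of maximal unipotent monodromy\<close>

abbreviation frob_lin :: "nat \<Rightarrow> complex fps" where
  "frob_lin n \<equiv> fps_const (of_nat n) + fps_X"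

text \<open>
  The Frobenius method: the coefficient of \<open>z\<^sup>n\<close> as a series in the shift \<open>\<epsilon>\<close> of the exponent,
  \<open>\<epsilon>\<close> being the formal variable.
\<close>

primrec frob_coeff :: "nat \<Rightarrow> complex fps" where
  "frob_coeff 0 = 1"
| "frob_coeff (Suc n) = frob_coeff n * (frob_lin n ^ 4 + 2 * frob_lin n ^ 3 + fps_const (7/5) * frob_lin n ^ 2
     + fps_const (2/5) * frob_lin n + fps_const (24/625)) * inverse (frob_lin (Suc n) ^ 4)"

lemma frob_coeff_Suc:
  "frob_lin (Suc n) ^ 4 * frob_coeff (Suc n) = frob_lin n ^ 4 * frob_coeff n + 2 * (frob_lin n ^ 3 * frob_coeff n)
     + fps_const (7/5) * (frob_lin n ^ 2 * frob_coeff n) + fps_const (2/5) * (frob_lin n * frob_coeff n)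
     + fps_const (24/625) * frob_coeff n"
proof -
  have "fps_nth (frob_lin (Suc n) ^ 4) 0 \<noteq> 0" by (simp add: fps_power_zeroth del: of_nat_Suc)
  then have "inverse (frob_lin (Suc n) ^ 4) * frob_lin (Suc n) ^ 4 = 1" by (rule inverse_mult_eq_1)
  then have cancel: "frob_lin (Suc n) ^ 4 * (x * inverse (frob_lin (Suc n) ^ 4)) = x" for x
    by (metis mult.assoc mult.commute mult.right_neutral)
  show ?thesis unfolding frob_coeff.simps cancel by (simp only: ring_distribs mult_ac)
qed

text \<open>\<theta> multiplies z^(n+\<epsilon>) by n + \<epsilon>. So this is the coefficient of
  z^n in the \<epsilon>^j part of \<theta>^i applied to the Frobenius series, after the common
  factor z^\<epsilon> is removed.\<close>

definition frob_nth :: "nat \<Rightarrow> nat \<Rightarrow> nat \<Rightarrow> complex" where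
  "frob_nth i j n = fps_nth (frob_lin n ^ i * frob_coeff n) j"

definition frob_fps :: "nat \<Rightarrow> nat \<Rightarrow> complex fps" where
  "frob_fps i j = Abs_fps (frob_nth i j)"

lemma frob_nth_Suc_left:
  "frob_nth (Suc i) j n = of_nat n * frob_nth i j n + (if j = 0 then 0 else frob_nth i (j - 1) n)"
  by (simp add: frob_nth_def ring_distribs mult.assoc)

lemma frob_nth_4_Suc:
  "frob_nth 4 j (Suc n) = frob_nth 4 j n + 2 * frob_nth 3 j n + 7/5 * frob_nth 2 j n
     + 2/5 * frob_nth 1 j n + 24/625 * frob_nth 0 j n"
  unfolding frob_nth_def frob_coeff_Suc by simp

lemma frob_nth_at_0: "frob_nth i j 0 = (if i = j then 1 else 0)"
  by (simp add: frob_nth_def)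

text \<open>Removing z^\<epsilon> turns \<theta> into \<theta> + \<epsilon>; the summand \<epsilon>
  causes the term of index \<open>j - 1\<close>.\<close>

lemma frob_fps_deriv:
  "fps_X * fps_deriv (frob_fps i j) = frob_fps (Suc i) j - (if j = 0 then 0 else frob_fps i (j - 1))"
proof (rule fps_ext)
  fix n
  show "fps_nth (fps_X * fps_deriv (frob_fps i j)) n
      = fps_nth (frob_fps (Suc i) j - (if j = 0 then 0 else frob_fps i (j - 1))) n"
    by (cases n) (auto simp: frob_fps_def frob_nth_Suc_left frob_nth_at_0)
qed

text \<open>The Frobenius series solves the equation up to the term \<epsilon>^4 z^\<epsilon>, which
  is invisible in the orders below 4.\<close>

lemma frob_fps_4:
  assumes "j < 4"
  shows "(1 - fps_X) * frob_fps 4 j = fps_X * (fps_const (24/625) * frob_fps 0 j + fps_const (2/5) * frob_fps 1 j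
     + fps_const (7/5) * frob_fps 2 j + fps_const 2 * frob_fps 3 j)"
proof (rule fps_ext)
  fix n
  show "fps_nth ((1 - fps_X) * frob_fps 4 j) n = fps_nth (fps_X * (fps_const (24/625) * frob_fps 0 j
     + fps_const (2/5) * frob_fps 1 j + fps_const (7/5) * frob_fps 2 j + fps_const 2 * frob_fps 3 j)) n"
    using assms by (cases n) (auto simp: ring_distribs frob_fps_def frob_nth_at_0 frob_nth_4_Suc)
qed

lemma frob_fps_conv:
  assumes "i < 4" "j < 4" shows "1 \<le> fps_conv_radius (frob_fps i j)"
proof -
  define x where "x n = (\<Sum>i<4. \<Sum>j<4. norm (frob_nth i j n))" for n
  have le: "norm (frob_nth i j n) \<le> x n" if "i < 4" "j < 4" for i j n
  proof -
    have "norm (frob_nth i j n) \<le> (\<Sum>j<4. norm (frob_nth i j n))"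
      using that by (intro member_le_sum) auto
    also have "\<dots> \<le> x n" unfolding x_def
      using that by (intro member_le_sum[of i "{..<4}" "\<lambda>i. \<Sum>j<4. norm (frob_nth i j n)"]) (auto intro: sum_nonneg)
    finally show ?thesis .
  qed
  have x0: "0 \<le> x n" for n unfolding x_def by (intro sum_nonneg) auto
  have pred: "norm (if j = 0 then 0 else frob_nth i (j - 1) n) \<le> x n" if "i < 4" "j < 4" for i j n
    using le[of i "j - 1" n] that x0[of n] by auto
  have nm: "norm (of_nat (Suc n) * w) = (real n + 1) * norm w" for n and w :: complex
    unfolding norm_mult norm_of_nat by simp
  have low: "(real n + 1) * norm (frob_nth i j (Suc n)) \<le> 2 * x (Suc n)" if "i < 3" "j < 4" for i j n
  proof -
    have "of_nat (Suc n) * frob_nth i j (Suc n) =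
        frob_nth (Suc i) j (Suc n) - (if j = 0 then 0 else frob_nth i (j - 1) (Suc n))"
      by (simp add: frob_nth_Suc_left)
    then have "norm (of_nat (Suc n) * frob_nth i j (Suc n)) \<le>
        norm (frob_nth (Suc i) j (Suc n)) + norm (if j = 0 then 0 else frob_nth i (j - 1) (Suc n))"
      using norm_triangle_ineq4 by metis
    also have "\<dots> \<le> 2 * x (Suc n)"
      using le[of "Suc i" j "Suc n"] pred[of i j "Suc n"] that by simp
    finally show ?thesis unfolding nm .
  qed
  have top: "(real n + 1) * norm (frob_nth 3 j (Suc n)) \<le> real n * norm (frob_nth 3 j n) + 5 * x n + x (Suc n)"
    if "j < 4" for j n
  proof -
    let ?a = "if j = 0 then 0 else frob_nth 3 (j - 1) (Suc n)"
    let ?b = "if j = 0 then 0 else frob_nth 3 (j - 1) n"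
    have s4: "frob_nth 4 j n = of_nat n * frob_nth 3 j n + (if j = 0 then 0 else frob_nth 3 (j - 1) n)" for n
      using frob_nth_Suc_left[of 3 j n] by simp
    have "of_nat (Suc n) * frob_nth 3 j (Suc n) = of_nat n * frob_nth 3 j n + (?b - ?a) + (2 * frob_nth 3 j n
       + 7/5 * frob_nth 2 j n + 2/5 * frob_nth 1 j n + 24/625 * frob_nth 0 j n)"
      using frob_nth_4_Suc[of j n] unfolding s4[of "Suc n"] s4[of n] by (simp add: algebra_simps)
    then have "norm (of_nat (Suc n) * frob_nth 3 j (Suc n)) \<le> norm (of_nat n * frob_nth 3 j n) + (norm ?b + norm ?a)
       + (norm (2 * frob_nth 3 j n) + norm (7/5 * frob_nth 2 j n) + norm (2/5 * frob_nth 1 j n) + norm (24/625 * frob_nth 0 j n))"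
      by (auto intro!: norm_triangle_mono norm_triangle_ineq4 simp del: of_nat_Suc norm_mult)
    also have "norm (of_nat n * frob_nth 3 j n) = real n * norm (frob_nth 3 j n)" by (simp add: norm_mult)
    also have "norm (2 * frob_nth 3 j n) + norm (7/5 * frob_nth 2 j n) + norm (2/5 * frob_nth 1 j n)
        + norm (24/625 * frob_nth 0 j n) \<le> 4 * x n"
      using le[of 0 j n] le[of 1 j n] le[of 2 j n] le[of 3 j n] x0[of n] that by (simp add: norm_mult norm_divide)
    also have "norm ?b + norm ?a \<le> x n + x (Suc n)" using pred[of 3 j n] pred[of 3 j "Suc n"] that by simp
    finally show ?thesis unfolding nm by simp
  qed
  show ?thesis
  \<comment> \<open>Twelve entries with \<open>i < 3\<close> contribute 2 x(n+1) each, four with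
    \<open>i = 3\<close> contribute x(n+1) + 5 x(n) each: 28 and 20 in all.\<close>
  proof (rule fps_conv_radius_ge_1[where x = x and C = 1 and K = 28])
    show "0 \<le> x n" for n by (rule x0)
    show "norm (fps_nth (frob_fps i j) n) \<le> 1 * x n" for n using le[OF assms] by (simp add: frob_fps_def)
    fix n
    have sp: "x n = (\<Sum>i<3. \<Sum>j<4. norm (frob_nth i j n)) + (\<Sum>j<4. norm (frob_nth 3 j n))" for n
      unfolding x_def by (simp add: eval_nat_numeral)
    have "(real n + 1) * x (Suc n) = (\<Sum>i<3. \<Sum>j<4. (real n + 1) * norm (frob_nth i j (Suc n)))
         + (\<Sum>j<4. (real n + 1) * norm (frob_nth 3 j (Suc n)))"
      unfolding sp[of "Suc n"] by (simp only: ring_distribs sum_distrib_left)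
    also have "\<dots> \<le> (\<Sum>i<(3::nat). \<Sum>j<(4::nat). 2 * x (Suc n)) + (\<Sum>j<4. real n * norm (frob_nth 3 j n) + 5 * x n + x (Suc n))"
      by (intro add_mono sum_mono) (use low top in auto)
    also have "\<dots> = 28 * x (Suc n) + real n * (\<Sum>j<4. norm (frob_nth 3 j n)) + 20 * x n"
      by (simp add: sum.distrib sum_distrib_left)
    also have "\<dots> \<le> 28 * x (Suc n) + real n * x n + 28 * x n"
    proof -
      have "(\<Sum>j<4. norm (frob_nth 3 j n)) \<le> x n"
        unfolding sp[of n] by (simp add: sum_nonneg)
      then have "real n * (\<Sum>j<4. norm (frob_nth 3 j n)) \<le> real n * x n" by (rule mult_left_mono) simp
      with x0[of n] show ?thesis by linarith
    qed
    finally show "(real n + 1) * x (Suc n) \<le> real n * x n + 28 * (x n + x (Suc n))" by (simp add: algebra_simps)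
  qed
qed

text \<open>This is exp(l J) with (J a)_k = a_(k+1). Its entries are the coefficients in \<epsilon>
  of z^\<epsilon> = exp(\<epsilon> l), so the unit vectors stand for the successive
  \<epsilon>-coefficients of the Frobenius series: the first is the holomorphic solution, the second
  has a simple logarithm.\<close>

definition log_exp :: "complex \<Rightarrow> complex ^ 4 \<Rightarrow> complex ^ 4" where
  "log_exp l a = vec4 (a $ 1 + l * a $ 2 + l ^ 2 / 2 * a $ 3 + l ^ 3 / 6 * a $ 4)
     (a $ 2 + l * a $ 3 + l ^ 2 / 2 * a $ 4) (a $ 3 + l * a $ 4) (a $ 4)"

definition frob_row :: "nat \<Rightarrow> complex \<Rightarrow> complex ^ 4 \<Rightarrow> complex" where
  "frob_row i z b = eval_fps (frob_fps i 0) z * b $ 1 + eval_fps (frob_fps i 1) z * b $ 2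
     + eval_fps (frob_fps i 2) z * b $ 3 + eval_fps (frob_fps i 3) z * b $ 4"

text \<open>The fundamental solution \<open>S(z) exp(l J)\<close>, with the nilpotent shift \<open>J\<close>; \<open>l\<close> stands for \<open>log z\<close>.\<close>

definition frob_sol :: "complex \<Rightarrow> complex \<Rightarrow> complex ^ 4 \<Rightarrow> complex ^ 4" where
  "frob_sol z l a = vec4 (frob_row 0 z (log_exp l a)) (frob_row 1 z (log_exp l a))
     (frob_row 2 z (log_exp l a)) (frob_row 3 z (log_exp l a))"

lemma log_exp_add: "log_exp (l + c) a = log_exp l (log_exp c a)"
  by (simp add: log_exp_def vec4_eq_iff algebra_simps power2_eq_square power3_eq_cube add_divide_distrib)

text \<open>Shifting the logarithm acts on the coordinates by the one-parameter group through the
  monodromy at 0.\<close>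

lemma frob_sol_log_exp: "frob_sol z (l + c) a = frob_sol z l (log_exp c a)"
  by (simp add: frob_sol_def log_exp_add)

lemma frob_sol_linear:
  "frob_sol z l (a + b) = frob_sol z l a + frob_sol z l b"
  "frob_sol z l (c *s a) = c *s frob_sol z l a"
  by (simp_all add: frob_sol_def frob_row_def log_exp_def vec4_eq_iff algebra_simps)

lemma eval_frob_deriv:
  assumes "z \<in> lens" "i < 3" "j < 4"
  shows "eval_fps (fps_deriv (frob_fps i j)) z =
    (eval_fps (frob_fps (Suc i) j) z - (if j = 0 then 0 else eval_fps (frob_fps i (j - 1)) z)) / z"
proof -
  have c: "1 \<le> fps_conv_radius (frob_fps i k)" if "i \<le> 3" "k < 4" for i k
    using frob_fps_conv[of i k] that by simp
  have d: "1 \<le> fps_conv_radius (fps_deriv (frob_fps i j))"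
    using frob_fps_conv[of i j] assms order.trans[OF _ fps_conv_radius_deriv] by simp
  have "z * eval_fps (fps_deriv (frob_fps i j)) z = eval_fps (fps_X * fps_deriv (frob_fps i j)) z"
    using assms d by (simp add: lens_eval_fps)
  also have "\<dots> = eval_fps (frob_fps (Suc i) j) z - (if j = 0 then 0 else eval_fps (frob_fps i (j - 1)) z)"
    using assms c[of "Suc i" j] c[of i "j - 1"]
    by (subst frob_fps_deriv) (auto simp: lens_eval_fps)
  finally show ?thesis using assms by (simp add: field_simps)
qed

lemma eval_frob_deriv_3:
  assumes "z \<in> lens" "j < 4"
  shows "eval_fps (fps_deriv (frob_fps 3 j)) z =
    (24/625 * eval_fps (frob_fps 0 j) z + 2/5 * eval_fps (frob_fps 1 j) z
     + 7/5 * eval_fps (frob_fps 2 j) z + 2 * eval_fps (frob_fps 3 j) z) / (1 - z)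
    - (if j = 0 then 0 else eval_fps (frob_fps 3 (j - 1)) z) / z"
proof -
  let ?p = "if j = 0 then 0 else frob_fps 3 (j - 1)"
  have c: "1 \<le> fps_conv_radius (frob_fps i k)" if "i \<le> 3" "k < 4" for i k
    using frob_fps_conv[of i k] that by simp
  have d: "1 \<le> fps_conv_radius (fps_deriv (frob_fps 3 j))"
    using frob_fps_conv[of 3 j] assms order.trans[OF _ fps_conv_radius_deriv] by simp
  have p: "1 \<le> fps_conv_radius ?p" using c[of 3 "j - 1"] assms by auto
  have "fps_X * fps_deriv (frob_fps 3 j) + ?p = frob_fps 4 j"
    using frob_fps_deriv[of 3 j] by simp
  then have "(1 - fps_X) * (fps_X * fps_deriv (frob_fps 3 j) + ?p) =
      fps_X * (fps_const (24/625) * frob_fps 0 j + fps_const (2/5) * frob_fps 1 j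
     + fps_const (7/5) * frob_fps 2 j + fps_const 2 * frob_fps 3 j)"
    using frob_fps_4[OF assms(2)] by simp
  then have "eval_fps ((1 - fps_X) * (fps_X * fps_deriv (frob_fps 3 j) + ?p)) z =
      eval_fps (fps_X * (fps_const (24/625) * frob_fps 0 j + fps_const (2/5) * frob_fps 1 j
     + fps_const (7/5) * frob_fps 2 j + fps_const 2 * frob_fps 3 j)) z"
    by (rule arg_cong)
  moreover have "eval_fps ((1 - fps_X) * (fps_X * fps_deriv (frob_fps 3 j) + ?p)) z =
      (1 - z) * (z * eval_fps (fps_deriv (frob_fps 3 j)) z + eval_fps ?p z)"
  proof -
    have "1 \<le> fps_conv_radius (1 - fps_X :: complex fps)"
      using conv1_intros(2)[of 1 fps_X] by simp
    then show ?thesis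
      using assms d p by (simp add: lens_eval_fps conv1_intros del: mult_eq_0_iff)
  qed
  moreover have "eval_fps (fps_X * (fps_const (24/625) * frob_fps 0 j + fps_const (2/5) * frob_fps 1 j
     + fps_const (7/5) * frob_fps 2 j + fps_const 2 * frob_fps 3 j)) z =
     z * (24/625 * eval_fps (frob_fps 0 j) z + 2/5 * eval_fps (frob_fps 1 j) z
     + 7/5 * eval_fps (frob_fps 2 j) z + 2 * eval_fps (frob_fps 3 j) z)"
    using assms c[of 0 j] c[of 1 j] c[of 2 j] c[of 3 j] by (simp add: lens_eval_fps conv1_intros)
  ultimately have "(1 - z) * (z * eval_fps (fps_deriv (frob_fps 3 j)) z + eval_fps ?p z) =
     z * (24/625 * eval_fps (frob_fps 0 j) z + 2/5 * eval_fps (frob_fps 1 j) z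
     + 7/5 * eval_fps (frob_fps 2 j) z + 2 * eval_fps (frob_fps 3 j) z)" by simp
  moreover have "eval_fps ?p z = (if j = 0 then 0 else eval_fps (frob_fps 3 (j - 1)) z)" by simp
  ultimately have *: "(1 - z) * (z * D + P) = z * R \<Longrightarrow> D = R / (1 - z) - P / z" for D P R
    using assms(1) by (auto simp: field_simps)
  show ?thesis
    by (rule *) (use \<open>(1 - z) * _ = _\<close> \<open>eval_fps ?p z = _\<close> in simp)
qed

lemma frob_row_has_derivative:
  assumes "z \<in> lens" "i < 4"
  shows "((\<lambda>z. frob_row i z (log_exp (Ln z) a)) has_field_derivative
    eval_fps (fps_deriv (frob_fps i 0)) z * log_exp (Ln z) a $ 1
  + eval_fps (fps_deriv (frob_fps i 1)) z * log_exp (Ln z) a $ 2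
  + eval_fps (fps_deriv (frob_fps i 2)) z * log_exp (Ln z) a $ 3
  + eval_fps (fps_deriv (frob_fps i 3)) z * log_exp (Ln z) a $ 4
  + (eval_fps (frob_fps i 0) z * log_exp (Ln z) a $ 2 + eval_fps (frob_fps i 1) z * log_exp (Ln z) a $ 3
   + eval_fps (frob_fps i 2) z * log_exp (Ln z) a $ 4) / z) (at z)"
proof -
  have ev: "(eval_fps (frob_fps i j) has_field_derivative eval_fps (fps_deriv (frob_fps i j)) z) (at z)"
    if "j < 4" for j
    by (intro has_field_derivative_eval_fps lens_conv frob_fps_conv assms that)
  have ln: "(Ln has_field_derivative 1 / z) (at z)"
    using has_field_derivative_Ln[OF lens_nonpos[OF assms(1)]] by (simp add: inverse_eq_divide)
  have "z \<noteq> 0" using assms by simp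
  note [derivative_intros] = ln
  have le: "((\<lambda>z. log_exp (Ln z) a $ 1) has_field_derivative log_exp (Ln z) a $ 2 / z) (at z)"
    "((\<lambda>z. log_exp (Ln z) a $ 2) has_field_derivative log_exp (Ln z) a $ 3 / z) (at z)"
    "((\<lambda>z. log_exp (Ln z) a $ 3) has_field_derivative log_exp (Ln z) a $ 4 / z) (at z)"
    "((\<lambda>z. log_exp (Ln z) a $ 4) has_field_derivative 0) (at z)"
    unfolding log_exp_def vec4_nth
    by (auto intro!: derivative_eq_intros simp: \<open>z \<noteq> 0\<close> field_simps power2_eq_square)
  show ?thesis
    unfolding frob_row_def
    by (rule DERIV_cong[OF DERIV_add[OF DERIV_add[OF DERIV_add[OF
          DERIV_mult[OF ev le(1)] DERIV_mult[OF ev le(2)]] DERIV_mult[OF ev le(3)]] DERIV_mult[OF ev le(4)]]])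
      (use \<open>z \<noteq> 0\<close> in \<open>simp_all add: field_simps\<close>)
qed

lemma pf_solution_frob_sol: "pf_solution (\<lambda>z. frob_sol z (Ln z) a)"
  unfolding pf_solution_def
proof (intro ballI conjI)
  fix z assume z: "z \<in> lens"
  then have nz: "z \<noteq> 0" "1 - z \<noteq> 0" by auto
  have low: "((\<lambda>z. frob_row i z (log_exp (Ln z) a)) has_field_derivative
     frob_row (Suc i) z (log_exp (Ln z) a) / z) (at z)" if "i < 3" for i
    by (rule DERIV_cong[OF frob_row_has_derivative[OF z]])
      (use that z nz in \<open>simp_all add: eval_frob_deriv frob_row_def field_simps\<close>)
  show "((\<lambda>z. frob_sol z (Ln z) a $ 1) has_field_derivative frob_sol z (Ln z) a $ 2 / z) (at z)"
    "((\<lambda>z. frob_sol z (Ln z) a $ 2) has_field_derivative frob_sol z (Ln z) a $ 3 / z) (at z)"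
    "((\<lambda>z. frob_sol z (Ln z) a $ 3) has_field_derivative frob_sol z (Ln z) a $ 4 / z) (at z)"
    using low[of 0] low[of 1] low[of 2] by (simp_all add: frob_sol_def numeral_eq_Suc)
  show "((\<lambda>z. frob_sol z (Ln z) a $ 4) has_field_derivative (24/625 * frob_sol z (Ln z) a $ 1
       + 2/5 * frob_sol z (Ln z) a $ 2 + 7/5 * frob_sol z (Ln z) a $ 3 + 2 * frob_sol z (Ln z) a $ 4) / (1 - z)) (at z)"
    unfolding frob_sol_def vec4_nth
    by (rule DERIV_cong[OF frob_row_has_derivative[OF z]])
      (use z nz in \<open>simp_all add: eval_frob_deriv_3 frob_row_def divide_simps, simp_all add: algebra_simps\<close>)
qed

subsection \<open>Solutions at the conifold point\<close>

text \<open>In s = 1 - z the operator \<theta> is -(1 - s) d/ds, and s dY_4/ds equals -2 Y_4 plus a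
  combination of the first three entries. So the coefficients of Y_4 follow from the others on
  division by n + 2, and exactly three initial values are free.\<close>

primrec coni_seq :: "complex \<times> complex \<times> complex \<Rightarrow> nat \<Rightarrow> complex \<times> complex \<times> complex" where
  "coni_seq v 0 = v"
| "coni_seq v (Suc n) = (case coni_seq v n of (a, b, c) \<Rightarrow>
     ((of_nat n * a - b) / of_nat (Suc n), (of_nat n * b - c) / of_nat (Suc n),
      (of_nat n * c - - (24/625 * a + 2/5 * b + 7/5 * c) / of_nat (n + 2)) / of_nat (Suc n)))"

definition coni_nth :: "complex \<times> complex \<times> complex \<Rightarrow> nat \<Rightarrow> nat \<Rightarrow> complex" where
  "coni_nth v i n = (case coni_seq v n of (a, b, c) \<Rightarrow> if i = 0 then a else if i = 1 then b else if i = 2 then c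
      else - (24/625 * a + 2/5 * b + 7/5 * c) / of_nat (n + 2))"

lemma coni_nth_Suc:
  assumes "i < 3"
  shows "of_nat (Suc n) * coni_nth v i (Suc n) = of_nat n * coni_nth v i n - coni_nth v (Suc i) n"
proof -
  have nz: "(of_nat (Suc n) :: complex) \<noteq> 0" by (simp del: of_nat_Suc)
  have "i = 0 \<or> i = 1 \<or> i = 2" using assms by auto
  then show ?thesis using nz
    by (auto simp: coni_nth_def simp del: of_nat_Suc split: prod.splits)
qed

lemma coni_nth_3:
  "of_nat n * coni_nth v 3 n = - (24/625 * coni_nth v 0 n + 2/5 * coni_nth v 1 n + 7/5 * coni_nth v 2 n + 2 * coni_nth v 3 n)"
proof -
  have nz: "(of_nat (n + 2) :: complex) \<noteq> 0" by (metis add_2_eq_Suc' of_nat_neq_0)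
  have "of_nat (n + 2) * coni_nth v 3 n = - (24/625 * coni_nth v 0 n + 2/5 * coni_nth v 1 n + 7/5 * coni_nth v 2 n)"
    using nz by (simp add: coni_nth_def del: of_nat_add split: prod.splits)
  then have "of_nat n * coni_nth v 3 n + 2 * coni_nth v 3 n = - (24/625 * coni_nth v 0 n + 2/5 * coni_nth v 1 n + 7/5 * coni_nth v 2 n)"
    by (simp only: of_nat_add ring_distribs of_nat_numeral)
  then show ?thesis by (simp only: eq_neg_iff_add_eq_0 add_ac)
qed

definition coni_fps :: "complex \<times> complex \<times> complex \<Rightarrow> nat \<Rightarrow> complex fps" where
  "coni_fps v i = Abs_fps (coni_nth v i)"

definition coni_norm :: "complex \<times> complex \<times> complex \<Rightarrow> nat \<Rightarrow> real" where
  "coni_norm v n = norm (coni_nth v 0 n) + norm (coni_nth v 1 n) + norm (coni_nth v 2 n)"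

lemma coni_nth_le: "norm (coni_nth v i n) \<le> coni_norm v n"
proof (cases "i < 3")
  case True
  then have "i = 0 \<or> i = 1 \<or> i = 2" by auto
  then show ?thesis by (auto simp: coni_norm_def)
next
  case False
  obtain a b c where abc: "coni_seq v n = (a, b, c)" by (cases "coni_seq v n") auto
  have "norm (24/625 * a + 2/5 * b + 7/5 * c) \<le> norm (24/625 * a) + norm (2/5 * b) + norm (7/5 * c)"
    by (intro norm_triangle_mono order.refl)
  also have "\<dots> \<le> 2 * (norm a + norm b + norm c)"
    by (simp add: norm_mult norm_divide) (use norm_ge_zero[of a] norm_ge_zero[of b] norm_ge_zero[of c] in linarith)
  also have "\<dots> \<le> real (n + 2) * (norm a + norm b + norm c)" by (intro mult_right_mono) auto
  finally have "norm (24/625 * a + 2/5 * b + 7/5 * c) / real (n + 2) \<le> norm a + norm b + norm c"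
    by (simp add: pos_divide_le_eq mult.commute)
  moreover have "coni_nth v i n = - (24/625 * a + 2/5 * b + 7/5 * c) / of_nat (n + 2)"
    unfolding coni_nth_def abc prod.case using False by simp
  then have "norm (coni_nth v i n) = norm (24/625 * a + 2/5 * b + 7/5 * c) / real (n + 2)"
    by (simp only: norm_divide norm_minus_cancel norm_of_nat)
  ultimately show ?thesis by (simp add: coni_norm_def coni_nth_def abc)
qed

lemma norm_of_nat_Suc_mult: "norm (of_nat (Suc n) * w) = (real n + 1) * norm (w :: complex)"
  unfolding norm_mult norm_of_nat by simp

lemma coni_nth_Suc_le:
  assumes "i < 3"
  shows "(real n + 1) * norm (coni_nth v i (Suc n)) \<le> real n * norm (coni_nth v i n) + coni_norm v n"
proof -
  have "norm (of_nat (Suc n) * coni_nth v i (Suc n)) \<le> norm (of_nat n * coni_nth v i n) + norm (coni_nth v (Suc i) n)"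
    unfolding coni_nth_Suc[OF assms] by (rule norm_triangle_ineq4)
  also have "\<dots> \<le> real n * norm (coni_nth v i n) + coni_norm v n"
    using coni_nth_le by (simp add: norm_mult)
  finally show ?thesis by (simp only: norm_of_nat_Suc_mult)
qed

lemma coni_norm_Suc_le: "(real n + 1) * coni_norm v (Suc n) \<le> real n * coni_norm v n + 3 * coni_norm v n"
  using coni_nth_Suc_le[of 0 n v] coni_nth_Suc_le[of 1 n v] coni_nth_Suc_le[of 2 n v]
  unfolding coni_norm_def by (simp add: ring_distribs)

lemma coni_norm_nonneg: "0 \<le> coni_norm v n"
  by (simp add: coni_norm_def)

lemma coni_fps_conv: "1 \<le> fps_conv_radius (coni_fps v i)"
proof (rule fps_conv_radius_ge_1[where x = "coni_norm v" and K = 3 and C = 1])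
  show "(real n + 1) * coni_norm v (Suc n) \<le> real n * coni_norm v n + 3 * (coni_norm v n + coni_norm v (Suc n))" for n
    using coni_norm_Suc_le[of n v] coni_norm_nonneg[of v "Suc n"] by (simp add: algebra_simps)
qed (use coni_nth_le coni_norm_nonneg in \<open>auto simp: coni_fps_def\<close>)

lemma coni_fps_deriv:
  assumes "i < 3"
  shows "(1 - fps_X) * fps_deriv (coni_fps v i) = - coni_fps v (Suc i)"
proof (rule fps_ext)
  fix n
  show "fps_nth ((1 - fps_X) * fps_deriv (coni_fps v i)) n = fps_nth (- coni_fps v (Suc i)) n"
    using coni_nth_Suc[OF assms, of n v]
    by (cases n) (auto simp: ring_distribs coni_fps_def simp del: of_nat_Suc)
qed

lemma coni_fps_deriv_3:
  "fps_X * fps_deriv (coni_fps v 3) = - (fps_const (24/625) * coni_fps v 0 + fps_const (2/5) * coni_fps v 1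
     + fps_const (7/5) * coni_fps v 2 + fps_const 2 * coni_fps v 3)"
proof (rule fps_ext)
  fix n
  show "fps_nth (fps_X * fps_deriv (coni_fps v 3)) n = fps_nth (- (fps_const (24/625) * coni_fps v 0
     + fps_const (2/5) * coni_fps v 1 + fps_const (7/5) * coni_fps v 2 + fps_const 2 * coni_fps v 3)) n"
    using coni_nth_3[of n v] by (cases n) (auto simp: coni_fps_def simp del: of_nat_Suc)
qed

definition coni_sol :: "complex \<times> complex \<times> complex \<Rightarrow> complex \<Rightarrow> complex ^ 4" where
  "coni_sol v s = vec4 (eval_fps (coni_fps v 0) s) (eval_fps (coni_fps v 1) s)
     (eval_fps (coni_fps v 2) s) (eval_fps (coni_fps v 3) s)"

lemma eval_coni_deriv:
  assumes "s \<in> lens"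
  shows "i < 3 \<Longrightarrow> eval_fps (fps_deriv (coni_fps v i)) s = - eval_fps (coni_fps v (Suc i)) s / (1 - s)"
    and "eval_fps (fps_deriv (coni_fps v 3)) s = - (24/625 * eval_fps (coni_fps v 0) s + 2/5 * eval_fps (coni_fps v 1) s
     + 7/5 * eval_fps (coni_fps v 2) s + 2 * eval_fps (coni_fps v 3) s) / s"
proof -
  have d: "1 \<le> fps_conv_radius (fps_deriv (coni_fps v i))" for i
    using coni_fps_conv order.trans[OF _ fps_conv_radius_deriv] by blast
  have x: "1 \<le> fps_conv_radius (1 - fps_X :: complex fps)"
    using conv1_intros(2)[of 1 fps_X] by simp
  have nz: "s \<noteq> 0" "1 - s \<noteq> 0" using assms by auto
  note um = eval_fps_minus[OF lens_conv[OF assms]]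
  show "eval_fps (fps_deriv (coni_fps v i)) s = - eval_fps (coni_fps v (Suc i)) s / (1 - s)" if "i < 3"
  proof -
    have "(1 - s) * eval_fps (fps_deriv (coni_fps v i)) s = eval_fps ((1 - fps_X) * fps_deriv (coni_fps v i)) s"
      using assms d x by (simp add: lens_eval_fps)
    also have "\<dots> = - eval_fps (coni_fps v (Suc i)) s"
      unfolding coni_fps_deriv[OF that] by (simp add: um coni_fps_conv)
    finally show ?thesis using nz by (simp add: field_simps)
  qed
  have "s * eval_fps (fps_deriv (coni_fps v 3)) s = eval_fps (fps_X * fps_deriv (coni_fps v 3)) s"
    using assms d by (simp add: lens_eval_fps)
  also have "\<dots> = - (24/625 * eval_fps (coni_fps v 0) s + 2/5 * eval_fps (coni_fps v 1) s
     + 7/5 * eval_fps (coni_fps v 2) s + 2 * eval_fps (coni_fps v 3) s)"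
    unfolding coni_fps_deriv_3 using assms by (simp add: um lens_eval_fps conv1_intros coni_fps_conv)
  finally show "eval_fps (fps_deriv (coni_fps v 3)) s = - (24/625 * eval_fps (coni_fps v 0) s + 2/5 * eval_fps (coni_fps v 1) s
     + 7/5 * eval_fps (coni_fps v 2) s + 2 * eval_fps (coni_fps v 3) s) / s"
    using nz by (simp add: field_simps)
qed

lemma pf_solution_reflectI:
  assumes "\<And>s. s \<in> lens \<Longrightarrow> ((\<lambda>s. Y s $ 1) has_field_derivative - Y s $ 2 / (1 - s)) (at s)"
    and "\<And>s. s \<in> lens \<Longrightarrow> ((\<lambda>s. Y s $ 2) has_field_derivative - Y s $ 3 / (1 - s)) (at s)"
    and "\<And>s. s \<in> lens \<Longrightarrow> ((\<lambda>s. Y s $ 3) has_field_derivative - Y s $ 4 / (1 - s)) (at s)"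
    and "\<And>s. s \<in> lens \<Longrightarrow> ((\<lambda>s. Y s $ 4) has_field_derivative
        - (24/625 * Y s $ 1 + 2/5 * Y s $ 2 + 7/5 * Y s $ 3 + 2 * Y s $ 4) / s) (at s)"
  shows "pf_solution (\<lambda>z. Y (1 - z))"
proof -
  have refl: "((\<lambda>z. F (1 - z)) has_field_derivative E) (at z)"
    if "(F has_field_derivative D) (at (1 - z))" "E = - D" for F and D E z :: complex
  proof -
    have "((\<lambda>z. 1 - z) has_field_derivative -1) (at z)" by (auto intro!: derivative_eq_intros)
    from DERIV_chain2[OF that(1) this] that(2) show ?thesis by simp
  qed
  show ?thesis unfolding pf_solution_def
    by (intro ballI conjI; rule refl, rule assms, erule lens_one_minus,
      simp only: minus_divide_left[symmetric] minus_minus diff_diff_eq2 add_diff_cancel_left')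
qed

lemma eval_coni_has_derivative:
  assumes "s \<in> lens"
  shows "i < 3 \<Longrightarrow> (eval_fps (coni_fps v i) has_field_derivative - eval_fps (coni_fps v (Suc i)) s / (1 - s)) (at s)"
    and "(eval_fps (coni_fps v 3) has_field_derivative - (24/625 * eval_fps (coni_fps v 0) s + 2/5 * eval_fps (coni_fps v 1) s
     + 7/5 * eval_fps (coni_fps v 2) s + 2 * eval_fps (coni_fps v 3) s) / s) (at s)"
proof -
  note d = has_field_derivative_eval_fps[OF lens_conv[OF assms coni_fps_conv]]
  show "(eval_fps (coni_fps v i) has_field_derivative - eval_fps (coni_fps v (Suc i)) s / (1 - s)) (at s)" if "i < 3"
    by (rule DERIV_cong[OF d eval_coni_deriv(1)[OF assms that]])
  show "(eval_fps (coni_fps v 3) has_field_derivative - (24/625 * eval_fps (coni_fps v 0) s + 2/5 * eval_fps (coni_fps v 1) s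
     + 7/5 * eval_fps (coni_fps v 2) s + 2 * eval_fps (coni_fps v 3) s) / s) (at s)"
    by (rule DERIV_cong[OF d eval_coni_deriv(2)[OF assms]])
qed

lemma pf_solution_coni_sol: "pf_solution (\<lambda>z. coni_sol v (1 - z))"
  by (rule pf_solution_reflectI)
    (use eval_coni_has_derivative(1)[of _ 0 v] eval_coni_has_derivative(1)[of _ 1 v]
       eval_coni_has_derivative(1)[of _ 2 v] eval_coni_has_derivative(2)[of _ v]
     in \<open>simp_all add: coni_sol_def numeral_2_eq_2 numeral_3_eq_3\<close>)

text \<open>
  The initial values of the power series solution of exponent 1, the vanishing cycle. The
  logarithmic solution below is \<open>log_part - log s * vanishing_cycle\<close> up to the polar terms
  \<open>1/s\<close> and \<open>1/s\<^sup>2 - 7/(5 s)\<close> in the second and third derivative.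
\<close>

abbreviation vcyc :: "complex \<times> complex \<times> complex" where
  "vcyc \<equiv> (0, 1, - (2/5))"

text \<open>Differentiating log s produces (1 - s)/s times the vanishing cycle, hence the
  differences of consecutive coefficients of \<open>vcyc\<close>. The resulting poles are matched by
  the polar terms. The start (0, 0, 0) selects one solution modulo power series solutions.\<close>

primrec log_part_seq :: "nat \<Rightarrow> complex \<times> complex \<times> complex" where
  "log_part_seq 0 = (0, 0, 0)"
| "log_part_seq (Suc n) = (case log_part_seq n of (a, b, c) \<Rightarrow>
     ((of_nat n * a - b + coni_nth vcyc 0 (Suc n) - coni_nth vcyc 0 n) / of_nat (Suc n),
      (of_nat n * b - c + coni_nth vcyc 1 (Suc n) - coni_nth vcyc 1 n) / of_nat (Suc n),
      (of_nat n * c - (coni_nth vcyc 3 n - (24/625 * a + 2/5 * b + 7/5 * c)) / of_nat (n + 2)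
          + coni_nth vcyc 2 (Suc n) - coni_nth vcyc 2 n) / of_nat (Suc n)))"

definition log_part_nth :: "nat \<Rightarrow> nat \<Rightarrow> complex" where
  "log_part_nth i n = (case log_part_seq n of (a, b, c) \<Rightarrow> if i = 0 then a else if i = 1 then b else if i = 2 then c
      else (coni_nth vcyc 3 n - (24/625 * a + 2/5 * b + 7/5 * c)) / of_nat (n + 2))"

lemma log_part_nth_Suc:
  assumes "i < 3"
  shows "of_nat (Suc n) * log_part_nth i (Suc n) = of_nat n * log_part_nth i n - log_part_nth (Suc i) n
     + coni_nth vcyc i (Suc n) - coni_nth vcyc i n"
proof -
  have nz: "(of_nat (Suc n) :: complex) \<noteq> 0" by (simp del: of_nat_Suc)
  have "i = 0 \<or> i = 1 \<or> i = 2" using assms by auto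
  then show ?thesis using nz
    by (auto simp: log_part_nth_def simp del: of_nat_Suc split: prod.splits)
qed

lemma log_part_nth_3:
  "of_nat n * log_part_nth 3 n = coni_nth vcyc 3 n
     - (24/625 * log_part_nth 0 n + 2/5 * log_part_nth 1 n + 7/5 * log_part_nth 2 n + 2 * log_part_nth 3 n)"
proof -
  have nz: "(of_nat (n + 2) :: complex) \<noteq> 0" by (metis add_2_eq_Suc' of_nat_neq_0)
  have "of_nat (n + 2) * log_part_nth 3 n = coni_nth vcyc 3 n
     - (24/625 * log_part_nth 0 n + 2/5 * log_part_nth 1 n + 7/5 * log_part_nth 2 n)"
    using nz by (simp add: log_part_nth_def del: of_nat_add split: prod.splits)
  then have "of_nat n * log_part_nth 3 n + 2 * log_part_nth 3 n = coni_nth vcyc 3 n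
     - (24/625 * log_part_nth 0 n + 2/5 * log_part_nth 1 n + 7/5 * log_part_nth 2 n)"
    by (simp only: of_nat_add ring_distribs of_nat_numeral)
  then show ?thesis by (simp only: eq_diff_eq add_ac)
qed

definition log_part_fps :: "nat \<Rightarrow> complex fps" where
  "log_part_fps i = Abs_fps (log_part_nth i)"

text \<open>The coefficients of \<open>vcyc\<close> are counted too, so that the inhomogeneous
  recursion still obeys the homogeneous inequality of \<open>fps_conv_radius_ge_1\<close>.\<close>

definition log_part_norm :: "nat \<Rightarrow> real" where
  "log_part_norm n = norm (log_part_nth 0 n) + norm (log_part_nth 1 n) + norm (log_part_nth 2 n) + coni_norm vcyc n"

lemma log_part_nth_le: "norm (log_part_nth i n) \<le> log_part_norm n"
proof (cases "i < 3")
  case True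
  then have "i = 0 \<or> i = 1 \<or> i = 2" by auto
  then show ?thesis using coni_norm_nonneg[of vcyc n] by (auto simp: log_part_norm_def)
next
  case False
  obtain a b c where abc: "log_part_seq n = (a, b, c)" by (cases "log_part_seq n") auto
  let ?X = "coni_nth vcyc 3 n - (24/625 * a + 2/5 * b + 7/5 * c)"
  have "norm ?X \<le> coni_norm vcyc n + (norm (24/625 * a) + norm (2/5 * b) + norm (7/5 * c))"
    by (intro order.trans[OF norm_triangle_ineq4] add_mono norm_triangle_mono order.refl coni_nth_le)
  also have "\<dots> \<le> 2 * (norm a + norm b + norm c + coni_norm vcyc n)"
    by (simp add: norm_mult norm_divide)
      (use norm_ge_zero[of a] norm_ge_zero[of b] norm_ge_zero[of c] coni_norm_nonneg[of vcyc n] in linarith)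
  also have "\<dots> \<le> real (n + 2) * (norm a + norm b + norm c + coni_norm vcyc n)"
    using coni_norm_nonneg[of vcyc n] by (intro mult_right_mono) auto
  finally have "norm ?X / real (n + 2) \<le> norm a + norm b + norm c + coni_norm vcyc n"
    by (simp add: pos_divide_le_eq mult.commute)
  moreover have "log_part_nth i n = ?X / of_nat (n + 2)"
    unfolding log_part_nth_def abc prod.case using False by simp
  then have "norm (log_part_nth i n) = norm ?X / real (n + 2)"
    by (simp only: norm_divide norm_of_nat)
  ultimately show ?thesis by (simp add: log_part_norm_def log_part_nth_def abc)
qed

lemma log_part_norm_nonneg: "0 \<le> log_part_norm n"
  using log_part_nth_le[of 0 n] norm_ge_zero order.trans by blast

lemma log_part_fps_conv: "1 \<le> fps_conv_radius (log_part_fps i)"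
proof (rule fps_conv_radius_ge_1[where x = log_part_norm and K = 9 and C = 1])
  fix n
  have "(real n + 1) * norm (log_part_nth i (Suc n)) \<le> real n * norm (log_part_nth i n)
      + (log_part_norm n + coni_norm vcyc (Suc n) + coni_norm vcyc n)" if "i < 3" for i
  proof -
    have "norm (of_nat (Suc n) * log_part_nth i (Suc n)) \<le> norm (of_nat n * log_part_nth i n) + norm (log_part_nth (Suc i) n)
        + norm (coni_nth vcyc i (Suc n)) + norm (coni_nth vcyc i n)"
      unfolding log_part_nth_Suc[OF that]
      by (intro order.trans[OF norm_triangle_ineq4] order.trans[OF norm_triangle_ineq] add_mono order.refl)
    also have "\<dots> \<le> real n * norm (log_part_nth i n) + (log_part_norm n + coni_norm vcyc (Suc n) + coni_norm vcyc n)"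
      using log_part_nth_le[of "Suc i" n] coni_nth_le[of vcyc i n] coni_nth_le[of vcyc i "Suc n"] by (simp add: norm_mult)
    finally show ?thesis by (simp only: norm_of_nat_Suc_mult)
  qed
  from this[of 0] this[of 1] this[of 2]
  have "(real n + 1) * log_part_norm (Suc n) \<le> real n * (norm (log_part_nth 0 n) + norm (log_part_nth 1 n) + norm (log_part_nth 2 n))
      + 3 * (log_part_norm n + coni_norm vcyc (Suc n) + coni_norm vcyc n) + (real n + 1) * coni_norm vcyc (Suc n)"
    unfolding log_part_norm_def[of "Suc n"] by (simp add: ring_distribs)
  also have "\<dots> \<le> real n * (norm (log_part_nth 0 n) + norm (log_part_nth 1 n) + norm (log_part_nth 2 n))
      + 3 * (log_part_norm n + coni_norm vcyc (Suc n) + coni_norm vcyc n) + (real n * coni_norm vcyc n + 3 * coni_norm vcyc n)"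
    using coni_norm_Suc_le[of n vcyc] by simp
  also have "\<dots> = real n * log_part_norm n + (3 * log_part_norm n + 3 * coni_norm vcyc (Suc n) + 6 * coni_norm vcyc n)"
    by (simp add: log_part_norm_def algebra_simps)
  also have "\<dots> \<le> real n * log_part_norm n + 9 * (log_part_norm n + log_part_norm (Suc n))"
  proof -
    have "coni_norm vcyc n \<le> log_part_norm n" for n by (simp add: log_part_norm_def)
    from this[of n] this[of "Suc n"] coni_norm_nonneg[of vcyc "Suc n"] show ?thesis by simp
  qed
  finally show "(real n + 1) * log_part_norm (Suc n) \<le> real n * log_part_norm n + 9 * (log_part_norm n + log_part_norm (Suc n))" .
qed (use log_part_nth_le log_part_norm_nonneg in \<open>auto simp: log_part_fps_def\<close>)

lemma log_part_fps_deriv: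
  assumes "i < 3"
  shows "(1 - fps_X) * (fps_X * fps_deriv (log_part_fps i)) = (1 - fps_X) * coni_fps vcyc i
     - fps_const (coni_nth vcyc i 0) - fps_X * log_part_fps (Suc i)"
proof (rule fps_ext)
  fix n
  show "fps_nth ((1 - fps_X) * (fps_X * fps_deriv (log_part_fps i))) n = fps_nth ((1 - fps_X) * coni_fps vcyc i
     - fps_const (coni_nth vcyc i 0) - fps_X * log_part_fps (Suc i)) n"
  proof (cases n)
    case (Suc m)
    with log_part_nth_Suc[OF assms, of m] show ?thesis
      by (cases m) (auto simp: left_diff_distrib log_part_fps_def coni_fps_def simp del: of_nat_Suc)
  qed (simp add: left_diff_distrib coni_fps_def)
qed

lemma log_part_fps_deriv_3:
  "fps_X * fps_deriv (log_part_fps 3) = coni_fps vcyc 3 - (fps_const (24/625) * log_part_fps 0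
     + fps_const (2/5) * log_part_fps 1 + fps_const (7/5) * log_part_fps 2 + fps_const 2 * log_part_fps 3)"
proof (rule fps_ext)
  fix n
  show "fps_nth (fps_X * fps_deriv (log_part_fps 3)) n = fps_nth (coni_fps vcyc 3 - (fps_const (24/625) * log_part_fps 0
     + fps_const (2/5) * log_part_fps 1 + fps_const (7/5) * log_part_fps 2 + fps_const 2 * log_part_fps 3)) n"
    using log_part_nth_3[of n] by (cases n) (auto simp: log_part_fps_def coni_fps_def simp del: of_nat_Suc)
qed

definition log_sol :: "complex \<Rightarrow> complex \<Rightarrow> complex ^ 4" where
  "log_sol s l = vec4 (eval_fps (log_part_fps 0) s) (eval_fps (log_part_fps 1) s)
     (eval_fps (log_part_fps 2) s + inverse s) (eval_fps (log_part_fps 3) s + inverse s ^ 2 - 7/5 * inverse s)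
     - l *s coni_sol vcyc s"

lemma eval_log_part_deriv:
  assumes "s \<in> lens"
  shows "i < 3 \<Longrightarrow> eval_fps (fps_deriv (log_part_fps i)) s =
      (eval_fps (coni_fps vcyc i) s - (coni_nth vcyc i 0 + s * eval_fps (log_part_fps (Suc i)) s) / (1 - s)) / s"
    and "eval_fps (fps_deriv (log_part_fps 3)) s = (eval_fps (coni_fps vcyc 3) s - (24/625 * eval_fps (log_part_fps 0) s
     + 2/5 * eval_fps (log_part_fps 1) s + 7/5 * eval_fps (log_part_fps 2) s + 2 * eval_fps (log_part_fps 3) s)) / s"
proof -
  have d: "1 \<le> fps_conv_radius (fps_deriv (log_part_fps i))" for i
    using log_part_fps_conv order.trans[OF _ fps_conv_radius_deriv] by blast
  have x: "1 \<le> fps_conv_radius (1 - fps_X :: complex fps)"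
    using conv1_intros(2)[of 1 fps_X] by simp
  have nz: "s \<noteq> 0" "1 - s \<noteq> 0" using assms by auto
  show "eval_fps (fps_deriv (log_part_fps i)) s =
      (eval_fps (coni_fps vcyc i) s - (coni_nth vcyc i 0 + s * eval_fps (log_part_fps (Suc i)) s) / (1 - s)) / s" if "i < 3"
  proof -
    have "(1 - s) * (s * eval_fps (fps_deriv (log_part_fps i)) s) =
        eval_fps ((1 - fps_X) * (fps_X * fps_deriv (log_part_fps i))) s"
      using assms d x by (simp add: lens_eval_fps conv1_intros)
    also have "\<dots> = (1 - s) * eval_fps (coni_fps vcyc i) s - coni_nth vcyc i 0 - s * eval_fps (log_part_fps (Suc i)) s"
      unfolding log_part_fps_deriv[OF that]
      using assms x by (simp add: lens_eval_fps conv1_intros coni_fps_conv log_part_fps_conv)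
    finally show ?thesis using nz by (simp add: field_simps)
  qed
  have "s * eval_fps (fps_deriv (log_part_fps 3)) s = eval_fps (fps_X * fps_deriv (log_part_fps 3)) s"
    using assms d by (simp add: lens_eval_fps)
  also have "\<dots> = eval_fps (coni_fps vcyc 3) s - (24/625 * eval_fps (log_part_fps 0) s
     + 2/5 * eval_fps (log_part_fps 1) s + 7/5 * eval_fps (log_part_fps 2) s + 2 * eval_fps (log_part_fps 3) s)"
    unfolding log_part_fps_deriv_3 using assms by (simp add: lens_eval_fps conv1_intros coni_fps_conv log_part_fps_conv)
  finally show "eval_fps (fps_deriv (log_part_fps 3)) s = (eval_fps (coni_fps vcyc 3) s - (24/625 * eval_fps (log_part_fps 0) s
     + 2/5 * eval_fps (log_part_fps 1) s + 7/5 * eval_fps (log_part_fps 2) s + 2 * eval_fps (log_part_fps 3) s)) / s"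
    using nz by (simp add: field_simps)
qed

lemma pf_solution_log_sol: "pf_solution (\<lambda>z. log_sol (1 - z) (Ln (1 - z)))"
proof (rule pf_solution_reflectI)
  fix s assume s: "s \<in> lens"
  then have nz: "s \<noteq> 0" "1 - s \<noteq> 0" by auto
  have ln: "(Ln has_field_derivative 1 / s) (at s)"
    using has_field_derivative_Ln[OF lens_nonpos[OF s]] by (simp add: inverse_eq_divide)
  have iv: "(inverse has_field_derivative - (1 / s ^ 2)) (at s)"
    by (rule DERIV_cong[OF DERIV_inverse[OF nz(1)]]) (simp add: power2_eq_square divide_simps)
  have iv2: "((\<lambda>s. inverse s ^ 2) has_field_derivative - (2 / s ^ 3)) (at s)"
    by (rule DERIV_cong[OF DERIV_power[OF iv]]) (use nz in \<open>simp add: divide_simps power2_eq_square power3_eq_cube\<close>)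
  have p5: "s ^ 5 = s * (s * (s * (s * s)))" by (simp add: eval_nat_numeral)
  note e = has_field_derivative_eval_fps[OF lens_conv[OF s log_part_fps_conv]]
  have S: "Suc 0 = 1" "Suc 1 = 2" "Suc 2 = 3" by simp_all
  have "(0::nat) < 3" "(1::nat) < 3" "(2::nat) < 3" by simp_all
  note lt = this
  note c0 = eval_coni_has_derivative(1)[OF s lt(1), where v = vcyc, unfolded S]
    and c1 = eval_coni_has_derivative(1)[OF s lt(2), where v = vcyc, unfolded S]
    and c2 = eval_coni_has_derivative(1)[OF s lt(3), where v = vcyc, unfolded S]
    and c3 = eval_coni_has_derivative(2)[OF s, where v = vcyc]
  have ev0: "coni_nth vcyc 0 0 = 0" "coni_nth vcyc 1 0 = 1" "coni_nth vcyc 2 0 = - (2/5)"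
    by (simp_all add: coni_nth_def)
  note d0 = eval_log_part_deriv(1)[OF s lt(1), unfolded S ev0]
    and d1 = eval_log_part_deriv(1)[OF s lt(2), unfolded S ev0]
    and d2 = eval_log_part_deriv(1)[OF s lt(3), unfolded S ev0]
    and d3 = eval_log_part_deriv(2)[OF s]
  show "((\<lambda>s. log_sol s (Ln s) $ 1) has_field_derivative - log_sol s (Ln s) $ 2 / (1 - s)) (at s)"
    unfolding log_sol_def coni_sol_def vec4_nth vector_minus_component vector_smult_component
    by (rule DERIV_cong[OF DERIV_diff[OF e DERIV_mult[OF ln c0]]], unfold d0)
      (use nz in \<open>simp add: divide_simps; simp add: algebra_simps\<close>)
  show "((\<lambda>s. log_sol s (Ln s) $ 2) has_field_derivative - log_sol s (Ln s) $ 3 / (1 - s)) (at s)"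
    unfolding log_sol_def coni_sol_def vec4_nth vector_minus_component vector_smult_component
    by (rule DERIV_cong[OF DERIV_diff[OF e DERIV_mult[OF ln c1]]], unfold d1)
      (use nz in \<open>simp add: divide_simps; simp add: algebra_simps\<close>)
  show "((\<lambda>s. log_sol s (Ln s) $ 3) has_field_derivative - log_sol s (Ln s) $ 4 / (1 - s)) (at s)"
    unfolding log_sol_def coni_sol_def vec4_nth vector_minus_component vector_smult_component
    by (rule DERIV_cong[OF DERIV_diff[OF DERIV_add[OF e iv] DERIV_mult[OF ln c2]]], unfold d2)
      (use nz in \<open>simp add: divide_simps; simp add: algebra_simps power2_eq_square\<close>)
  show "((\<lambda>s. log_sol s (Ln s) $ 4) has_field_derivative - (24/625 * log_sol s (Ln s) $ 1
     + 2/5 * log_sol s (Ln s) $ 2 + 7/5 * log_sol s (Ln s) $ 3 + 2 * log_sol s (Ln s) $ 4) / s) (at s)"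
    unfolding log_sol_def coni_sol_def vec4_nth vector_minus_component vector_smult_component
    by (rule DERIV_cong[OF DERIV_diff[OF DERIV_diff[OF DERIV_add[OF e iv2] DERIV_cmult[OF iv]] DERIV_mult[OF ln c3]]], unfold d3)
      (use nz in \<open>simp add: divide_simps; simp add: algebra_simps power2_eq_square power3_eq_cube p5\<close>)
qed

subsection \<open>The intersection form and the connection matrix\<close>

text \<open>The Picard-Fuchs operator is self-adjoint up to a factor, which makes this alternating form
  constant on pairs of solutions.\<close>

definition pf_form :: "complex \<Rightarrow> complex ^ 4 \<Rightarrow> complex ^ 4 \<Rightarrow> complex" where
  "pf_form z Y Z = (1 - z) * ((Y $ 1 * Z $ 4 - Y $ 4 * Z $ 1) - (Y $ 2 * Z $ 3 - Y $ 3 * Z $ 2))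
     - z * (Y $ 1 * Z $ 3 - Y $ 3 * Z $ 1) - 2/5 * z * (Y $ 1 * Z $ 2 - Y $ 2 * Z $ 1)"

abbreviation symp :: "complex ^ 4 \<Rightarrow> complex ^ 4 \<Rightarrow> complex" where
  "symp \<equiv> pf_form 0"

lemma pf_form_linear:
  "pf_form z (X + Y) Z = pf_form z X Z + pf_form z Y Z" "pf_form z (c *s X) Z = c * pf_form z X Z"
  "pf_form z X (Y + Z) = pf_form z X Y + pf_form z X Z" "pf_form z X (c *s Y) = c * pf_form z X Y"
  "pf_form z (X - Y) Z = pf_form z X Z - pf_form z Y Z" "pf_form z X (Y - Z) = pf_form z X Y - pf_form z X Z"
  by (simp_all add: pf_form_def algebra_simps)

lemma pf_form_self [simp]: "pf_form z X X = 0"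
  by (simp add: pf_form_def algebra_simps)

lemma pf_form_commute: "pf_form z Y X = - pf_form z X Y"
  by (simp add: pf_form_def algebra_simps)

lemma pf_form_nondegenerate:
  assumes "z \<noteq> 1" "\<And>X. pf_form z X Y = 0"
  shows "Y = 0"
proof -
  have "1 - z \<noteq> 0" using assms by simp
  have 1: "Y $ 1 = 0" using assms(2)[of "vec4 0 0 0 1"] \<open>1 - z \<noteq> 0\<close> by (simp add: pf_form_def)
  have 2: "Y $ 2 = 0" using assms(2)[of "vec4 0 0 1 0"] \<open>1 - z \<noteq> 0\<close> 1 by (simp add: pf_form_def)
  have 3: "Y $ 3 = 0" using assms(2)[of "vec4 0 1 0 0"] \<open>1 - z \<noteq> 0\<close> 1 by (simp add: pf_form_def)
  have 4: "Y $ 4 = 0" using assms(2)[of "vec4 1 0 0 0"] \<open>1 - z \<noteq> 0\<close> 1 2 3 by (simp add: pf_form_def)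
  show ?thesis using 1 2 3 4 by (simp add: vec4_eq_iff)
qed

lemma pf_solutionE:
  assumes "pf_solution Y" "z \<in> lens"
  obtains a b c d where
    "((\<lambda>z. Y z $ 1) has_field_derivative a) (at z)" "Y z $ 2 = z * a"
     "((\<lambda>z. Y z $ 2) has_field_derivative b) (at z)" "Y z $ 3 = z * b"
     "((\<lambda>z. Y z $ 3) has_field_derivative c) (at z)" "Y z $ 4 = z * c"
     "((\<lambda>z. Y z $ 4) has_field_derivative d) (at z)"
     "24/625 * Y z $ 1 + 2/5 * Y z $ 2 + 7/5 * Y z $ 3 + 2 * Y z $ 4 = (1 - z) * d"
proof (rule that[of "Y z $ 2 / z" "Y z $ 3 / z" "Y z $ 4 / z"
      "(24/625 * Y z $ 1 + 2/5 * Y z $ 2 + 7/5 * Y z $ 3 + 2 * Y z $ 4) / (1 - z)"])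
  have "z \<noteq> 0" "1 - z \<noteq> 0" using assms(2) by auto
  then show "Y z $ 2 = z * (Y z $ 2 / z)" "Y z $ 3 = z * (Y z $ 3 / z)" "Y z $ 4 = z * (Y z $ 4 / z)"
    "24/625 * Y z $ 1 + 2/5 * Y z $ 2 + 7/5 * Y z $ 3 + 2 * Y z $ 4 =
      (1 - z) * ((24/625 * Y z $ 1 + 2/5 * Y z $ 2 + 7/5 * Y z $ 3 + 2 * Y z $ 4) / (1 - z))"
    by simp_all
qed (use assms in \<open>auto simp: pf_solution_def\<close>)

lemma pf_form_const:
  assumes "pf_solution Y" "pf_solution Z"
  shows "\<exists>k. \<forall>z\<in>lens. pf_form z (Y z) (Z z) = k"
proof (rule has_field_derivative_zero_constant[OF convex_lens])
  fix z assume z: "z \<in> lens"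
  then have nz: "z \<noteq> 0" "1 - z \<noteq> 0" by auto
  obtain a b c d where
    Y: "((\<lambda>z. Y z $ 1) has_field_derivative a) (at z)" "Y z $ 2 = z * a"
     "((\<lambda>z. Y z $ 2) has_field_derivative b) (at z)" "Y z $ 3 = z * b"
     "((\<lambda>z. Y z $ 3) has_field_derivative c) (at z)" "Y z $ 4 = z * c"
     "((\<lambda>z. Y z $ 4) has_field_derivative d) (at z)"
     "24/625 * Y z $ 1 + 2/5 * Y z $ 2 + 7/5 * Y z $ 3 + 2 * Y z $ 4 = (1 - z) * d"
    using pf_solutionE[OF assms(1) z] by blast
  obtain a' b' c' d' where
    Z: "((\<lambda>z. Z z $ 1) has_field_derivative a') (at z)" "Z z $ 2 = z * a'"
     "((\<lambda>z. Z z $ 2) has_field_derivative b') (at z)" "Z z $ 3 = z * b'"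
     "((\<lambda>z. Z z $ 3) has_field_derivative c') (at z)" "Z z $ 4 = z * c'"
     "((\<lambda>z. Z z $ 4) has_field_derivative d') (at z)"
     "24/625 * Z z $ 1 + 2/5 * Z z $ 2 + 7/5 * Z z $ 3 + 2 * Z z $ 4 = (1 - z) * d'"
    using pf_solutionE[OF assms(2) z] by blast
  note [derivative_intros] = Y(1,3,5,7) Z(1,3,5,7)
  have yd: "(1 - z) * (Z z $ 1 * d) = Z z $ 1 * (24/625 * Y z $ 1 + 2/5 * Y z $ 2 + 7/5 * Y z $ 3 + 2 * Y z $ 4)"
    and zd: "(1 - z) * (Y z $ 1 * d') = Y z $ 1 * (24/625 * Z z $ 1 + 2/5 * Z z $ 2 + 7/5 * Z z $ 3 + 2 * Z z $ 4)"
    unfolding Y(8) Z(8) by simp_all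
  have "((\<lambda>z. pf_form z (Y z) (Z z)) has_field_derivative (1 - z) * (Y z $ 1 * d') - (1 - z) * (Z z $ 1 * d)
      + (1 - z) * (a * Z z $ 4 - Y z $ 4 * a' - (b * Z z $ 3 + Y z $ 2 * c' - c * Z z $ 2 - Y z $ 3 * b'))
      - ((Y z $ 1 * Z z $ 4 - Y z $ 4 * Z z $ 1) - (Y z $ 2 * Z z $ 3 - Y z $ 3 * Z z $ 2))
      - (Y z $ 1 * Z z $ 3 - Y z $ 3 * Z z $ 1) - z * (a * Z z $ 3 + Y z $ 1 * c' - c * Z z $ 1 - Y z $ 3 * a')
      - 2/5 * (Y z $ 1 * Z z $ 2 - Y z $ 2 * Z z $ 1) - 2/5 * z * (a * Z z $ 2 + Y z $ 1 * b' - b * Z z $ 1 - Y z $ 2 * a')) (at z)"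
    unfolding pf_form_def
    by (rule derivative_eq_intros refl)+ (simp add: algebra_simps)
  then have "((\<lambda>z. pf_form z (Y z) (Z z)) has_field_derivative 0) (at z)"
    by (rule DERIV_cong) (unfold yd zd, simp add: Y(2,4,6) Z(2,4,6) algebra_simps)
  then show "((\<lambda>z. pf_form z (Y z) (Z z)) has_field_derivative 0) (at z within lens)"
    by (rule has_field_derivative_at_within)
qed

lemma logpoly_frob_sol: "logpoly (\<lambda>z l. frob_sol z l a $ i)"
proof -
  have div: "logpoly (\<lambda>z l. l ^ n / c)" for n c
    unfolding divide_inverse by (intro logpoly_mult logpoly_power logpoly_log logpoly_const)
  have le: "logpoly (\<lambda>z l. log_exp l a $ j)" for j
    using exhaust_4[of j] unfolding log_exp_def
    by (elim disjE; hypsubst; unfold vec4_nth; intro logpoly_add logpoly_mult div logpoly_log logpoly_const)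
  have "logpoly (\<lambda>z l. frob_row k z (log_exp l a))" if "k < 4" for k
    unfolding frob_row_def using that by (intro logpoly_add logpoly_mult logpoly_eval_fps le frob_fps_conv) auto
  then show ?thesis using exhaust_4[of i] by (auto simp: frob_sol_def)
qed

lemma logpoly_pf_form:
  assumes "\<And>i. logpoly (\<lambda>z l. Y z l $ i)" "\<And>i. logpoly (\<lambda>z l. Z z l $ i)"
  shows "logpoly (\<lambda>z l. pf_form z (Y z l) (Z z l))"
  unfolding pf_form_def by (intro logpoly_intros assms)

lemma at_0_unique:
  fixes f :: "complex \<Rightarrow> complex"
  assumes "isCont f 0" "\<And>z. z \<in> lens \<Longrightarrow> f z = k"
  shows "f 0 = k"
proof (rule tendsto_unique)
  have "(of_real \<longlongrightarrow> complex_of_real 0) (at_right 0)"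
    by (rule tendsto_of_real) (rule tendsto_ident_at)
  with assms(1) show "((\<lambda>x::real. f (of_real x)) \<longlongrightarrow> f 0) (at_right 0)"
    by (intro isCont_tendsto_compose[of 0 f]) auto
  show "((\<lambda>x::real. f (of_real x)) \<longlongrightarrow> k) (at_right 0)"
    by (rule tendsto_eventually, rule eventually_at_rightI[of 0 1])
      (use assms(2) of_real_in_lens in auto)
qed (simp add: trivial_limit_at_right_real)

lemma isCont_eval_fps_0: "1 \<le> fps_conv_radius F \<Longrightarrow> isCont (eval_fps F) (0::complex)"
  using less_le_trans[of 0 1 "fps_conv_radius F"]
  by (intro continuous_eval_fps) (simp add: zero_ereal_def[symmetric])

lemma isCont_frob_sol_0: "isCont (\<lambda>z. frob_sol z l a $ i) 0"
proof -
  have "isCont (\<lambda>z. frob_row k z b) 0" if "k < 4" for k b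
    unfolding frob_row_def using that by (intro continuous_intros isCont_eval_fps_0 frob_fps_conv) auto
  then show ?thesis using exhaust_4[of i] by (auto simp: frob_sol_def)
qed

lemma frob_sol_at_0: "frob_sol 0 0 a = a"
proof -
  have "frob_row i 0 b = (if i = 0 then b $ 1 else if i = 1 then b $ 2 else if i = 2 then b $ 3 else if i = 3 then b $ 4 else 0)" for i b
    unfolding frob_row_def eval_fps_at_0 frob_fps_def fps_nth_Abs_fps frob_nth_at_0 by auto
  moreover have "log_exp 0 a = a" by (simp add: log_exp_def vec4_eq_iff)
  ultimately show ?thesis by (simp add: frob_sol_def vec4_eq_iff)
qed

text \<open>The form is constant for l = Ln z, hence for free \<open>l\<close>. With l = 0 no
  logarithm remains, and as z tends to 0 the matrix S(z) tends to the identity, which gives the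
  value.\<close>

lemma pf_form_frob_sol:
  assumes "z \<in> lens" shows "pf_form z (frob_sol z l a) (frob_sol z l b) = symp a b"
proof -
  obtain k where k: "\<And>z. z \<in> lens \<Longrightarrow> pf_form z (frob_sol z (Ln z) a) (frob_sol z (Ln z) b) = k"
    using pf_form_const[OF pf_solution_frob_sol[of a] pf_solution_frob_sol[of b]] by auto
  have "pf_form z (frob_sol z l a) (frob_sol z l b) - k = 0" if "z \<in> lens" for z l
    by (rule logpoly_eq_0[OF logpoly_diff[OF logpoly_pf_form logpoly_const] _ that])
      (simp_all add: logpoly_frob_sol k)
  then have k': "pf_form z (frob_sol z l a) (frob_sol z l b) = k" if "z \<in> lens" for z l
    using that by simp
  have "pf_form 0 (frob_sol 0 0 a) (frob_sol 0 0 b) = k"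
  proof (rule at_0_unique[where f = "\<lambda>z. pf_form z (frob_sol z 0 a) (frob_sol z 0 b)"])
    show "isCont (\<lambda>z. pf_form z (frob_sol z 0 a) (frob_sol z 0 b)) 0"
      unfolding pf_form_def by (intro isCont_diff isCont_mult isCont_frob_sol_0 continuous_const continuous_ident)
  qed (rule k')
  with k'[OF assms] show ?thesis by (simp add: frob_sol_at_0)
qed

text \<open>The value of the form on two solutions does not depend on \<open>l\<close>, and a shift
  of \<open>l\<close> is an application of \<open>log_exp\<close>.\<close>

lemma symp_log_exp [simp]: "symp (log_exp c a) (log_exp c b) = symp a b"
proof -
  have h: "of_real (1/2) \<in> lens" by (rule of_real_in_lens) auto
  show ?thesis
    unfolding pf_form_frob_sol[OF h, of 0, symmetric] frob_sol_log_exp[symmetric] add_0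
    unfolding pf_form_frob_sol[OF h] ..
qed

lemma frob_sol_surj:
  assumes "z \<in> lens" shows "\<exists>a. frob_sol z l a = Y"
proof -
  have lin: "Vector_Spaces.linear (*s) (*s) (frob_sol z l)"
    unfolding Vector_Spaces.linear_iff by (simp add: frob_sol_linear vec.vector_space_axioms)
  have "inj (frob_sol z l)"
  proof (rule injI)
    fix a b assume "frob_sol z l a = frob_sol z l b"
    then have "symp X (a - b) = 0" for X
      unfolding pf_form_linear pf_form_frob_sol[OF assms, of l, symmetric] by simp
    then have "a - b = 0" by (intro pf_form_nondegenerate[of 0]) auto
    then show "a = b" by simp
  qed
  from vec.linear_inj_imp_surj[OF lin this] show ?thesis by (metis surjD)
qed

text \<open>The pairings of \<open>Y\<close> with the fundamental solutions are constants and the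
  form is nondegenerate, so these constants determine \<open>Y\<close>. This takes the place of a
  uniqueness theorem for the differential equation.\<close>

lemma pf_solution_eq_frob_sol:
  assumes "pf_solution Y"
  shows "\<exists>x. \<forall>z\<in>lens. Y z = frob_sol z (Ln z) x"
proof -
  obtain k where k: "\<And>a z. z \<in> lens \<Longrightarrow> pf_form z (frob_sol z (Ln z) a) (Y z) = k a"
    using pf_form_const[OF pf_solution_frob_sol assms] by (rule_tac that[of "\<lambda>a. SOME k. \<forall>z\<in>lens. pf_form z (frob_sol z (Ln z) a) (Y z) = k"]) (rule someI2_ex, auto)
  \<comment> \<open>The vector that represents the linear functional \<open>k\<close> through the
    form: \<open>k a = symp a x\<close>.\<close>
  define x where "x = vec4 (- k (vec4 0 0 0 1)) (k (vec4 0 0 1 0)) (- k (vec4 0 1 0 0)) (k (vec4 1 0 0 0))"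
  have "Y z = frob_sol z (Ln z) x" if z: "z \<in> lens" for z
  proof -
    have ka: "k a = symp a x" for a
    proof -
      have a: "a = a $ 1 *s vec4 1 0 0 0 + a $ 2 *s vec4 0 1 0 0 + a $ 3 *s vec4 0 0 1 0 + a $ 4 *s vec4 0 0 0 1"
        by (simp add: vec4_eq_iff)
      have "k a = a $ 1 * k (vec4 1 0 0 0) + a $ 2 * k (vec4 0 1 0 0) + a $ 3 * k (vec4 0 0 1 0) + a $ 4 * k (vec4 0 0 0 1)"
        unfolding k[OF z, symmetric] by (subst (1) a) (simp add: frob_sol_linear pf_form_linear)
      then show ?thesis by (simp add: x_def pf_form_def)
    qed
    have "pf_form z X (Y z - frob_sol z (Ln z) x) = 0" for X
    proof -
      obtain a where "frob_sol z (Ln z) a = X" using frob_sol_surj[OF z] by blast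
      then show ?thesis using k[OF z, of a] ka[of a] pf_form_frob_sol[OF z, of "Ln z" a x]
        by (simp add: pf_form_linear)
    qed
    then have "Y z - frob_sol z (Ln z) x = 0" by (rule pf_form_nondegenerate[rotated]) (use z in auto)
    then show ?thesis by simp
  qed
  then show ?thesis by blast
qed

section \<open>The basis at the conifold point and the connection matrix\<close>

definition coni_basis :: "complex \<Rightarrow> complex \<Rightarrow> complex ^ 4 \<Rightarrow> complex ^ 4" where
  "coni_basis s l x = x $ 1 *s coni_sol (1, 0, 0) s + x $ 2 *s coni_sol (0, 0, 1) s + x $ 3 *s coni_sol vcyc s
     + x $ 4 *s log_sol s l"

definition coni_vec :: "complex \<times> complex \<times> complex \<Rightarrow> complex ^ 4" where
  "coni_vec v = (SOME x. \<forall>z\<in>lens. coni_sol v (1 - z) = frob_sol z (Ln z) x)"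

definition log_vec :: "complex ^ 4" where
  "log_vec = (SOME x. \<forall>z\<in>lens. log_sol (1 - z) (Ln (1 - z)) = frob_sol z (Ln z) x)"

text \<open>The change of coordinates from the basis at 1 to the basis at 0. Its entries stay
  unevaluated.\<close>

definition connection :: "complex ^ 4 \<Rightarrow> complex ^ 4" where
  "connection x = x $ 1 *s coni_vec (1, 0, 0) + x $ 2 *s coni_vec (0, 0, 1) + x $ 3 *s coni_vec vcyc + x $ 4 *s log_vec"

lemma coni_sol_eq: "z \<in> lens \<Longrightarrow> coni_sol v (1 - z) = frob_sol z (Ln z) (coni_vec v)"
  using someI_ex[OF pf_solution_eq_frob_sol[OF pf_solution_coni_sol[of v]]]
  unfolding coni_vec_def by blast

lemma log_sol_eq: "z \<in> lens \<Longrightarrow> log_sol (1 - z) (Ln (1 - z)) = frob_sol z (Ln z) log_vec"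
  using someI_ex[OF pf_solution_eq_frob_sol[OF pf_solution_log_sol]]
  unfolding log_vec_def by blast

lemma coni_basis_eq: "z \<in> lens \<Longrightarrow> coni_basis (1 - z) (Ln (1 - z)) x = frob_sol z (Ln z) (connection x)"
  by (simp add: coni_basis_def connection_def coni_sol_eq log_sol_eq frob_sol_linear)

lemma log_sol_add: "log_sol s (l + k) = log_sol s l - k *s coni_sol vcyc s"
  by (simp add: log_sol_def vec_eq_iff algebra_simps)

text \<open>The one-parameter group through the monodromy at 1: it moves a solution along the
  vanishing cycle, in proportion to its logarithmic coordinate.\<close>

lemma coni_basis_add:
  "coni_basis s (l + k) x = coni_basis s l (x - (k * x $ 4) *s vec4 0 0 1 0)"
  unfolding coni_basis_def log_sol_add by (simp add: vec_eq_iff algebra_simps)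

lemma logpoly_coni_basis: "logpoly (\<lambda>s l. coni_basis s l x $ i)"
proof -
  have c: "logpoly (\<lambda>s l. coni_sol v s $ i)" for v i
    using exhaust_4[of i] unfolding coni_sol_def
    by (elim disjE; hypsubst; unfold vec4_nth; intro logpoly_eval_fps coni_fps_conv)
  have "logpoly (\<lambda>s l. log_sol s l $ i)" for i
    using exhaust_4[of i] unfolding log_sol_def
    by (elim disjE; hypsubst; unfold vec4_nth vector_minus_component vector_smult_component;
        intro logpoly_diff logpoly_add logpoly_mult logpoly_power logpoly_eval_fps log_part_fps_conv
          logpoly_inverse logpoly_const logpoly_log c)
  then show ?thesis
    unfolding coni_basis_def vector_add_component vector_smult_component
    by (intro logpoly_add logpoly_cmult c)
qed

lemma isCont_coni_sol_0: "isCont (\<lambda>s. coni_sol v s $ i) 0"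
  using exhaust_4[of i] unfolding coni_sol_def
  by (elim disjE; hypsubst; unfold vec4_nth; intro isCont_eval_fps_0 coni_fps_conv)

lemma coni_sol_at_0:
  "coni_sol (a, b, c) 0 $ 1 = a" "coni_sol (a, b, c) 0 $ 2 = b" "coni_sol (a, b, c) 0 $ 3 = c"
  unfolding coni_sol_def vec4_nth eval_fps_at_0 coni_fps_def fps_nth_Abs_fps coni_nth_def by simp_all

lemma connection_linear:
  "connection (x + y) = connection x + connection y" "connection (c *s x) = c *s connection x"
  "connection (x - y) = connection x - connection y"
  by (simp_all add: connection_def vec_eq_iff algebra_simps)

text \<open>A linear dependence is an identity with log s free. Comparing two values of the
  logarithm isolates x_4 times the vanishing cycle, whose second entry is 1 at s = 0. The three
  remaining solutions are told apart by their first three initial values.\<close>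

lemma connection_eq_0:
  assumes "connection x = 0" shows "x = 0"
proof -
  have zero: "coni_basis s (Ln s) x = 0" if "s \<in> lens" for s
    using coni_basis_eq[OF lens_one_minus[OF that], of x] assms frob_sol_linear(2)[of _ _ 0 0]
    by simp
  have zero_l: "coni_basis s l x $ i = 0" if "s \<in> lens" for s l i
    by (rule logpoly_eq_0[OF logpoly_coni_basis _ that]) (simp add: zero)
  have c4: "x $ 4 * coni_sol vcyc s $ 2 = 0" if "s \<in> lens" for s
    using zero_l[OF that, of 0 2] zero_l[OF that, of "0 + 1" 2] unfolding coni_basis_add
    by (simp add: coni_basis_def algebra_simps)
  have "x $ 4 * coni_sol vcyc 0 $ 2 = 0"
    by (rule at_0_unique[where f = "\<lambda>s. x $ 4 * coni_sol vcyc s $ 2"])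
      (intro isCont_mult isCont_coni_sol_0 continuous_const, rule c4)
  then have x4: "x $ 4 = 0" by (simp add: coni_sol_at_0)
  have "x $ 1 * coni_sol (1, 0, 0) 0 $ i + x $ 2 * coni_sol (0, 0, 1) 0 $ i + x $ 3 * coni_sol vcyc 0 $ i = 0" for i
  proof (rule at_0_unique[where f = "\<lambda>s. x $ 1 * coni_sol (1, 0, 0) s $ i + x $ 2 * coni_sol (0, 0, 1) s $ i
      + x $ 3 * coni_sol vcyc s $ i"])
    fix s :: complex assume "s \<in> lens"
    from zero_l[OF this, of 0 i] x4
    show "x $ 1 * coni_sol (1, 0, 0) s $ i + x $ 2 * coni_sol (0, 0, 1) s $ i + x $ 3 * coni_sol vcyc s $ i = 0"
      by (simp add: coni_basis_def)
  qed (intro isCont_add isCont_mult isCont_coni_sol_0 continuous_const)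
  from this[of 1] this[of 2] this[of 3] x4 show ?thesis
    by (simp add: coni_sol_at_0 vec4_eq_iff)
qed

lemma connection_surj: "\<exists>x. connection x = a"
proof -
  have lin: "Vector_Spaces.linear (*s) (*s) connection"
    unfolding Vector_Spaces.linear_iff by (simp add: connection_linear vec.vector_space_axioms)
  have "inj connection"
    by (rule injI) (metis connection_eq_0 connection_linear(3) eq_iff_diff_eq_0)
  from vec.linear_inj_imp_surj[OF lin this] show ?thesis by (metis surjD)
qed

lemma coni_vec_vcyc: "coni_vec vcyc = connection (vec4 0 0 1 0)"
  by (simp add: connection_def)

text \<open>At z = 1 the form involves only the first three entries, and the initial values (0, 1,
  -2/5) span its radical there.\<close>

lemma symp_vcyc_coni: "symp (coni_vec vcyc) (coni_vec (a, b, c)) = 0"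
proof -
  define f where "f s = pf_form (1 - s) (coni_sol vcyc s) (coni_sol (a, b, c) s)" for s
  have "f 0 = symp (coni_vec vcyc) (coni_vec (a, b, c))"
  proof (rule at_0_unique)
    show "isCont f 0" unfolding f_def pf_form_def
      by (intro isCont_diff isCont_mult isCont_coni_sol_0 continuous_const continuous_ident)
    fix s assume "s \<in> lens"
    then show "f s = symp (coni_vec vcyc) (coni_vec (a, b, c))"
      using coni_sol_eq[OF lens_one_minus, of s] pf_form_frob_sol[OF lens_one_minus, of s] by (simp add: f_def)
  qed
  then show ?thesis by (simp add: f_def pf_form_def coni_sol_at_0)
qed

text \<open>Pairing with the vanishing cycle reads off the logarithmic coordinate, which makes the
  shift of log s a transvection.\<close>

lemma symp_vcyc_connection: "symp (coni_vec vcyc) (connection x) = x $ 4 * symp (coni_vec vcyc) log_vec"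
  by (simp add: connection_def pf_form_linear symp_vcyc_coni)

lemma symp_vcyc_log_vec: "symp (coni_vec vcyc) log_vec \<noteq> 0"
proof
  assume "symp (coni_vec vcyc) log_vec = 0"
  then have "symp (coni_vec vcyc) X = 0" for X
    using connection_surj[of X] symp_vcyc_connection by auto
  then have "symp X (coni_vec vcyc) = 0" for X
    using pf_form_commute[of 0 X "coni_vec vcyc"] by simp
  then have "coni_vec vcyc = 0" by (intro pf_form_nondegenerate[of 0]) auto
  then have "vec4 0 0 1 0 = (0 :: complex ^ 4)" unfolding coni_vec_vcyc by (rule connection_eq_0)
  then show False by (simp add: vec4_eq_iff)
qed

subsection \<open>The holomorphic solution is singular at the conifold point\<close>

lemma frob_nth_0_right: "frob_nth i 0 n = of_nat n ^ i * frob_nth 0 0 n"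
  by (induction i) (simp_all add: frob_nth_Suc_left)

text \<open>From n = 1 on, where it equals 24/625, the quantity n^2 r_n does not decrease, because
  the quartic of the recursion is at least n^2 (n + 1)^2.\<close>

lemma frob_nth_real:
  "\<exists>r. frob_nth 0 0 n = of_real r \<and> 0 \<le> r \<and> (n > 0 \<longrightarrow> 24/625 \<le> real n ^ 2 * r)"
proof (induction n)
  case 0 show ?case by (rule exI[of _ 1]) (simp add: frob_nth_at_0)
next
  case (Suc n)
  then obtain r where r: "frob_nth 0 0 n = of_real r" "0 \<le> r" "n > 0 \<Longrightarrow> 24/625 \<le> real n ^ 2 * r" by blast
  define N where "N = real n"
  define r' where "r' = (N ^ 4 + 2 * N ^ 3 + 7/5 * N ^ 2 + 2/5 * N + 24/625) * r / (N + 1) ^ 4"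
  have N: "0 \<le> N" by (simp add: N_def)
  have "complex_of_real (N + 1) ^ 4 * frob_nth 0 0 (Suc n) = of_real ((N ^ 4 + 2 * N ^ 3 + 7/5 * N ^ 2 + 2/5 * N + 24/625) * r)"
    using frob_nth_4_Suc[of 0 n]
    unfolding frob_nth_0_right[of 4] frob_nth_0_right[of 3] frob_nth_0_right[of 2] frob_nth_0_right[of 1] r(1)
    by (simp add: N_def algebra_simps)
  moreover have nz: "complex_of_real (N + 1) ^ 4 \<noteq> 0" using N by (simp del: of_real_add)
  ultimately have "frob_nth 0 0 (Suc n) = of_real r'"
    unfolding r'_def of_real_divide of_real_power by (simp add: field_simps del: of_real_add)
  moreover have "0 \<le> r'" using N r(2) by (simp add: r'_def)
  moreover have "24/625 \<le> real (Suc n) ^ 2 * r'"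
  proof (cases "n = 0")
    case True
    then have "r = 1" using r(1) by (simp add: frob_nth_at_0)
    with True show ?thesis by (simp add: r'_def N_def)
  next
    case False
    have "N ^ 2 * (N + 1) ^ 2 * r \<le> (N ^ 4 + 2 * N ^ 3 + 7/5 * N ^ 2 + 2/5 * N + 24/625) * r"
    proof (rule mult_right_mono[OF _ r(2)])
      have "N ^ 4 + 2 * N ^ 3 + 7/5 * N ^ 2 + 2/5 * N + 24/625 = N ^ 2 * (N + 1) ^ 2 + (2/5 * N ^ 2 + 2/5 * N + 24/625)"
        by algebra
      also have "\<dots> \<ge> N ^ 2 * (N + 1) ^ 2" using N by simp
      finally show "N ^ 2 * (N + 1) ^ 2 \<le> N ^ 4 + 2 * N ^ 3 + 7/5 * N ^ 2 + 2/5 * N + 24/625" .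
    qed
    then have "N ^ 2 * (N + 1) ^ 2 * r / (N + 1) ^ 4 * (N + 1) ^ 2 \<le> r' * (N + 1) ^ 2"
      unfolding r'_def by (rule mult_right_mono[OF divide_right_mono]) (use N in auto)
    moreover have "N ^ 2 * (N + 1) ^ 2 * r / (N + 1) ^ 4 * (N + 1) ^ 2 = N ^ 2 * r"
    proof -
      have "(N + 1) ^ 4 = (N + 1) ^ 2 * (N + 1) ^ 2" by (simp flip: power_add)
      moreover have "(N + 1) ^ 2 \<noteq> 0" using N by simp
      ultimately show ?thesis by (simp only: nonzero_mult_div_cancel_right divide_divide_eq_left[symmetric] times_divide_eq_left
            mult.assoc[symmetric] nonzero_eq_divide_eq) (simp add: mult_ac)
    qed
    ultimately show ?thesis using r(3) False by (simp add: N_def mult.commute add.commute)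
  qed
  ultimately show ?case by (intro exI[of _ r']) simp
qed

text \<open>\<theta> of the holomorphic solution has the coefficients n r_n, at least (24/625)/n for
  n > 0. They are nonnegative, so a bound near z = 1 would bound all partial sums and make the
  harmonic series converge.\<close>

lemma frob_fps_1_0_unbounded:
  assumes "eventually (\<lambda>s. norm (eval_fps (frob_fps 1 0) (1 - of_real s)) \<le> M) (at_right 0)"
  shows False
proof -
  define R where "R s = eval_fps (frob_fps 1 0) (1 - s)" for s
  obtain r where r: "\<And>n. frob_nth 0 0 n = of_real (r n)" "\<And>n. 0 \<le> r n"
    "\<And>n. n > 0 \<Longrightarrow> 24/625 \<le> real n ^ 2 * r n"
    using frob_nth_real by metis
  have nth: "fps_nth (frob_fps 1 0) n = of_real (real n * r n)" for n
    unfolding frob_fps_def fps_nth_Abs_fps frob_nth_0_right[of 1] r(1) by simp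
  have partial: "(\<Sum>n<N. real n * r n * (1 - s) ^ n) \<le> norm (R (of_real s))" if "0 < s" "s < 1" for s N
  proof -
    have "complex_of_real (1 - s) \<in> lens" using that by (intro of_real_in_lens) auto
    then have "(\<lambda>n. fps_nth (frob_fps 1 0) n * of_real (1 - s) ^ n) sums eval_fps (frob_fps 1 0) (of_real (1 - s))"
      by (intro sums_eval_fps lens_conv frob_fps_conv) auto
    then have "(\<lambda>n. of_real (real n * r n * (1 - s) ^ n)) sums R (of_real s)"
      unfolding nth R_def by simp
    then have "(\<lambda>n. Re (of_real (real n * r n * (1 - s) ^ n))) sums Re (R (of_real s))"
      by (rule sums_Re)
    then have "(\<lambda>n. real n * r n * (1 - s) ^ n) sums Re (R (of_real s))" by (simp only: Re_complex_of_real)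
    then have "(\<Sum>n<N. real n * r n * (1 - s) ^ n) \<le> Re (R (of_real s))"
      using that r(2) sum_le_suminf[of "\<lambda>n. real n * r n * (1 - s) ^ n" "{..<N}"] by (auto simp: sums_iff)
    then show ?thesis using complex_Re_le_cmod order.trans by blast
  qed
  have bound: "(\<Sum>n<N. real n * r n) \<le> M" for N
  proof (rule tendsto_upperbound)
    have "((\<lambda>s::real. \<Sum>n<N. real n * r n * (1 - s) ^ n) \<longlongrightarrow> (\<Sum>n<N. real n * r n * (1 - 0) ^ n)) (at_right 0)"
      by (intro tendsto_intros)
    then show "((\<lambda>s::real. \<Sum>n<N. real n * r n * (1 - s) ^ n) \<longlongrightarrow> (\<Sum>n<N. real n * r n)) (at_right 0)"
      by simp
    have "eventually (\<lambda>s::real. 0 < s \<and> s < 1) (at_right 0)"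
      by (rule eventually_at_rightI[of 0 1]) auto
    with assms[folded R_def] show "eventually (\<lambda>s. (\<Sum>n<N. real n * r n * (1 - s) ^ n) \<le> M) (at_right 0)"
      by eventually_elim (use partial order.trans in blast)
  qed (simp add: trivial_limit_at_right_real)
  have "summable (\<lambda>n. real n * r n)"
    by (rule summableI_nonneg_bounded[where x = M]) (use r(2) bound in auto)
  then have "summable (\<lambda>n. 625/24 * (real n * r n))" by (rule summable_mult)
  then have "summable (\<lambda>n. inverse (real n))"
  proof (rule summable_comparison_test'[where N = 1])
    fix n :: nat assume "1 \<le> n"
    then have n: "0 < real n" by simp
    have "24/625 \<le> real n * (real n * r n)"
      using r(3)[of n] \<open>1 \<le> n\<close> by (simp add: power2_eq_square mult.assoc)
    then show "norm (inverse (real n)) \<le> 625/24 * (real n * r n)"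
      using n by (simp add: field_simps)
  qed
  then show False using not_summable_harmonic[where ?'a = real] by (simp add: inverse_eq_divide)
qed

text \<open>Otherwise the holomorphic solution would have no logarithmic component at 1, and its
  \<theta>-derivative would stay bounded there. Up to sign the pairing is the fourth coordinate of
  the vanishing cycle, so this gives cyclicity under J.\<close>

lemma symp_vcyc_e1: "symp (coni_vec vcyc) (vec4 1 0 0 0) \<noteq> 0"
proof
  assume z: "symp (coni_vec vcyc) (vec4 1 0 0 0) = 0"
  obtain x where x: "connection x = vec4 1 0 0 0" using connection_surj by blast
  have "x $ 4 * symp (coni_vec vcyc) log_vec = 0" using z by (simp flip: x add: symp_vcyc_connection)
  then have x4: "x $ 4 = 0" using symp_vcyc_log_vec by simp
  have "log_exp l (vec4 1 0 0 0) = vec4 1 0 0 0" for l by (simp add: log_exp_def vec4_eq_iff)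
  then have f: "frob_sol z l (vec4 1 0 0 0) $ 2 = eval_fps (frob_fps 1 0) z" for z l
    by (simp add: frob_sol_def frob_row_def)
  define R where "R s = x $ 1 * coni_sol (1, 0, 0) s $ 2 + x $ 2 * coni_sol (0, 0, 1) s $ 2 + x $ 3 * coni_sol vcyc s $ 2" for s
  have eq: "eval_fps (frob_fps 1 0) (1 - s) = R s" if "s \<in> lens" for s
    using arg_cong[OF coni_basis_eq[OF lens_one_minus[OF that], of x], of "\<lambda>v. v $ 2"] f[of "1 - s" "Ln (1 - s)"] x4
    by (simp add: x coni_basis_def R_def)
  have "isCont R 0" unfolding R_def by (intro isCont_add isCont_mult isCont_coni_sol_0 continuous_const)
  then have "isCont R (of_real 0)" by simp
  moreover have "(of_real \<longlongrightarrow> complex_of_real 0) (at_right 0)"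
    by (rule tendsto_of_real) (rule tendsto_ident_at)
  ultimately have "((\<lambda>s::real. R (of_real s)) \<longlongrightarrow> R (of_real 0)) (at_right 0)"
    by (rule isCont_tendsto_compose)
  then have "((\<lambda>s::real. norm (R (of_real s))) \<longlongrightarrow> norm (R (of_real 0))) (at_right 0)" by (rule tendsto_norm)
  then have ev: "eventually (\<lambda>s::real. norm (R (of_real s)) < norm (R (of_real 0)) + 1) (at_right 0)"
    by (rule order_tendstoD) simp
  have "eventually (\<lambda>s::real. complex_of_real s \<in> lens) (at_right 0)"
    by (rule eventually_at_rightI[of 0 1]) (auto intro: of_real_in_lens)
  with ev have "eventually (\<lambda>s::real. norm (eval_fps (frob_fps 1 0) (1 - of_real s)) \<le> norm (R (of_real 0)) + 1) (at_right 0)"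
    by eventually_elim (subst eq, simp_all)
  then show False by (rule frob_fps_1_0_unbounded)
qed

subsection \<open>Relations invariant under the unipotent monodromies\<close>

definition transv :: "complex ^ 4 \<Rightarrow> complex \<Rightarrow> complex ^ 4 \<Rightarrow> complex ^ 4" where
  "transv w k a = a + (k * symp w a) *s w"

lemma transv_linear:
  "transv w k (a + b) = transv w k a + transv w k b" "transv w k (c *s a) = c *s transv w k a"
  by (simp_all add: transv_def pf_form_linear vec_eq_iff algebra_simps)

lemma symp_transv [simp]: "symp (transv w k a) (transv w k b) = symp a b"
  using pf_form_commute[of 0 w a] by (simp add: transv_def pf_form_linear)

lemma transv_inverse [simp]: "transv w k (transv w (- k) a) = a" "transv w (- k) (transv w k a) = a"
  by (simp_all add: transv_def pf_form_linear vec_eq_iff algebra_simps)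

lemma transv_conj:
  assumes "\<And>a b. f (a + b) = f a + f b" "\<And>c a. f (c *s a) = c *s f a"
    and "\<And>a b. symp (f a) (f b) = symp a b"
  shows "transv (f w) m (f a) = f (transv w m a)"
  by (simp add: transv_def assms)

lemma log_exp_linear:
  "log_exp k (a + b) = log_exp k a + log_exp k b" "log_exp k (c *s a) = c *s log_exp k a"
  by (simp_all add: log_exp_def vec4_eq_iff algebra_simps)

lemma log_exp_inverse [simp]: "log_exp k (log_exp (- k) a) = a"
  by (simp add: log_exp_add[symmetric]) (simp add: log_exp_def vec4_eq_iff)

lemma symp_separates:
  assumes "a \<noteq> 0" obtains p where "symp p a \<noteq> 0"
  using pf_form_nondegenerate[of 0 a] assms by auto

lemma symp_separates2:
  assumes "a \<noteq> 0" "b \<noteq> 0" obtains p where "symp p a \<noteq> 0" "symp p b \<noteq> 0"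
proof -
  obtain p where p: "symp p a \<noteq> 0" using symp_separates[OF assms(1)] .
  obtain q where q: "symp q b \<noteq> 0" using symp_separates[OF assms(2)] .
  show thesis
  proof (cases "symp p b = 0 \<and> symp q a = 0")
    case True
    with p q show thesis by (intro that[of "p + q"]) (auto simp: pf_form_linear)
  qed (use p q that in blast)
qed

definition indep2 :: "complex ^ 4 \<Rightarrow> complex ^ 4 \<Rightarrow> bool" where
  "indep2 a b \<longleftrightarrow> a \<noteq> 0 \<and> (\<forall>k. b \<noteq> k *s a)"

lemma indep2_perp:
  assumes "indep2 a b" obtains p where "symp p a = 0" "symp p b \<noteq> 0"
proof -
  obtain q where q: "symp q a \<noteq> 0" using symp_separates assms unfolding indep2_def by blast
  define k where "k = symp q b / symp q a"
  have "b - k *s a \<noteq> 0" using assms by (auto simp: indep2_def)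
  then obtain p where p: "symp p (b - k *s a) \<noteq> 0" by (rule symp_separates)
  show thesis
  proof (rule that[of "p - (symp p a / symp q a) *s q"])
    show "symp (p - (symp p a / symp q a) *s q) a = 0" using q by (simp add: pf_form_linear)
    show "symp (p - (symp p a / symp q a) *s q) b \<noteq> 0"
      using p q by (simp add: pf_form_linear k_def field_simps)
  qed
qed

lemma indep2_perp2:
  assumes "indep2 a b" "indep2 a c" obtains p where "symp p a = 0" "symp p b \<noteq> 0" "symp p c \<noteq> 0"
proof -
  obtain p where p: "symp p a = 0" "symp p b \<noteq> 0" using indep2_perp[OF assms(1)] .
  obtain q where q: "symp q a = 0" "symp q c \<noteq> 0" using indep2_perp[OF assms(2)] .
  show thesis
  proof (cases "symp p c = 0 \<and> symp q b = 0")
    case True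
    with p q show thesis by (intro that[of "p + q"]) (auto simp: pf_form_linear)
  qed (use p q that in blast)
qed

text \<open>The pairing is a cubic in k. Its coefficients, read from the top, determine w_4, w_3,
  w_2, w_1 in turn, because v_4 is nonzero. This provides translates of \<open>v\<close> in general
  position.\<close>

lemma finite_symp_log_exp_zero:
  assumes "w \<noteq> 0" "v $ 4 \<noteq> 0" shows "finite {k. symp w (log_exp k v) = 0}"
proof -
  define p where "p = [: w $ 1 * v $ 4 - w $ 4 * v $ 1 - w $ 2 * v $ 3 + w $ 3 * v $ 2,
     w $ 3 * v $ 3 - w $ 4 * v $ 2 - w $ 2 * v $ 4, (w $ 3 * v $ 4 - w $ 4 * v $ 3) / 2, - (w $ 4 * v $ 4) / 6 :]"
  have "symp w (log_exp k v) = poly p k" for k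
    by (simp add: p_def pf_form_def log_exp_def algebra_simps power2_eq_square power3_eq_cube)
      (simp add: field_simps)
  moreover have "p \<noteq> 0"
  proof
    assume p: "p = 0"
    then have 4: "w $ 4 = 0" using assms(2) by (simp add: p_def)
    with p have 3: "w $ 3 = 0" using assms(2) by (simp add: p_def)
    with p 4 have 2: "w $ 2 = 0" using assms(2) by (simp add: p_def)
    with p 3 4 have 1: "w $ 1 = 0" using assms(2) by (simp add: p_def)
    show False using 1 2 3 4 assms(1) by (simp add: vec4_eq_iff)
  qed
  ultimately show ?thesis using poly_roots_finite by simp
qed

text \<open>\<open>R\<close> abstracts from the polynomial relation; what is kept is its invariance
  under the two one-parameter groups. A vector is cyclic for J exactly when its last coordinate is
  nonzero.\<close>

locale monodromy_invariant =
  fixes R :: "complex ^ 4 \<Rightarrow> complex ^ 4 \<Rightarrow> bool" and v :: "complex ^ 4"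
  assumes unipotent: "R a b \<Longrightarrow> R (log_exp k a) (log_exp k b)"
    and reflection: "R a b \<Longrightarrow> R (transv v k a) (transv v k b)"
    and cyclic: "v $ 4 \<noteq> 0"
begin

definition dirs :: "(complex ^ 4) set" where
  "dirs = {w. \<forall>a b k. R a b \<longrightarrow> R (transv w k a) (transv w k b)}"

lemma dirs_log_exp:
  assumes "w \<in> dirs" shows "log_exp k w \<in> dirs"
  unfolding dirs_def
proof (intro CollectI allI impI)
  fix a b m assume "R a b"
  then have "R (log_exp k (transv w m (log_exp (- k) a))) (log_exp k (transv w m (log_exp (- k) b)))"
    using assms unipotent unfolding dirs_def by blast
  moreover have "transv (log_exp k w) m a = log_exp k (transv w m (log_exp (- k) a))" for a
    using transv_conj[of "log_exp k" w m "log_exp (- k) a"] by (simp add: log_exp_linear)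
  ultimately show "R (transv (log_exp k w) m a) (transv (log_exp k w) m b)" by simp
qed

text \<open>A conjugate of a transvection along w by a symplectic map is the transvection along the
  image of w. The image here is w plus a multiple of w', so nonorthogonal directions can be
  added.\<close>

lemma dirs_transv:
  assumes "w \<in> dirs" "w' \<in> dirs" shows "transv w' k w \<in> dirs"
  unfolding dirs_def
proof (intro CollectI allI impI)
  fix a b m assume "R a b"
  then have "R (transv w' k (transv w m (transv w' (- k) a))) (transv w' k (transv w m (transv w' (- k) b)))"
    using assms unfolding dirs_def by blast
  moreover have "transv (transv w' k w) m a = transv w' k (transv w m (transv w' (- k) a))" for a
    using transv_conj[of "transv w' k" w m "transv w' (- k) a"] by (simp add: transv_linear)
  ultimately show "R (transv (transv w' k w) m a) (transv (transv w' k w) m b)" by simp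
qed

lemma dirs_scale:
  assumes "w \<in> dirs" shows "c *s w \<in> dirs"
proof -
  have "transv (c *s w) k a = transv w (c * c * k) a" for k a
    by (simp add: transv_def pf_form_linear vec_eq_iff algebra_simps)
  then show ?thesis using assms unfolding dirs_def by simp
qed

lemma dirs_add_nonorthogonal:
  assumes "w \<in> dirs" "w' \<in> dirs" "symp w' w \<noteq> 0" shows "w + c *s w' \<in> dirs"
  using dirs_transv[OF assms(1,2), of "c / symp w' w"] assms(3) by (simp add: transv_def)

text \<open>If the summands may be orthogonal, a detour through a direction \<open>u\<close> in
  general position helps: w, w + t u, w + w' + t u, w + w'. Each step adds a multiple of a
  nonorthogonal direction.\<close>

lemma dirs_add:
  assumes w: "w \<in> dirs" and w': "w' \<in> dirs" shows "w + w' \<in> dirs"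
proof (cases "w = 0 \<or> w' = 0 \<or> w + w' = 0")
  case True
  then show ?thesis using w w' dirs_scale[OF w, of 0] by auto
next
  case False
  have fin: "finite ({k. symp w (log_exp k v) = 0} \<union> {k. symp w' (log_exp k v) = 0} \<union> {k. symp (w + w') (log_exp k v) = 0})"
    using False cyclic by (intro finite_UnI finite_symp_log_exp_zero) auto
  obtain k where "k \<notin> {k. symp w (log_exp k v) = 0} \<union> {k. symp w' (log_exp k v) = 0}
      \<union> {k. symp (w + w') (log_exp k v) = 0}"
    using ex_new_if_finite[OF infinite_UNIV_char_0 fin] by (rule exE)
  moreover define u where "u = log_exp k v"
  ultimately have nz: "symp w u \<noteq> 0" "symp w' u \<noteq> 0" "symp (w + w') u \<noteq> 0" by auto
  have "v \<in> dirs" using reflection by (simp add: dirs_def)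
  then have u: "u \<in> dirs" unfolding u_def by (rule dirs_log_exp)
  \<comment> \<open>The pairing is affine in \<open>t\<close> with slope \<open>symp w' u\<close>,
    which is nonzero, so it cannot vanish at both 1 and 2.\<close>
  obtain t where t: "symp w' (w + t *s u) \<noteq> 0"
  proof (cases "symp w' (w + 1 *s u) = 0")
    case True
    then have "symp w' (w + 2 *s u) = symp w' u"
      by (simp add: pf_form_linear add.commute)
    with nz(2) show thesis by (intro that[of 2]) simp
  qed (use that in blast)
  have "w + t *s u \<in> dirs"
    using nz(1) pf_form_commute[of 0 w u] by (intro dirs_add_nonorthogonal w u) simp
  from dirs_add_nonorthogonal[OF this w' t, of 1]
  have 1: "(w + w') + t *s u \<in> dirs" by (simp add: add_ac)
  have "symp u ((w + w') + t *s u) = symp u (w + w')" by (simp add: pf_form_linear)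
  also have "\<dots> = - symp (w + w') u" by (rule pf_form_commute)
  finally have "symp u ((w + w') + t *s u) \<noteq> 0" using nz(3) by simp
  from dirs_add_nonorthogonal[OF 1 u this, of "- t"] show ?thesis by simp
qed

text \<open>Since J^4 = 0, combinations of exp(k J) v for k = -1, 0, 1, 2 give J v, J^2 v and J^3 v
  exactly: these are \<open>v1\<close>, \<open>v2\<close>, \<open>v3\<close>. With \<open>v\<close>
  they form a triangular system with diagonal entries v_4.\<close>

lemma dirs_UNIV: "a \<in> dirs"
proof -
  have v: "v \<in> dirs" using reflection by (simp add: dirs_def)
  note [intro] = dirs_add dirs_scale
  define v1 where "v1 = vec4 (v $ 2) (v $ 3) (v $ 4) 0"
  define v2 where "v2 = vec4 (v $ 3) (v $ 4) 0 0"
  define v3 where "v3 = vec4 (v $ 4) 0 0 0"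
  note le = dirs_log_exp[OF v]
  have "log_exp 1 v + (log_exp (-1) v + (-2) *s v) \<in> dirs" using le v by blast
  also have "log_exp 1 v + (log_exp (-1) v + (-2) *s v) = v2"
    by (simp add: log_exp_def v2_def vec4_eq_iff)
  finally have v2: "v2 \<in> dirs" .
  have "log_exp 2 v + ((-1) *s v + ((-2) *s v2 + ((-1) *s log_exp 1 v + log_exp (-1) v))) \<in> dirs"
    using le v v2 by blast
  also have "log_exp 2 v + ((-1) *s v + ((-2) *s v2 + ((-1) *s log_exp 1 v + log_exp (-1) v))) = v3"
    by (simp add: log_exp_def v2_def v3_def vec4_eq_iff)
  finally have v3: "v3 \<in> dirs" .
  have "log_exp 1 v + ((-1) *s v + ((-1/2) *s v2 + (-1/6) *s v3)) \<in> dirs"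
    using le v v2 v3 by blast
  also have "log_exp 1 v + ((-1) *s v + ((-1/2) *s v2 + (-1/6) *s v3)) = v1"
    by (simp add: log_exp_def v1_def v2_def v3_def vec4_eq_iff)
  finally have v1: "v1 \<in> dirs" .
  define d where "d = a $ 4 / v $ 4"
  define c where "c = (a $ 3 - d * v $ 3) / v $ 4"
  define b where "b = (a $ 2 - d * v $ 2 - c * v $ 3) / v $ 4"
  define e where "e = (a $ 1 - d * v $ 1 - c * v $ 2 - b * v $ 3) / v $ 4"
  have "d *s v + (c *s v1 + (b *s v2 + e *s v3)) \<in> dirs" using v v1 v2 v3 by blast
  also have "d *s v + (c *s v1 + (b *s v2 + e *s v3)) = a"
    using cyclic by (simp add: v1_def v2_def v3_def vec4_eq_iff e_def b_def c_def d_def)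
  finally show ?thesis .
qed

lemma R_transv: "R a b \<Longrightarrow> R (transv w k a) (transv w k b)"
  using dirs_UNIV[of w] by (simp add: dirs_def)

definition isotropic_R :: "complex ^ 4 \<Rightarrow> complex ^ 4 \<Rightarrow> bool" where
  "isotropic_R a b \<longleftrightarrow> R a b \<and> symp a b = 0 \<and> indep2 a b"

lemma isotropic_R_transv:
  assumes "isotropic_R a b" shows "isotropic_R (transv w k a) (transv w k b)"
proof -
  have "transv w k a \<noteq> 0"
  proof
    assume "transv w k a = 0"
    then have "transv w (- k) (transv w k a) = 0" by (simp add: transv_def pf_form_def)
    with assms show False by (simp add: isotropic_R_def indep2_def)
  qed
  moreover have "transv w k b \<noteq> c *s transv w k a" for c
  proof
    assume "transv w k b = c *s transv w k a"
    then have "transv w (- k) (transv w k b) = c *s transv w (- k) (transv w k a)"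
      by (simp add: transv_linear)
    with assms show False by (simp add: isotropic_R_def indep2_def)
  qed
  ultimately show ?thesis using assms R_transv by (simp add: isotropic_R_def indep2_def)
qed

lemma isotropic_R_fst:
  assumes "isotropic_R a b" "symp a' a \<noteq> 0" obtains b' where "isotropic_R a' b'"
proof -
  have "transv (a' - a) (1 / symp a' a) a = a'"
    using assms(2) by (simp add: transv_def pf_form_linear)
  with isotropic_R_transv[OF assms(1), of "a' - a" "1 / symp a' a"] that show thesis by metis
qed

text \<open>The transvection along b' - b that moves b to b' fixes a, because a is orthogonal to
  both.\<close>

lemma isotropic_R_snd:
  assumes "isotropic_R a b" "symp b' b \<noteq> 0" "symp b' a = 0" shows "isotropic_R a b'"
proof -
  have "symp b a = 0" using assms(1) pf_form_commute[of 0 b a] by (simp add: isotropic_R_def)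
  then have "transv (b' - b) (1 / symp b' b) a = a"
    using assms(3) by (simp add: transv_def pf_form_linear)
  moreover have "transv (b' - b) (1 / symp b' b) b = b'"
    using assms(2) by (simp add: transv_def pf_form_linear)
  ultimately show ?thesis using isotropic_R_transv[OF assms(1), of "b' - b" "1 / symp b' b"] by simp
qed

text \<open>A form of Witt's theorem. A single transvection links only nonorthogonal vectors, so the
  first vector travels through \<open>m\<close> and the second through \<open>p\<close>;
  \<open>p\<close> is orthogonal to a, which keeps the first vector in place.\<close>

theorem R_isotropic:
  assumes "R a0 b0" "symp a0 b0 = 0" "indep2 a0 b0" "symp a b = 0" "indep2 a b"
  shows "R a b"
proof -
  have 0: "isotropic_R a0 b0" using assms by (simp add: isotropic_R_def)
  have "a0 \<noteq> 0" "a \<noteq> 0" using assms by (auto simp: indep2_def)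
  then obtain m where m: "symp m a0 \<noteq> 0" "symp m a \<noteq> 0" by (rule symp_separates2)
  obtain b1 where "isotropic_R m b1" using isotropic_R_fst[OF 0 m(1)] .
  moreover have "symp a m \<noteq> 0" using m(2) pf_form_commute[of 0 a m] by simp
  ultimately obtain b2 where b2: "isotropic_R a b2" by (rule isotropic_R_fst)
  then have "indep2 a b2" by (simp add: isotropic_R_def)
  then obtain p where p: "symp p a = 0" "symp p b2 \<noteq> 0" "symp p b \<noteq> 0" using assms(5) by (rule indep2_perp2)
  have "isotropic_R a p" by (rule isotropic_R_snd[OF b2 p(2,1)])
  then have "isotropic_R a b"
    by (rule isotropic_R_snd) (use p(3) assms(4) pf_form_commute[of 0 b p] pf_form_commute[of 0 b a] in auto)
  then show ?thesis by (simp add: isotropic_R_def)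
qed

end

subsection \<open>The seven functions in terms of solutions\<close>

text \<open>
  The values of \<open>t\<^sub>0, \<dots>, t\<^sub>6\<close> in terms of \<open>z = t\<^sub>4 / t\<^sub>0\<^sup>5\<close>, the solution \<open>y = 5 t\<^sub>0\<close> of the Picard-Fuchs
  equation with its derivatives \<open>Y\<close>, and \<open>W = y \<theta>y' - y' \<theta>y\<close>, \<open>W1 = \<theta> W\<close> for a second solution \<open>y'\<close>.
\<close>

definition t_values :: "'a::field_char_0 \<Rightarrow> 'a \<Rightarrow> 'a \<Rightarrow> 'a \<Rightarrow> 'a \<Rightarrow> 'a \<Rightarrow> 'a \<Rightarrow> 'a \<Rightarrow> nat \<Rightarrow> 'a" where
  "t_values c z y y1 y2 y3 W W1 i =
     (if i = 0 then y / 5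
      else if i = 1 then y * (3125 * (z - 1) * y3 + (3750 * z - 625) * y2 + (1375 * z - 125) * y1 + (150 * z - 25) * y)
      else if i = 2 then y ^ 2 * (125 * (z - 1) * y2 + 75 * (z - 1) * y1 + (10 * z - 35) * y)
      else if i = 3 then y ^ 3 * (5 * (z - 1) * y1 + (z - 6) * y)
      else if i = 4 then z * y ^ 5 / 3125
      else if i = 5 then c * (z - 1) * y ^ 2 * W
      else c * y ^ 5 * (z - 1) / 625 * ((z - 1) * y * W1 + (2 * (z - 1) * y1 + z * y) * W))"

definition sol_values :: "complex \<Rightarrow> complex \<Rightarrow> complex ^ 4 \<Rightarrow> complex ^ 4 \<Rightarrow> nat \<Rightarrow> complex" where
  "sol_values c z Y Z = t_values c z (Y $ 1) (Y $ 2) (Y $ 3) (Y $ 4)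
     (Y $ 1 * Z $ 2 - Y $ 2 * Z $ 1) (Y $ 1 * Z $ 3 - Y $ 3 * Z $ 1)"

lemma logpoly_sol_values:
  assumes "logpoly z" "\<And>i. logpoly (\<lambda>x l. Y x l $ i)" "\<And>i. logpoly (\<lambda>x l. Z x l $ i)"
  shows "logpoly (\<lambda>x l. sol_values c (z x l) (Y x l) (Z x l) i)"
proof -
  have if_intro: "logpoly (\<lambda>x l. if P then g x l else h x l)" if "logpoly g" "logpoly h" for P g h
    using that by (cases P) simp_all
  show ?thesis
    unfolding sol_values_def t_values_def divide_inverse
    by (intro if_intro logpoly_mult logpoly_add logpoly_diff logpoly_power logpoly_const assms)
qed

definition relation :: "((nat \<Rightarrow>\<^sub>0 nat) \<Rightarrow>\<^sub>0 complex) \<Rightarrow> complex \<Rightarrow> complex ^ 4 \<Rightarrow> complex ^ 4 \<Rightarrow> bool" where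
  "relation P c a b \<longleftrightarrow> (\<forall>z\<in>lens. meval P (sol_values c z (frob_sol z (Ln z) a) (frob_sol z (Ln z) b)) = 0)"

text \<open>For fixed coordinates the relation is a \<open>logpoly\<close> that vanishes at Ln z,
  hence vanishes for every \<open>l\<close>, in particular for Ln z + k.\<close>

lemma relation_unipotent:
  assumes "relation P c a b" shows "relation P c (log_exp k a) (log_exp k b)"
proof -
  have "meval P (sol_values c z (frob_sol z l a) (frob_sol z l b)) = 0" if "z \<in> lens" for z l
    by (rule logpoly_eq_0[OF logpoly_meval[OF logpoly_sol_values[OF logpoly_var logpoly_frob_sol logpoly_frob_sol]] _ that])
      (use assms in \<open>simp add: relation_def\<close>)
  then show ?thesis unfolding relation_def frob_sol_log_exp[symmetric] by blast
qed

lemma relation_connection: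
  assumes "relation P c (connection x) (connection y)"
  shows "relation P c (connection (x - (k * x $ 4) *s vec4 0 0 1 0)) (connection (y - (k * y $ 4) *s vec4 0 0 1 0))"
proof -
  have "meval P (sol_values c (1 - s) (coni_basis s l x) (coni_basis s l y)) = 0" if "s \<in> lens" for s l
  proof (rule logpoly_eq_0[OF logpoly_meval[OF logpoly_sol_values[OF _ logpoly_coni_basis logpoly_coni_basis]] _ that])
    show "logpoly (\<lambda>s l. 1 - s)" by (intro logpoly_diff logpoly_const logpoly_var)
    fix s assume s: "s \<in> lens"
    from coni_basis_eq[OF lens_one_minus[OF s]] assms lens_one_minus[OF s]
    show "meval P (sol_values c (1 - s) (coni_basis s (Ln s) x) (coni_basis s (Ln s) y)) = 0"
      unfolding relation_def by simp
  qed
  note zero = this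
  show ?thesis unfolding relation_def
  proof
    fix z assume z: "z \<in> lens"
    have "1 - (1 - z) = z" by simp
    with zero[OF lens_one_minus[OF z], of "Ln (1 - z) + k"]
    show "meval P (sol_values c z (frob_sol z (Ln z) (connection (x - (k * x $ 4) *s vec4 0 0 1 0)))
        (frob_sol z (Ln z) (connection (y - (k * y $ 4) *s vec4 0 0 1 0)))) = 0"
      unfolding coni_basis_add coni_basis_eq[OF z] by simp
  qed
qed

lemma relation_reflection:
  assumes "relation P c a b"
  shows "relation P c (transv (coni_vec vcyc) k a) (transv (coni_vec vcyc) k b)"
proof -
  obtain x where x: "connection x = a" using connection_surj by blast
  obtain y where y: "connection y = b" using connection_surj by blast
  \<comment> \<open>The constant of the logarithmic shift is scaled so that the transvection gets
    the factor \<open>k\<close>.\<close>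
  have "connection (x - (- (k * symp (coni_vec vcyc) log_vec) * x $ 4) *s vec4 0 0 1 0)
      = transv (coni_vec vcyc) k (connection x)" for x
    unfolding transv_def symp_vcyc_connection connection_linear coni_vec_vcyc[symmetric]
    by (simp add: vec_eq_iff algebra_simps)
  then show ?thesis
    using relation_connection[of P c x y "- (k * symp (coni_vec vcyc) log_vec)"] assms by (simp add: x y)
qed

lemma relation_isotropic:
  assumes "relation P c (vec4 1 0 0 0) (vec4 0 1 0 0)" "symp a b = 0" "indep2 a b"
  shows "relation P c a b"
proof -
  interpret monodromy_invariant "relation P c" "coni_vec vcyc"
  proof
    show "coni_vec vcyc $ 4 \<noteq> 0"
      using symp_vcyc_e1 by (simp add: pf_form_def)
  qed (fact relation_unipotent relation_reflection)+
  show ?thesis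
    by (rule R_isotropic[OF assms(1) _ _ assms(2,3)]) (auto simp: pf_form_def indep2_def vec4_eq_iff)
qed

text \<open>The values see the second solution only through \<open>W\<close> and \<open>W1\<close>.
  So its first entry can be 0 and its last entry \<open>q\<close> is free to make the pair
  isotropic, while \<open>W\<close> being nonzero makes the pair independent.\<close>

lemma meval_eq_0_if_relation:
  assumes rel: "relation P c (vec4 1 0 0 0) (vec4 0 1 0 0)" and "c \<noteq> 0" and "z \<in> lens"
    and y: "y \<noteq> 0" and W: "W \<noteq> 0"
  shows "meval P (t_values c z y y1 y2 y3 W W1) = 0"
proof -
  have z: "1 - z \<noteq> 0" using assms by auto
  define Y where "Y = vec4 y y1 y2 y3"
  define w where "w = W / y"
  define w1 where "w1 = W1 / y"
  define q where "q = ((1 - z) * (y1 * w1 - y2 * w) + z * W1 + 2/5 * z * W) / ((1 - z) * y)"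
  define Z where "Z = vec4 0 w w1 q"
  have yw: "y * w = W" "y * w1 = W1" using y by (simp_all add: w_def w1_def)
  have q: "(1 - z) * (y * q) = (1 - z) * (y1 * w1 - y2 * w) + z * W1 + 2/5 * z * W"
    using z y by (simp add: q_def)
  have "pf_form z Y Z = (1 - z) * (y * q) - (1 - z) * (y1 * w1 - y2 * w) - z * (y * w1) - 2/5 * z * (y * w)"
    by (simp add: pf_form_def Y_def Z_def algebra_simps)
  then have "pf_form z Y Z = 0" unfolding q yw by simp
  obtain a where a: "frob_sol z (Ln z) a = Y" using frob_sol_surj[OF assms(3)] by blast
  obtain b where b: "frob_sol z (Ln z) b = Z" using frob_sol_surj[OF assms(3)] by blast
  have "symp a b = 0"
    using \<open>pf_form z Y Z = 0\<close> pf_form_frob_sol[OF assms(3), of "Ln z" a b] by (simp add: a b)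
  moreover have "indep2 a b"
    unfolding indep2_def
  proof (intro conjI allI notI)
    assume "a = 0"
    then have "Y = 0" using frob_sol_linear(2)[of z "Ln z" 0 0] by (simp flip: a)
    then show False using y by (simp add: Y_def vec4_eq_iff)
  next
    fix k assume "b = k *s a"
    then have "Z = k *s Y" by (simp add: frob_sol_linear flip: a b)
    then show False using y W by (auto simp: Y_def Z_def w_def vec4_eq_iff)
  qed
  ultimately have "relation P c a b" by (rule relation_isotropic[OF rel])
  then have "meval P (sol_values c z Y Z) = 0" using assms(3) by (auto simp: relation_def a b)
  moreover have "sol_values c z Y Z = t_values c z y y1 y2 y3 W W1"
    by (simp add: sol_values_def Y_def Z_def yw)
  ultimately show ?thesis by simp
qed

lemma poly_eq_0_if_relation:
  assumes rel: "relation P c (vec4 1 0 0 0) (vec4 0 1 0 0)" and "c \<noteq> 0" and P: "poly_indets P \<subseteq> {0..6}"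
  shows "P = 0"
proof -
  \<comment> \<open>The two intervals force z = x_4 / x_0^5 into the real interval (0, 1), which
    lies in the lens. A nonzero x_5 gives a nonzero \<open>W\<close>.\<close>
  define A where "A i = (if i = 0 then complex_of_real ` {1<..<11/10} else if i = 4 then complex_of_real ` {1/10<..<1/2}
      else - {0})" for i :: nat
  have "infinite (complex_of_real ` {a<..<b})" if "a < b" for a b
    using that by (simp add: finite_image_iff inj_on_def infinite_Ioo)
  moreover have "infinite (- {0 :: complex})"
    unfolding Compl_eq_Diff_UNIV by (rule infinite_remove) (rule infinite_UNIV_char_0)
  ultimately have inf: "infinite (A i)" for i by (simp add: A_def)
  show ?thesis
  proof (rule meval_eq_0_imp_eq_0[OF _ P inf])
    fix x assume x: "\<And>i. i \<in> {0..6} \<Longrightarrow> x i \<in> A i"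
    obtain r where r: "x 0 = of_real r" "1 < r" "r < 11/10" using x[of 0] by (auto simp: A_def)
    obtain s where s: "x 4 = of_real s" "1/10 < s" "s < 1/2" using x[of 4] by (auto simp: A_def)
    have x5: "x 5 \<noteq> 0" using x[of 5] by (simp add: A_def)
    define z where "z = x 4 / x 0 ^ 5"
    have r5: "1 \<le> r ^ 5" using r by simp
    have "0 < s / r ^ 5" using r s by (intro divide_pos_pos zero_less_power) auto
    moreover have "s / r ^ 5 < 1" using r5 s by (subst pos_divide_less_eq) linarith+
    ultimately have zl: "z \<in> lens" using of_real_in_lens[of "s / r ^ 5"] by (simp add: z_def r s)
    then have z1: "z - 1 \<noteq> 0" by auto
    define y where "y = 5 * x 0"
    have y: "y \<noteq> 0" using r by (simp add: y_def)
    \<comment> \<open>\<open>t_values\<close> is triangular: x_3, x_2, x_1 give the derivatives of y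
      in turn, then x_5 and x_6 give \<open>W\<close> and \<open>W1\<close>.\<close>
    define y1 where "y1 = (x 3 / y ^ 3 - (z - 6) * y) / (5 * (z - 1))"
    define y2 where "y2 = (x 2 / y ^ 2 - 75 * (z - 1) * y1 - (10 * z - 35) * y) / (125 * (z - 1))"
    define y3 where "y3 = (x 1 / y - (3750 * z - 625) * y2 - (1375 * z - 125) * y1 - (150 * z - 25) * y) / (3125 * (z - 1))"
    define W where "W = x 5 / (c * (z - 1) * y ^ 2)"
    define W1 where "W1 = (x 6 / (c * y ^ 5 * (z - 1) / 625) - (2 * (z - 1) * y1 + z * y) * W) / ((z - 1) * y)"
    have W: "W \<noteq> 0" using x5 z1 y \<open>c \<noteq> 0\<close> by (simp add: W_def)
    let ?t = "t_values c z y y1 y2 y3 W W1"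
    have e3: "5 * (z - 1) * y1 + (z - 6) * y = x 3 / y ^ 3"
      and e2: "125 * (z - 1) * y2 + 75 * (z - 1) * y1 + (10 * z - 35) * y = x 2 / y ^ 2"
      and e1: "3125 * (z - 1) * y3 + (3750 * z - 625) * y2 + (1375 * z - 125) * y1 + (150 * z - 25) * y = x 1 / y"
      and e5: "c * (z - 1) * y ^ 2 * W = x 5"
      and e6: "(z - 1) * y * W1 + (2 * (z - 1) * y1 + z * y) * W = x 6 / (c * y ^ 5 * (z - 1) / 625)"
      using z1 y \<open>c \<noteq> 0\<close> by (simp_all add: y1_def y2_def y3_def W_def W1_def)
    have e4: "z * y ^ 5 / 3125 = x 4" using y by (simp add: z_def y_def power_mult_distrib)
    have t: "?t i = x i" if "i \<in> {0..6}" for i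
    proof -
      consider "i = 0" | "i = 1" | "i = 2" | "i = 3" | "i = 4" | "i = 5" | "i = 6"
        using \<open>i \<in> {0..6}\<close> by fastforce
      then show ?thesis
        unfolding t_values_def e1 e2 e3 e4 e5 e6 using y z1 \<open>c \<noteq> 0\<close> by cases (simp_all add: y_def)
    qed
    have "meval P x = meval P ?t"
      unfolding meval_def
    proof (intro sum.cong refl arg_cong2[where f = "(*)"] prod.cong)
      fix m i assume "m \<in> Poly_Mapping.keys P" "i \<in> Poly_Mapping.keys m"
      then have "i \<in> {0..6}" using P by (auto simp: poly_indets_def)
      then show "x i ^ Poly_Mapping.lookup m i = ?t i ^ Poly_Mapping.lookup m i" by (simp add: t)
    qed
    then show "meval P x = 0"
      using meval_eq_0_if_relation[OF rel \<open>c \<noteq> 0\<close> zl y W] by simp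
  qed simp
qed

subsection \<open>The Picard-Fuchs equation from the differential system\<close>

locale derivation =
  fixes D :: "'a::idom \<Rightarrow> 'a"
  assumes add: "D (x + y) = D x + D y"
    and mult: "D (x * y) = D x * y + x * D y"
begin

lemma zero [simp]: "D 0 = 0"
  using add[of 0 0] by (metis add_0_right add_left_cancel)

lemma one [simp]: "D 1 = 0"
  using mult[of 1 1] by (metis mult_1 mult_1_right add_0_right add_left_cancel)

lemma minus: "D (- x) = - D x"
  using add[of x "- x"] by (simp add: eq_neg_iff_add_eq_0 add.commute)

lemma diff: "D (x - y) = D x - D y"
  using add[of x "- y"] by (simp add: minus)

lemma of_nat [simp]: "D (of_nat n) = 0"
  by (induction n) (simp_all add: add)

lemma numeral [simp]: "D (numeral n) = 0"
  using of_nat[of "numeral n"] by simp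

lemma power_Suc: "D (x ^ Suc n) = of_nat (Suc n) * x ^ n * D x"
  by (induction n) (simp_all add: mult algebra_simps)

lemma power_numerals:
  "D (x ^ 2) = 2 * x * D x" "D (x ^ 3) = 3 * x ^ 2 * D x" "D (x ^ 4) = 4 * x ^ 3 * D x" "D (x ^ 5) = 5 * x ^ 4 * D x"
  using power_Suc[of x 1] power_Suc[of x 2] power_Suc[of x 3] power_Suc[of x 4]
  by (simp_all add: eval_nat_numeral)

lemmas rules = add mult diff power_numerals

end

text \<open>
  The system rewritten for the multiple \<open>D = t\<^sub>0 t\<^sub>5 / (t\<^sub>4 - t\<^sub>0\<^sup>5)\<close> of its derivation, with denominators
  cleared and \<open>a = t\<^sub>0\<close>, \<open>t\<^sub>4 = z a\<^sup>5\<close>; the factor is chosen so that \<open>D z = z\<close>.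
\<close>

locale dwork_derivation = derivation D for D :: "'a::idom \<Rightarrow> 'a" +
  fixes a t1 t2 t3 t5 t6 z W :: 'a
  assumes numeral_nonzero [simp]: "(numeral k :: 'a) \<noteq> 0" and a: "a \<noteq> 0" and z: "z \<noteq> 1"
    and E0: "3125 * a ^ 5 * (z - 1) * D a = a * (3750 * a ^ 5 + a * t3 - 625 * z * a ^ 5)"
    and E1: "3125 * a ^ 5 * (z - 1) * D t1 =
       a * (3125 * (- 125 * a ^ 6 + a ^ 4 * t1 + 125 * z * a ^ 6) + t1 * t3)"
    and E2: "3125 * a ^ 5 * (z - 1) * D t2 =
       a * (3125 * (- 1875 * a ^ 7 + 2 * a ^ 4 * t2 + 1875 * z * a ^ 7) - 625 * a ^ 5 * t1 + 625 * z * a ^ 5 * t1 + 2 * t2 * t3)"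
    and E3: "3125 * a ^ 5 * (z - 1) * D t3 =
       a * (3125 * (- 3125 * a ^ 8 + 3 * a ^ 4 * t3 + 3125 * z * a ^ 8) - 625 * a ^ 5 * t2 + 625 * z * a ^ 5 * t2 + 3 * t3 ^ 2)"
    and E4: "3125 * a ^ 5 * (z - 1) * D (z * a ^ 5) = a * (15625 * z * a ^ 9 + 5 * z * a ^ 5 * t3)"
    and E5: "a ^ 5 * (z - 1) * D t5 = a * t6"
    and E6: "1953125 * a ^ 5 * (z - 1) * D t6 = a * (t5 * (- 28125000 * a ^ 8 - 15000 * a ^ 4 * t3
        - 1171875 * z * a ^ 8 - 2 * t3 ^ 2) + t6 * (23437500 * a ^ 4 + 6250 * t3))"
    and W: "t5 = 25 * (z - 1) * a ^ 2 * W"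
begin

abbreviation "b1 \<equiv> D a"
abbreviation "b2 \<equiv> D b1"
abbreviation "b3 \<equiv> D b2"

lemma z1: "z - 1 \<noteq> 0"
  using z by simp

text \<open>\<open>E0\<close> is linear in \<open>t3\<close>. In the same way \<open>E3\<close>
  yields \<open>t2\<close> and \<open>E2\<close> yields \<open>t1\<close>; after these eliminations
  \<open>E1\<close> becomes the Picard-Fuchs equation.\<close>

lemma t3_eq: "t3 = 625 * a ^ 3 * (5 * (z - 1) * b1 + (z - 6) * a)"
proof -
  have "a ^ 2 * t3 = a ^ 2 * (625 * a ^ 3 * (5 * (z - 1) * b1 + (z - 6) * a))"
    using E0 by algebra
  then show ?thesis using a by simp
qed

lemma D_z: "D z = z"
proof -
  have "3125 * a ^ 10 * (z - 1) * D z = 3125 * a ^ 10 * (z - 1) * z"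
    using E4 unfolding rules t3_eq by algebra
  then show ?thesis using a z1 by simp
qed

lemma t2_eq: "t2 = 625 * a ^ 2 * (25 * (z - 1) * b2 + 15 * (z - 1) * b1 + (2 * z - 7) * a)"
proof -
  have d: "D t3 = 625 * (3 * a ^ 2 * b1 * (5 * (z - 1) * b1 + (z - 6) * a) + a ^ 3 * (5 * z * b1 + 5 * (z - 1) * b2 + z * a + (z - 6) * b1))"
    unfolding t3_eq rules numeral one D_z by algebra
  have "625 * a ^ 6 * (z - 1) * (t2 - 625 * a ^ 2 * (25 * (z - 1) * b2 + 15 * (z - 1) * b1 + (2 * z - 7) * a)) = a * (3125 * (- 3125 * a ^ 8 + 3 * a ^ 4 * t3 + 3125 * z * a ^ 8) - 625 * a ^ 5 * t2 + 625 * z * a ^ 5 * t2 + 3 * t3 ^ 2) - 3125 * a ^ 5 * (z - 1) * (625 * (3 * a ^ 2 * b1 * (5 * (z - 1) * b1 + (z - 6) * a) + a ^ 3 * (5 * z * b1 + 5 * (z - 1) * b2 + z * a + (z - 6) * b1)))"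
    unfolding t3_eq by algebra
  then have "625 * a ^ 6 * (z - 1) * (t2 - 625 * a ^ 2 * (25 * (z - 1) * b2 + 15 * (z - 1) * b1 + (2 * z - 7) * a)) = 0"
    using E3 unfolding d by simp
  then show ?thesis using a z1 by simp
qed

lemma t1_eq: "t1 = 625 * a * (125 * (z - 1) * b3 + (150 * z - 25) * b2 + (55 * z - 5) * b1 + (6 * z - 1) * a)"
proof -
  have d: "D t2 = 625 * (2 * a * b1 * (25 * (z - 1) * b2 + 15 * (z - 1) * b1 + (2 * z - 7) * a) + a ^ 2 * (25 * z * b2 + 25 * (z - 1) * b3 + 15 * z * b1 + 15 * (z - 1) * b2 + 2 * z * a + (2 * z - 7) * b1))"
    unfolding t2_eq rules numeral one D_z by algebra
  have "625 * a ^ 6 * (z - 1) * (t1 - 625 * a * (125 * (z - 1) * b3 + (150 * z - 25) * b2 + (55 * z - 5) * b1 + (6 * z - 1) * a)) = a * (3125 * (- 1875 * a ^ 7 + 2 * a ^ 4 * t2 + 1875 * z * a ^ 7) - 625 * a ^ 5 * t1 + 625 * z * a ^ 5 * t1 + 2 * t2 * t3) - 3125 * a ^ 5 * (z - 1) * (625 * (2 * a * b1 * (25 * (z - 1) * b2 + 15 * (z - 1) * b1 + (2 * z - 7) * a) + a ^ 2 * (25 * z * b2 + 25 * (z - 1) * b3 + 15 * z * b1 + 15 * (z - 1) * b2 + 2 * z * a + (2 * z - 7) * b1)))"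
    unfolding t2_eq t3_eq by algebra
  then have "625 * a ^ 6 * (z - 1) * (t1 - 625 * a * (125 * (z - 1) * b3 + (150 * z - 25) * b2 + (55 * z - 5) * b1 + (6 * z - 1) * a)) = 0"
    using E2 unfolding d by simp
  then show ?thesis using a z1 by simp
qed

lemma picard_fuchs: "625 * (1 - z) * D b3 = z * (24 * a + 250 * b1 + 875 * b2 + 1250 * b3)"
proof -
  have d: "D t1 = 625 * (b1 * (125 * (z - 1) * b3 + (150 * z - 25) * b2 + (55 * z - 5) * b1 + (6 * z - 1) * a) + a * (125 * z * b3 + 125 * (z - 1) * D b3 + 150 * z * b2 + (150 * z - 25) * b3 + 55 * z * b1 + (55 * z - 5) * b2 + 6 * z * a + (6 * z - 1) * b1))"
    unfolding t1_eq rules numeral one D_z by algebra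
  have "390625 * a ^ 6 * (z - 1) * (625 * (1 - z) * D b3 - z * (24 * a + 250 * b1 + 875 * b2 + 1250 * b3)) = a * (3125 * (- 125 * a ^ 6 + a ^ 4 * t1 + 125 * z * a ^ 6) + t1 * t3) - 3125 * a ^ 5 * (z - 1) * (625 * (b1 * (125 * (z - 1) * b3 + (150 * z - 25) * b2 + (55 * z - 5) * b1 + (6 * z - 1) * a) + a * (125 * z * b3 + 125 * (z - 1) * D b3 + 150 * z * b2 + (150 * z - 25) * b3 + 55 * z * b1 + (55 * z - 5) * b2 + 6 * z * a + (6 * z - 1) * b1)))"
    unfolding t1_eq t3_eq by algebra
  then have "390625 * a ^ 6 * (z - 1) * (625 * (1 - z) * D b3 - z * (24 * a + 250 * b1 + 875 * b2 + 1250 * b3)) = 0"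
    using E1 unfolding d by simp
  then show ?thesis using a z1 by simp
qed

lemma t6_eq: "t6 = 25 * a ^ 5 * (z - 1) * ((z - 1) * a * D W + (2 * (z - 1) * b1 + z * a) * W)"
proof -
  have d: "D t5 = 25 * (z * a ^ 2 * W + (z - 1) * (2 * a * b1 * W + a ^ 2 * D W))"
    unfolding W rules numeral one D_z by algebra
  have "a * (t6 - 25 * a ^ 5 * (z - 1) * ((z - 1) * a * D W + (2 * (z - 1) * b1 + z * a) * W)) = a * t6 - a ^ 5 * (z - 1) * (25 * (z * a ^ 2 * W + (z - 1) * (2 * a * b1 * W + a ^ 2 * D W)))"
    by algebra
  then have "a * (t6 - 25 * a ^ 5 * (z - 1) * ((z - 1) * a * D W + (2 * (z - 1) * b1 + z * a) * W)) = 0" using E5 unfolding d by simp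
  then show ?thesis using a by simp
qed

text \<open>What \<open>E6\<close> becomes after elimination of \<open>t3\<close>,
  \<open>t5\<close>, \<open>t6\<close>: the equation for the Wronskian of y with a solution
  isotropic to it.\<close>

lemma wronskian_equation: "5 * (1 - z) * a * D (D W) - 10 * (1 - z) * (b1 * D W - b2 * W) - 5 * z * a * D W - 2 * z * a * W = 0"
proof -
  have d: "D t6 = 25 * (5 * a ^ 4 * b1 * (z - 1) * ((z - 1) * a * D W + (2 * (z - 1) * b1 + z * a) * W) + a ^ 5 * z * ((z - 1) * a * D W + (2 * (z - 1) * b1 + z * a) * W) + a ^ 5 * (z - 1) * (z * a * D W + (z - 1) * b1 * D W + (z - 1) * a * D (D W) + (2 * z * b1 + 2 * (z - 1) * b2 + z * a + z * b1) * W + (2 * (z - 1) * b1 + z * a) * D W))"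
    unfolding t6_eq rules numeral one D_z by algebra
  have "9765625 * a ^ 10 * (z - 1) ^ 2 * (5 * (1 - z) * a * D (D W) - 10 * (1 - z) * (b1 * D W - b2 * W) - 5 * z * a * D W - 2 * z * a * W) = a * (t5 * (- 28125000 * a ^ 8 - 15000 * a ^ 4 * t3 - 1171875 * z * a ^ 8 - 2 * t3 ^ 2) + t6 * (23437500 * a ^ 4 + 6250 * t3)) - 1953125 * a ^ 5 * (z - 1) * (25 * (5 * a ^ 4 * b1 * (z - 1) * ((z - 1) * a * D W + (2 * (z - 1) * b1 + z * a) * W) + a ^ 5 * z * ((z - 1) * a * D W + (2 * (z - 1) * b1 + z * a) * W) + a ^ 5 * (z - 1) * (z * a * D W + (z - 1) * b1 * D W + (z - 1) * a * D (D W) + (2 * z * b1 + 2 * (z - 1) * b2 + z * a + z * b1) * W + (2 * (z - 1) * b1 + z * a) * D W)))"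
    unfolding t6_eq t3_eq W by algebra
  then have "9765625 * a ^ 10 * (z - 1) ^ 2 * (5 * (1 - z) * a * D (D W) - 10 * (1 - z) * (b1 * D W - b2 * W) - 5 * z * a * D W - 2 * z * a * W) = 0"
    using E6 unfolding d by simp
  then show ?thesis using a z1 by simp
qed

end

subsection \<open>The power series solutions in the \<open>q\<close>-coordinate\<close>

lemma derivation_theta: "derivation (\<lambda>f :: complex fps. \<kappa> * (fps_X * fps_deriv f))"
  by unfold_locales (simp_all add: algebra_simps)

lemma fps_numeral_neq_0 [simp]: "(numeral k :: complex fps) \<noteq> 0"
  by (simp add: numeral_fps_const)

interpretation X_deriv: derivation "\<lambda>f :: complex fps. fps_X * fps_deriv f"
  using derivation_theta[of 1] by simp

lemma theta_leading:
  obtains h' :: "complex fps" where "\<kappa> * (fps_X * fps_deriv (fps_X ^ n * h)) = fps_X ^ n * h'"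
    "fps_nth h' 0 = fps_nth \<kappa> 0 * of_nat n * fps_nth h 0"
proof (rule that[of "\<kappa> * (of_nat n * h + fps_X * fps_deriv h)"])
  have "fps_X * fps_deriv (fps_X ^ n) = (of_nat n * fps_X ^ n :: complex fps)"
  proof (cases n)
    case (Suc m)
    show ?thesis unfolding Suc X_deriv.power_Suc by (simp add: mult_ac del: of_nat_Suc)
  qed simp
  then have "fps_X * fps_deriv (fps_X ^ n * h) = of_nat n * fps_X ^ n * h + fps_X ^ n * (fps_X * fps_deriv h)"
    by (metis X_deriv.mult)
  then show "\<kappa> * (fps_X * fps_deriv (fps_X ^ n * h)) = fps_X ^ n * (\<kappa> * (of_nat n * h + fps_X * fps_deriv h))"
    by (simp add: algebra_simps)
qed simp

lemma fps_lead:
  fixes f :: "complex fps"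
  assumes "f \<noteq> 0" "fps_nth f 0 = 0"
  obtains n h where "n > 0" "f = fps_X ^ n * h" "fps_nth h 0 \<noteq> 0"
proof (rule that[of "subdegree f" "fps_shift (subdegree f) f"])
  show "f = fps_X ^ subdegree f * fps_shift (subdegree f) f"
    by (metis fps_shift_times_fps_X_power mult.commute order.refl subdegree_decompose)
qed (use assms subdegree_eq_0_iff in auto)

text \<open>Both uniqueness statements compare leading coefficients: the indicial polynomials have \<open>0\<close> as
  their only root.\<close>

lemma picard_fuchs_unique:
  fixes f z \<kappa> :: "complex fps"
  defines "D \<equiv> \<lambda>f. \<kappa> * (fps_X * fps_deriv f)"
  assumes "fps_nth z 0 = 0" "fps_nth \<kappa> 0 \<noteq> 0" "fps_nth f 0 = 0"
    and eq: "625 * (1 - z) * D (D (D (D f))) = z * (24 * f + 250 * D f + 875 * D (D f) + 1250 * D (D (D f)))"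
  shows "f = 0"
proof (rule ccontr)
  assume "f \<noteq> 0"
  then obtain n h where n: "n > 0" and f: "f = fps_X ^ n * h" and h: "fps_nth h 0 \<noteq> 0"
    using assms(4) by (rule fps_lead)
  obtain h1 where h1: "D (fps_X ^ n * h) = fps_X ^ n * h1" "fps_nth h1 0 = fps_nth \<kappa> 0 * of_nat n * fps_nth h 0"
    unfolding D_def using theta_leading[of \<kappa> n h] by blast
  obtain h2 where h2: "D (fps_X ^ n * h1) = fps_X ^ n * h2" "fps_nth h2 0 = fps_nth \<kappa> 0 * of_nat n * fps_nth h1 0"
    unfolding D_def using theta_leading[of \<kappa> n h1] by blast
  obtain h3 where h3: "D (fps_X ^ n * h2) = fps_X ^ n * h3" "fps_nth h3 0 = fps_nth \<kappa> 0 * of_nat n * fps_nth h2 0"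
    unfolding D_def using theta_leading[of \<kappa> n h2] by blast
  obtain h4 where h4: "D (fps_X ^ n * h3) = fps_X ^ n * h4" "fps_nth h4 0 = fps_nth \<kappa> 0 * of_nat n * fps_nth h3 0"
    unfolding D_def using theta_leading[of \<kappa> n h3] by blast
  have "fps_X ^ n * (625 * (1 - z) * h4) = fps_X ^ n * (z * (24 * h + 250 * h1 + 875 * h2 + 1250 * h3))"
    using eq unfolding f h1(1) h2(1) h3(1) h4(1) by (simp add: algebra_simps)
  then have "625 * (1 - z) * h4 = z * (24 * h + 250 * h1 + 875 * h2 + 1250 * h3)" by simp
  from arg_cong[OF this, of "\<lambda>f. fps_nth f 0"] have "fps_nth h4 0 = 0"
    by (simp add: assms(2))
  then show False using h n assms(3) by (simp add: h4(2) h3(2) h2(2) h1(2))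
qed

lemma wronskian_equation_unique:
  fixes W a b c z \<kappa> :: "complex fps"
  defines "D \<equiv> \<lambda>f. \<kappa> * (fps_X * fps_deriv f)"
  assumes "fps_nth z 0 = 0" "fps_nth \<kappa> 0 \<noteq> 0" "fps_nth W 0 = 0" "fps_nth a 0 \<noteq> 0" "fps_nth b 0 = 0" "fps_nth c 0 = 0"
    and eq: "5 * (1 - z) * a * D (D W) - 10 * (1 - z) * (b * D W - c * W) - 5 * z * a * D W - 2 * z * a * W = 0"
  shows "W = 0"
proof (rule ccontr)
  assume "W \<noteq> 0"
  then obtain n h where n: "n > 0" and f: "W = fps_X ^ n * h" and h: "fps_nth h 0 \<noteq> 0"
    using assms(4) by (rule fps_lead)
  obtain h1 where h1: "D (fps_X ^ n * h) = fps_X ^ n * h1" "fps_nth h1 0 = fps_nth \<kappa> 0 * of_nat n * fps_nth h 0"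
    unfolding D_def using theta_leading[of \<kappa> n h] by blast
  obtain h2 where h2: "D (fps_X ^ n * h1) = fps_X ^ n * h2" "fps_nth h2 0 = fps_nth \<kappa> 0 * of_nat n * fps_nth h1 0"
    unfolding D_def using theta_leading[of \<kappa> n h1] by blast
  have "fps_X ^ n * (5 * (1 - z) * a * h2 - 10 * (1 - z) * (b * h1 - c * h) - 5 * z * a * h1 - 2 * z * a * h) = 0"
    using eq unfolding f h1(1) h2(1) by (simp add: algebra_simps)
  then have "5 * (1 - z) * a * h2 - 10 * (1 - z) * (b * h1 - c * h) - 5 * z * a * h1 - 2 * z * a * h = 0" by simp
  from arg_cong[OF this, of "\<lambda>f. fps_nth f 0"] have "fps_nth h2 0 = 0"
    using assms by simp
  then show False using h n assms(3) by (simp add: h2(2) h1(2))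
qed

text \<open>The chain rule: the second assumption makes the derivation z d/dz on series in
  z.\<close>

lemma theta_compose:
  fixes \<kappa> z F :: "complex fps"
  assumes "fps_nth z 0 = 0" "\<kappa> * (fps_X * fps_deriv z) = z"
  shows "\<kappa> * (fps_X * fps_deriv (F oo z)) = (fps_X * fps_deriv F) oo z"
proof -
  have "\<kappa> * (fps_X * fps_deriv (F oo z)) = (fps_deriv F oo z) * (\<kappa> * (fps_X * fps_deriv z))"
    unfolding fps_compose_deriv[OF assms(1)] by (simp add: mult_ac)
  then show ?thesis
    unfolding assms(2) using assms(1) by (simp add: fps_compose_mult_distrib mult.commute)
qed

abbreviation "fU i \<equiv> frob_fps i 0"
abbreviation "fV i \<equiv> frob_fps i 1"

lemma X_deriv_fU: "fps_X * fps_deriv (fU i) = fU (Suc i)"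
  using frob_fps_deriv[of i 0] by simp

lemma X_deriv_fV: "fps_X * fps_deriv (fV i) = fV (Suc i) - fU i"
  using frob_fps_deriv[of i 1] by simp

lemma frob_fps_4':
  assumes "j < 4"
  shows "625 * ((1 - fps_X) * frob_fps 4 j) = fps_X * (24 * frob_fps 0 j + 250 * frob_fps 1 j + 875 * frob_fps 2 j + 1250 * frob_fps 3 j)"
proof -
  have c: "625 * (fps_const x * f) = fps_const (625 * x) * f" for x and f :: "complex fps"
    by (simp add: numeral_fps_const mult.assoc[symmetric] del: fps_const_mult_apply_left)
  have "625 * ((1 - fps_X) * frob_fps 4 j) = fps_X * (625 * (fps_const (24/625) * frob_fps 0 j)
     + 625 * (fps_const (2/5) * frob_fps 1 j) + 625 * (fps_const (7/5) * frob_fps 2 j) + 625 * (fps_const 2 * frob_fps 3 j))"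
    unfolding frob_fps_4[OF assms] by (simp only: ring_distribs mult.left_commute)
  then show ?thesis unfolding c by (simp add: numeral_fps_const)
qed

text \<open>The solutions have the \<theta>-derivatives \<open>fU i\<close> and \<open>fV i\<close>
  + log z \<open>fU i\<close>. The logarithm cancels in their 2 x 2 minors, which are therefore
  power series.\<close>

definition frob_wronskian :: "nat \<Rightarrow> nat \<Rightarrow> complex fps" where
  "frob_wronskian i j = fU i * fV j - fU j * fV i"

lemma X_deriv_frob_wronskian:
  "fps_X * fps_deriv (frob_wronskian i j) = frob_wronskian (Suc i) j + frob_wronskian i (Suc j)"
  unfolding frob_wronskian_def X_deriv.diff X_deriv.mult X_deriv_fU X_deriv_fV by algebra

lemma frob_wronskian_self [simp]: "frob_wronskian i i = 0"
  by (simp add: frob_wronskian_def)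

text \<open>Up to the factor 5 this is \<open>pf_form\<close> on the first two Frobenius solutions.
  The equation makes its derivative vanish, and its constant term is 0.\<close>

lemma frob_isotropic:
  "5 * (1 - fps_X) * (frob_wronskian 0 3 - frob_wronskian 1 2) - 5 * fps_X * frob_wronskian 0 2 - 2 * fps_X * frob_wronskian 0 1 = 0"
  (is "?G = 0")
proof -
  have X: "fps_X * fps_deriv fps_X = (fps_X :: complex fps)" by simp
  have S: "Suc 0 = 1" "Suc 1 = 2" "Suc 2 = 3" "Suc 3 = 4" by simp_all
  have 4: "125 * ((1 - fps_X) * frob_wronskian 0 4) = fps_X * (50 * frob_wronskian 0 1 + 175 * frob_wronskian 0 2 + 250 * frob_wronskian 0 3)"
  proof -
    have n: "(1::nat) < 4" by simp
    have "625 * ((1 - fps_X) * frob_wronskian 0 4) = fU 0 * (625 * ((1 - fps_X) * fV 4)) - (625 * ((1 - fps_X) * fU 4)) * fV 0"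
      unfolding frob_wronskian_def by algebra
    also have "\<dots> = fU 0 * (fps_X * (24 * fV 0 + 250 * fV 1 + 875 * fV 2 + 1250 * fV 3))
        - (fps_X * (24 * fU 0 + 250 * fU 1 + 875 * fU 2 + 1250 * fU 3)) * fV 0"
      unfolding frob_fps_4'[OF zero_less_numeral] frob_fps_4'[OF n] ..
    also have "\<dots> = 5 * (fps_X * (50 * frob_wronskian 0 1 + 175 * frob_wronskian 0 2 + 250 * frob_wronskian 0 3))"
      unfolding frob_wronskian_def by algebra
    finally have "5 * (125 * ((1 - fps_X) * frob_wronskian 0 4)) =
        5 * (fps_X * (50 * frob_wronskian 0 1 + 175 * frob_wronskian 0 2 + 250 * frob_wronskian 0 3))"
      by algebra
    then show ?thesis by (metis mult_left_cancel fps_numeral_neq_0)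
  qed
  have "fps_X * fps_deriv ?G = 5 * (- fps_X) * (frob_wronskian 0 3 - frob_wronskian 1 2)
     + 5 * (1 - fps_X) * frob_wronskian 0 4
     - 5 * (fps_X * frob_wronskian 0 2 + fps_X * (frob_wronskian 1 2 + frob_wronskian 0 3))
     - 2 * (fps_X * frob_wronskian 0 1 + fps_X * frob_wronskian 0 2)"
    unfolding X_deriv.diff X_deriv.mult X_deriv.numeral X_deriv.one X X_deriv_frob_wronskian S frob_wronskian_self
    by algebra
  then have "25 * (fps_X * fps_deriv ?G) = 25 * (5 * (- fps_X) * (frob_wronskian 0 3 - frob_wronskian 1 2))
     + 125 * ((1 - fps_X) * frob_wronskian 0 4)
     - 25 * (5 * (fps_X * frob_wronskian 0 2 + fps_X * (frob_wronskian 1 2 + frob_wronskian 0 3)))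
     - 25 * (2 * (fps_X * frob_wronskian 0 1 + fps_X * frob_wronskian 0 2))"
    by algebra
  also have "\<dots> = 0" unfolding 4 by algebra
  finally have "fps_deriv ?G = 0" by (simp only: mult_eq_0_iff fps_numeral_neq_0 fps_X_neq_zero simp_thms)
  then have "?G = fps_const (fps_nth ?G 0)" by (simp only: fps_deriv_eq_0_iff)
  moreover have "fps_nth ?G 0 = 0"
    by (simp add: frob_wronskian_def frob_fps_def frob_nth_at_0)
  ultimately show ?thesis by simp
qed

text \<open>By the Pluecker relation U_1 W_02 - U_2 W_01 = U_0 W_12 this is U_0 times the isotropy
  relation.\<close>

lemma frob_wronskian_equation:
  "5 * (1 - fps_X) * fU 0 * (frob_wronskian 1 2 + frob_wronskian 0 3) - 10 * (1 - fps_X) * (fU 1 * frob_wronskian 0 2 - fU 2 * frob_wronskian 0 1)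
   - 5 * fps_X * fU 0 * frob_wronskian 0 2 - 2 * fps_X * fU 0 * frob_wronskian 0 1 = 0"
proof -
  have "fU 1 * frob_wronskian 0 2 - fU 2 * frob_wronskian 0 1 = fU 0 * frob_wronskian 1 2"
    unfolding frob_wronskian_def by algebra
  then show ?thesis using frob_isotropic by algebra
qed

section \<open>The seven functions as power series in z\<close>

definition t_series :: "complex \<Rightarrow> nat \<Rightarrow> complex fps" where
  "t_series c i =
     (if i = 0 then fps_const (1/5) * fU 0
      else if i = 1 then fU 0 * (3125 * (fps_X - 1) * fU 3 + (3750 * fps_X - 625) * fU 2 + (1375 * fps_X - 125) * fU 1 + (150 * fps_X - 25) * fU 0)
      else if i = 2 then fU 0 ^ 2 * (125 * (fps_X - 1) * fU 2 + 75 * (fps_X - 1) * fU 1 + (10 * fps_X - 35) * fU 0)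
      else if i = 3 then fU 0 ^ 3 * (5 * (fps_X - 1) * fU 1 + (fps_X - 6) * fU 0)
      else if i = 4 then fps_const (1/3125) * (fps_X * fU 0 ^ 5)
      else if i = 5 then fps_const c * ((fps_X - 1) * fU 0 ^ 2 * frob_wronskian 0 1)
      else fps_const (c / 625) * (fU 0 ^ 5 * (fps_X - 1) * ((fps_X - 1) * fU 0 * frob_wronskian 0 2
        + (2 * (fps_X - 1) * fU 1 + fps_X * fU 0) * frob_wronskian 0 1)))"

lemma conv1_more:
  "1 \<le> fps_conv_radius (fps_X :: complex fps)" "1 \<le> fps_conv_radius (numeral n :: complex fps)"
  "1 \<le> fps_conv_radius (1 :: complex fps)" "1 \<le> fps_conv_radius (fps_const c :: complex fps)"
  "1 \<le> fps_conv_radius (F :: complex fps) \<Longrightarrow> 1 \<le> fps_conv_radius (F ^ k)"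
  using order.trans[OF _ fps_conv_radius_power] by auto

lemma frob_fps_conv_U: "i < 4 \<Longrightarrow> 1 \<le> fps_conv_radius (fU i)"
  and frob_fps_conv_V: "i < 4 \<Longrightarrow> 1 \<le> fps_conv_radius (fV i)"
  by (simp_all add: frob_fps_conv)

lemma t_series_conv: "1 \<le> fps_conv_radius (t_series c i)"
proof -
  have if_intro: "1 \<le> fps_conv_radius (if P then f else g)"
    if "1 \<le> fps_conv_radius f" "1 \<le> fps_conv_radius g" for P and f g :: "complex fps"
    using that by simp
  show ?thesis
    unfolding t_series_def frob_wronskian_def
    by (intro if_intro conv1_intros conv1_more frob_fps_conv_U frob_fps_conv_V) simp_all
qed

text \<open>Any \<open>l\<close> is allowed, because the Wronskian minors are free of the
  logarithm.\<close>

lemma eval_t_series: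
  assumes "z \<in> lens"
  shows "eval_fps (t_series c i) z = sol_values c z (frob_sol z l (vec4 1 0 0 0)) (frob_sol z l (vec4 0 1 0 0)) i"
proof -
  have pw: "eval_fps (F ^ k) z = eval_fps F z ^ k" if "1 \<le> fps_conv_radius F" for F k
    using lens_conv[OF assms that] by (rule eval_fps_power)
  note ev = lens_eval_fps[OF assms] pw conv1_intros conv1_more frob_fps_conv_U frob_fps_conv_V
  have le: "log_exp l (vec4 1 0 0 0) = vec4 1 0 0 0" "log_exp l (vec4 0 1 0 0) = vec4 l 1 0 0"
    by (simp_all add: log_exp_def vec4_eq_iff)
  have w: "eval_fps (frob_wronskian i j) z = eval_fps (fU i) z * eval_fps (fV j) z - eval_fps (fU j) z * eval_fps (fV i) z"
    "1 \<le> fps_conv_radius (frob_wronskian i j)" if "i < 4" "j < 4" for i j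
    using that by (simp_all only: frob_wronskian_def ev)
  have W: "eval_fps (frob_wronskian 0 j) z = eval_fps (fU 0) z * (eval_fps (fU j) z * l + eval_fps (fV j) z)
      - eval_fps (fU j) z * (eval_fps (fU 0) z * l + eval_fps (fV 0) z)" if "j < 4" for j
    using that by (simp add: w algebra_simps)
  have n: "(1::nat) < 4" "(2::nat) < 4" "(0::nat) < 4" "(3::nat) < 4" by simp_all
  have if_eq: "eval_fps (if P then f else g) z = (if P then x else y)"
    if "eval_fps f z = x" "eval_fps g z = y" for P f g x y
    using that by simp
  show ?thesis
    unfolding sol_values_def t_values_def frob_sol_def vec4_nth frob_row_def le t_series_def mult_1_right mult_zero_right
      add_0_right
    by (intro if_eq) (simp_all only: ev w(2) n W eval_fps_numeral eval_fps_1 eval_fps_X eval_fps_const, simp_all add: mult.assoc)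
qed

lemma frob_fps_initial: "fps_nth (frob_fps i j) 0 = (if i = j then 1 else 0)"
  by (simp add: frob_fps_def frob_nth_at_0)

text \<open>t_4 / t_0^5 serves as the coordinate z. In it the equations for y and for the Wronskian
  have at most one power series solution with a given constant term, so both functions are the
  Frobenius series up to constants, and the elimination formulas give the rest.\<close>

lemma dwork_system_eq_t_series:
  assumes sys: "dwork_system t" and t00: "fps_nth (t 0) 0 = 1/5" and t40: "fps_nth (t 4) 0 = 0"
    and t50: "fps_nth (t 5) 0 \<noteq> 0"
  shows "\<exists>c z. c \<noteq> 0 \<and> fps_nth z 0 = 0 \<and> t 4 = z * t 0 ^ 5 \<and> (\<forall>i\<in>{0..6}. t i = t_series c i oo z)"
proof -
  define a where "a = t 0"
  define z where "z = t 4 * inverse a ^ 5"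
  define g where "g = t 4 - a ^ 5"
  define \<kappa> where "\<kappa> = 5 * (a * t 5 * inverse g)"
  define D where "D f = \<kappa> * (fps_X * fps_deriv f)" for f
  have a0: "fps_nth a 0 = 1/5" using t00 by (simp add: a_def)
  have g0: "fps_nth g 0 = - 1/3125" using t40 by (simp add: g_def fps_power_zeroth a0 power_divide)
  have ia: "inverse a * a = 1" by (rule inverse_mult_eq_1) (simp add: a0)
  have ig: "inverse g * g = 1" by (rule inverse_mult_eq_1) (simp add: g0)
  have i5: "inverse (t 5) * t 5 = 1" by (rule inverse_mult_eq_1) (rule t50)
  have z0: "fps_nth z 0 = 0" using t40 by (simp add: z_def)
  have za: "z * a ^ 5 = t 4"
  proof -
    have "z * a ^ 5 = t 4 * (inverse a * a) ^ 5" unfolding z_def by algebra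
    then show ?thesis by (simp add: ia)
  qed
  have g: "a ^ 5 * (z - 1) = g" unfolding g_def za[symmetric] by algebra
  have k0: "fps_nth \<kappa> 0 \<noteq> 0" using t50 by (simp add: \<kappa>_def a0 g0)
  have DD: "a ^ 5 * (z - 1) * D f = a * (t 5 * qderiv5 f)" for f
  proof -
    have "g * D f = (inverse g * g) * (a * (t 5 * (5 * fps_X * fps_deriv f)))"
      unfolding D_def \<kappa>_def by algebra
    then show ?thesis unfolding g ig qderiv5_def by simp
  qed
  have div: "t 5 * (1 / t 5 * R) = R" "t 5 * (R / t 5) = R" for R
    using i5 t50 by (simp_all add: fps_divide_unit mult.assoc[symmetric] mult.commute[of "t 5"] mult.assoc)
  note S = sys[unfolded dwork_system_def, folded a_def za]
  note S0 = S[THEN conjunct1]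
    and S1 = S[THEN conjunct2, THEN conjunct1]
    and S2 = S[THEN conjunct2, THEN conjunct2, THEN conjunct1]
    and S3 = S[THEN conjunct2, THEN conjunct2, THEN conjunct2, THEN conjunct1]
    and S4 = S[THEN conjunct2, THEN conjunct2, THEN conjunct2, THEN conjunct2, THEN conjunct1]
    and S5 = S[THEN conjunct2, THEN conjunct2, THEN conjunct2, THEN conjunct2, THEN conjunct2, THEN conjunct1]
    and S6 = S[THEN conjunct2, THEN conjunct2, THEN conjunct2, THEN conjunct2, THEN conjunct2, THEN conjunct2]
  interpret derivation D unfolding D_def by (rule derivation_theta)
  define i1 where "i1 = inverse (z - 1)"
  have i1: "i1 * (z - 1) = 1" unfolding i1_def by (rule inverse_mult_eq_1) (simp add: z0)
  define W where "W = fps_const (1/25) * (t 5 * inverse a ^ 2 * i1)"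
  have W: "t 5 = 25 * (z - 1) * a ^ 2 * W"
  proof -
    have "25 * (z - 1) * a ^ 2 * W = (25 * fps_const (1/25)) * (i1 * (z - 1)) * (inverse a * a) ^ 2 * t 5"
      unfolding W_def by algebra
    also have "25 * fps_const (1/25) = (1 :: complex fps)" by (simp add: numeral_fps_const)
    finally show ?thesis by (simp add: i1 ia)
  qed
  interpret dwork_derivation D a "t 1" "t 2" "t 3" "t 5" "t 6" z W
  proof
    have c: "3125 * fps_const (6/5) = (3750 :: complex fps)" "3125 * fps_const (1/3125) = (1 :: complex fps)"
      "3125 * fps_const (1/5) = (625 :: complex fps)" "3125 * fps_const (2/3125) = (2 :: complex fps)"
      "3125 * fps_const (3/3125) = (3 :: complex fps)" "3125 * fps_const (1/625) = (5 :: complex fps)"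
      "1953125 * fps_const (72/5) = (28125000 :: complex fps)" "1953125 * fps_const (24/3125) = (15000 :: complex fps)"
      "1953125 * fps_const (3/5) = (1171875 :: complex fps)" "1953125 * fps_const (2/1953125) = (2 :: complex fps)"
      "1953125 * fps_const (2/625) = (6250 :: complex fps)"
      by (simp_all add: numeral_fps_const)
    have DD': "n * a ^ 5 * (z - 1) * D f = a * (n * (t 5 * qderiv5 f))" for n f
      using DD[of f] by (simp add: mult.assoc mult.left_commute[of _ n])
    show "numeral k \<noteq> (0 :: complex fps)" for k by simp
    show "a \<noteq> 0" using a0 by auto
    show "z \<noteq> 1" using z0 by auto
    show "t 5 = 25 * (z - 1) * a ^ 2 * W" by (rule W)
    have q0: "t 5 * qderiv5 a = fps_const (6/5) * a ^ 5 + fps_const (1/3125) * a * t 3 - fps_const (1/5) * (z * a ^ 5)"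
      unfolding S0 by (rule div(1))
    have "a * (3125 * (t 5 * qderiv5 a)) = a * ((3125 * fps_const (6/5)) * a ^ 5 + (3125 * fps_const (1/3125)) * (a * t 3) - (3125 * fps_const (1/5)) * (z * a ^ 5))"
      unfolding q0 by algebra
    note * = this[unfolded c]
    show "3125 * a ^ 5 * (z - 1) * D a = a * (3750 * a ^ 5 + a * t 3 - 625 * z * a ^ 5)"
      unfolding DD' * by algebra
    have q1: "t 5 * qderiv5 (t 1) = - 125 * a ^ 6 + a ^ 4 * t 1 + 125 * a * (z * a ^ 5) + fps_const (1/3125) * t 1 * t 3"
      unfolding S1 by (rule div(1))
    have "a * (3125 * (t 5 * qderiv5 (t 1))) = a * (3125 * (- 125 * a ^ 6 + a ^ 4 * t 1 + 125 * a * (z * a ^ 5)) + (3125 * fps_const (1/3125)) * (t 1 * t 3))"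
      unfolding q1 by algebra
    note * = this[unfolded c]
    show "3125 * a ^ 5 * (z - 1) * D (t 1) = a * (3125 * (- 125 * a ^ 6 + a ^ 4 * t 1 + 125 * z * a ^ 6) + t 1 * t 3)"
      unfolding DD' * by algebra
    have q2: "t 5 * qderiv5 (t 2) = - 1875 * a ^ 7 - fps_const (1/5) * a ^ 5 * t 1 + 2 * a ^ 4 * t 2
        + 1875 * a ^ 2 * (z * a ^ 5) + fps_const (1/5) * t 1 * (z * a ^ 5) + fps_const (2/3125) * t 2 * t 3"
      unfolding S2 by (rule div(1))
    have "a * (3125 * (t 5 * qderiv5 (t 2))) = a * (3125 * (- 1875 * a ^ 7 + 2 * a ^ 4 * t 2 + 1875 * a ^ 2 * (z * a ^ 5)) - (3125 * fps_const (1/5)) * (a ^ 5 * t 1) + (3125 * fps_const (1/5)) * (t 1 * (z * a ^ 5)) + (3125 * fps_const (2/3125)) * (t 2 * t 3))"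
      unfolding q2 by algebra
    note * = this[unfolded c]
    show "3125 * a ^ 5 * (z - 1) * D (t 2) =
       a * (3125 * (- 1875 * a ^ 7 + 2 * a ^ 4 * t 2 + 1875 * z * a ^ 7) - 625 * a ^ 5 * t 1 + 625 * z * a ^ 5 * t 1 + 2 * t 2 * t 3)"
      unfolding DD' * by algebra
    have q3: "t 5 * qderiv5 (t 3) = - 3125 * a ^ 8 - fps_const (1/5) * a ^ 5 * t 2 + 3 * a ^ 4 * t 3
        + 3125 * a ^ 3 * (z * a ^ 5) + fps_const (1/5) * t 2 * (z * a ^ 5) + fps_const (3/3125) * t 3 ^ 2"
      unfolding S3 by (rule div(1))
    have "a * (3125 * (t 5 * qderiv5 (t 3))) = a * (3125 * (- 3125 * a ^ 8 + 3 * a ^ 4 * t 3 + 3125 * a ^ 3 * (z * a ^ 5)) - (3125 * fps_const (1/5)) * (a ^ 5 * t 2) + (3125 * fps_const (1/5)) * (t 2 * (z * a ^ 5)) + (3125 * fps_const (3/3125)) * t 3 ^ 2)"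
      unfolding q3 by algebra
    note * = this[unfolded c]
    show "3125 * a ^ 5 * (z - 1) * D (t 3) =
       a * (3125 * (- 3125 * a ^ 8 + 3 * a ^ 4 * t 3 + 3125 * z * a ^ 8) - 625 * a ^ 5 * t 2 + 625 * z * a ^ 5 * t 2 + 3 * t 3 ^ 2)"
      unfolding DD' * by algebra
    have q4: "t 5 * qderiv5 (z * a ^ 5) = 5 * a ^ 4 * (z * a ^ 5) + fps_const (1/625) * t 3 * (z * a ^ 5)"
      unfolding S4 by (rule div(1))
    have "a * (3125 * (t 5 * qderiv5 (z * a ^ 5))) = a * (3125 * (5 * a ^ 4 * (z * a ^ 5)) + (3125 * fps_const (1/625)) * (t 3 * (z * a ^ 5)))"
      unfolding q4 by algebra
    note * = this[unfolded c]
    show "3125 * a ^ 5 * (z - 1) * D (z * a ^ 5) = a * (15625 * z * a ^ 9 + 5 * z * a ^ 5 * t 3)"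
      unfolding DD' * by algebra
    have q5: "t 5 * qderiv5 (t 5) = t 6" unfolding S5 by (rule div(2))
    show "a ^ 5 * (z - 1) * D (t 5) = a * t 6" unfolding DD q5 ..
    have q6: "t 5 * qderiv5 (t 6) = t 5 * (- fps_const (72/5) * a ^ 8 - fps_const (24/3125) * a ^ 4 * t 3
         - fps_const (3/5) * a ^ 3 * (z * a ^ 5) - fps_const (2/1953125) * t 3 ^ 2)
       + (t 5 * (t 6 / t 5)) * (12 * a ^ 4 + fps_const (2/625) * t 3)"
      unfolding S6 by algebra
    have "a * (1953125 * (t 5 * qderiv5 (t 6))) = a * (t 5 * (- (1953125 * fps_const (72/5)) * a ^ 8 - (1953125 * fps_const (24/3125)) * (a ^ 4 * t 3) - (1953125 * fps_const (3/5)) * (a ^ 3 * (z * a ^ 5)) - (1953125 * fps_const (2/1953125)) * t 3 ^ 2) + t 6 * (23437500 * a ^ 4 + (1953125 * fps_const (2/625)) * t 3))"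
      unfolding q6 div(2) by algebra
    note * = this[unfolded c]
    show "1953125 * a ^ 5 * (z - 1) * D (t 6) = a * (t 5 * (- 28125000 * a ^ 8 - 15000 * a ^ 4 * t 3
        - 1171875 * z * a ^ 8 - 2 * t 3 ^ 2) + t 6 * (23437500 * a ^ 4 + 6250 * t 3))"
      unfolding DD' * by algebra
  qed
  have comp: "D (F oo z) = (fps_X * fps_deriv F) oo z" for F
    using theta_compose[OF z0] D_z unfolding D_def by blast
  have compU: "D (fU i oo z) = fU (Suc i) oo z" for i unfolding comp X_deriv_fU ..
  note cz = fps_compose_mult_distrib[OF z0] fps_compose_add_distrib fps_compose_sub_distrib
    fps_X_fps_compose_startby0[OF z0] numeral_compose fps_compose_1 fps_const_compose fps_compose_power[OF z0, symmetric]
  have S: "Suc 0 = 1" "Suc 1 = 2" "Suc 2 = 3" "Suc 3 = 4" by simp_all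
  \<comment> \<open>Both series have constant term 1, so their difference starts in positive
    degree.\<close>
  have 5: "5 * a - (fU 0 oo z) = 0"
  proof (rule picard_fuchs_unique[OF z0 k0, folded D_def])
    show "fps_nth (5 * a - (fU 0 oo z)) 0 = 0" by (simp add: a0 frob_fps_initial)
    have "625 * ((1 - z) * (fU 4 oo z)) = z * (24 * (fU 0 oo z) + 250 * (fU 1 oo z) + 875 * (fU 2 oo z) + 1250 * (fU 3 oo z))"
      using arg_cong[OF frob_fps_4'[of 0], of "\<lambda>F. F oo z"] unfolding cz by simp
    then show "625 * (1 - z) * D (D (D (D (5 * a - (fU 0 oo z))))) = z * (24 * (5 * a - (fU 0 oo z)) + 250 * D (5 * a - (fU 0 oo z))
       + 875 * D (D (5 * a - (fU 0 oo z))) + 1250 * D (D (D (5 * a - (fU 0 oo z)))))"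
      using picard_fuchs unfolding rules numeral zero compU S by algebra
  qed
  then have y0: "fU 0 oo z = 5 * a" by simp
  have y1: "fU 1 oo z = 5 * b1" using compU[of 0] unfolding y0 rules numeral S by simp
  have y2: "fU 2 oo z = 5 * b2" using compU[of 1] unfolding y1 rules numeral S by simp
  have y3: "fU 3 oo z = 5 * b3" using compU[of 2] unfolding y2 rules numeral S by simp
  \<comment> \<open>\<open>V\<close> has constant term 1, so this choice makes \<open>W\<close>
    minus \<open>c\<close> times \<open>V\<close> start in positive degree.\<close>
  define c where "c = fps_nth W 0"
  define V where "V = frob_wronskian 0 1 oo z"
  have DV: "D V = frob_wronskian 0 2 oo z"
    unfolding V_def comp X_deriv_frob_wronskian S by simp
  have DDV: "D (D V) = (frob_wronskian 1 2 + frob_wronskian 0 3) oo z"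
    unfolding DV comp X_deriv_frob_wronskian S ..
  have Dc: "D (fps_const c) = 0" by (simp add: D_def)
  have "W - fps_const c * V = 0"
  proof (rule wronskian_equation_unique[OF z0 k0, folded D_def])
    show "fps_nth (W - fps_const c * V) 0 = 0"
      by (simp add: c_def V_def frob_wronskian_def frob_fps_initial)
    show "fps_nth a 0 \<noteq> 0" unfolding a0 by simp
    show "fps_nth b1 0 = 0" "fps_nth b2 0 = 0" by (simp_all add: D_def)
    have "5 * (1 - z) * (5 * a) * D (D V) - 10 * (1 - z) * ((5 * b1) * D V - (5 * b2) * V)
       - 5 * z * (5 * a) * D V - 2 * z * (5 * a) * V = 0"
      using arg_cong[OF frob_wronskian_equation, of "\<lambda>F. F oo z"]
      unfolding DDV unfolding DV unfolding V_def y0[symmetric] y1[symmetric] y2[symmetric] cz fps_compose_0 .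
    then have "5 * (5 * (1 - z) * a * D (D V) - 10 * (1 - z) * (b1 * D V - b2 * V) - 5 * z * a * D V - 2 * z * a * V) = 0"
      by algebra
    then have "5 * (1 - z) * a * D (D V) - 10 * (1 - z) * (b1 * D V - b2 * V) - 5 * z * a * D V - 2 * z * a * V = 0"
      by (metis mult_eq_0_iff fps_numeral_neq_0)
    then show "5 * (1 - z) * a * D (D (W - fps_const c * V)) - 10 * (1 - z) * (b1 * D (W - fps_const c * V) - b2 * (W - fps_const c * V))
       - 5 * z * a * D (W - fps_const c * V) - 2 * z * a * (W - fps_const c * V) = 0"
      using wronskian_equation unfolding rules Dc zero by algebra
  qed
  then have Wc: "W = fps_const c * V" by simp
  have DW: "D W = fps_const c * D V" unfolding Wc rules Dc by simp
  have "c \<noteq> 0" using t50 unfolding W by (auto simp: c_def)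
  have "t i = t_series c i oo z" if "i \<in> {0..6}" for i
  proof -
    have k: "5 * fps_const (1/5) = (1 :: complex fps)" "3125 * fps_const (1/3125) = (1 :: complex fps)"
      "625 * fps_const (c / 625) = fps_const c" by (simp_all add: numeral_fps_const)
    consider "i = 0" | "i = 1" | "i = 2" | "i = 3" | "i = 4" | "i = 5" | "i = 6"
      using \<open>i \<in> {0..6}\<close> by fastforce
    then show ?thesis
    proof cases
      case 1
      have "t_series c 0 oo z = fps_const (1/5) * (5 * a)" unfolding t_series_def if_P[OF refl] cz y0 ..
      also have "\<dots> = (5 * fps_const (1/5)) * a" by algebra
      finally show ?thesis unfolding k(1) 1 a_def by simp
    next
      case 2
      have "t_series c 1 oo z = 5 * a * (3125 * (z - 1) * (5 * b3) + (3750 * z - 625) * (5 * b2) + (1375 * z - 125) * (5 * b1) + (150 * z - 25) * (5 * a))"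
        by (simp add: t_series_def cz y0 y1[unfolded One_nat_def] y2 y3)
      then show ?thesis unfolding 2 t1_eq by algebra
    next
      case 3
      have "t_series c 2 oo z = (5 * a) ^ 2 * (125 * (z - 1) * (5 * b2) + 75 * (z - 1) * (5 * b1) + (10 * z - 35) * (5 * a))"
        by (simp add: t_series_def cz y0 y1[unfolded One_nat_def] y2 y3)
      then show ?thesis unfolding 3 t2_eq by algebra
    next
      case 4
      have "t_series c 3 oo z = (5 * a) ^ 3 * (5 * (z - 1) * (5 * b1) + (z - 6) * (5 * a))"
        by (simp add: t_series_def cz y0 y1[unfolded One_nat_def] y2 y3)
      then show ?thesis unfolding 4 t3_eq by algebra
    next
      case 5
      have "t_series c 4 oo z = fps_const (1/3125) * (z * (5 * a) ^ 5)"
        by (simp add: t_series_def cz y0)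
      also have "\<dots> = (3125 * fps_const (1/3125)) * (z * a ^ 5)" by algebra
      finally show ?thesis unfolding k(2) 5 za[symmetric] by simp
    next
      case 6
      have "t_series c 5 oo z = fps_const c * ((z - 1) * (5 * a) ^ 2 * V)"
        by (simp add: t_series_def cz y0 V_def)
      then show ?thesis unfolding 6 W Wc by algebra
    next
      case 7
      have "t_series c 6 oo z = fps_const (c / 625) * ((5 * a) ^ 5 * (z - 1) * ((z - 1) * (5 * a) * D V
          + (2 * (z - 1) * (5 * b1) + z * (5 * a)) * V))"
        by (simp add: t_series_def cz y0 y1[unfolded One_nat_def] DV[symmetric] V_def[symmetric, unfolded One_nat_def])
      also have "\<dots> = (625 * fps_const (c / 625)) * (25 * a ^ 5 * (z - 1) * ((z - 1) * a * D V + (2 * (z - 1) * b1 + z * a) * V))"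
        by algebra
      finally show ?thesis unfolding k(3) 7 t6_eq DW unfolding Wc by algebra
    qed
  qed
  then show ?thesis using \<open>c \<noteq> 0\<close> z0 za[unfolded a_def] by (intro exI[of _ c] exI[of _ z]) auto
qed

section \<open>Algebraic independence\<close>

lemma poly_eval_fps_compose:
  fixes f :: "'i \<Rightarrow> 'a::field fps"
  assumes "fps_nth z 0 = 0"
  shows "poly_eval_fps f P oo z = poly_eval_fps (\<lambda>i. f i oo z) P"
  unfolding poly_eval_fps_def
  by (simp add: fps_compose_sum_distrib fps_compose_mult_distrib[OF assms] fps_compose_prod_distrib[OF assms]
      fps_compose_power[OF assms, symmetric])

theorem theorem2:
  fixes t :: "nat \<Rightarrow> complex fps"
  assumes "dwork_system t"
    and "fps_nth (t 0) 0 = 1/5"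
    and "fps_nth (t 0) 1 = 24"
    and "fps_nth (t 4) 0 = 0"
    and "fps_nth (t 5) 0 \<noteq> 0"
  shows "algebraically_independent_fps {0..6} t"
proof -
  obtain c z where c: "c \<noteq> 0" and z0: "fps_nth z 0 = 0" and t4: "t 4 = z * t 0 ^ 5"
    and t: "\<And>i. i \<in> {0..6} \<Longrightarrow> t i = t_series c i oo z"
    using dwork_system_eq_t_series[OF assms(1,2,4,5)] by blast
  \<comment> \<open>Composition with \<open>z\<close> has to be injective in order to move a
    relation from q to z. If \<open>z\<close> were 0, then t_0 would be constant, against its
    coefficient 24.\<close>
  have "z \<noteq> 0"
  proof
    assume "z = 0"
    then have "t 0 = fps_const (fps_nth (t_series c 0) 0)" using t[of 0] by simp
    then show False using assms(3) by (metis fps_nth_fps_const zero_neq_numeral zero_neq_one)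
  qed
  have "P = 0" if P: "poly_indets P \<subseteq> {0..6}" "poly_eval_fps t P = 0" for P
  proof -
    have "poly_eval_fps (t_series c) P oo z = poly_eval_fps t P"
      unfolding poly_eval_fps_compose[OF z0] unfolding poly_eval_fps_def
    proof (intro sum.cong refl arg_cong2[where f = "(*)"] prod.cong)
      fix m i assume "m \<in> Poly_Mapping.keys P" "i \<in> Poly_Mapping.keys m"
      then have "i \<in> {0..6}" using P(1) by (auto simp: poly_indets_def)
      then show "(t_series c i oo z) ^ Poly_Mapping.lookup m i = t i ^ Poly_Mapping.lookup m i" by (simp add: t)
    qed
    then have zero: "poly_eval_fps (t_series c) P = 0"
      using P(2) \<open>z \<noteq> 0\<close> fps_compose_eq_0_iff[OF z0] by simp
    have "relation P c (vec4 1 0 0 0) (vec4 0 1 0 0)"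
      unfolding relation_def
    proof
      fix x assume x: "x \<in> lens"
      have "meval P (\<lambda>i. eval_fps (t_series c i) x) = 0"
        using eval_fps_poly_eval[of 1 "t_series c" x P] t_series_conv zero x
        by (simp add: lens_iff)
      then show "meval P (sol_values c x (frob_sol x (Ln x) (vec4 1 0 0 0)) (frob_sol x (Ln x) (vec4 0 1 0 0))) = 0"
        by (simp only: eval_t_series[OF x, of c _ "Ln x"])
    qed
    then show "P = 0" using c P(1) by (rule poly_eq_0_if_relation)
  qed
  then show ?thesis unfolding algebraically_independent_fps_def by blast
qed

end
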